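(* Let $1<p<N$, let $\Omega\subset\mathbb{R}^N$ be a bounded, strictly convex, open set with $C^2$ boundary and $0\in\overline{\Omega}$, and let $f:\overline{\Omega}\times\mathbb{R}\to\mathbb{R}$ be a Carathéodory function. Assume: (H0)' $|f(x,s)|\le |x|^{-\mu}\,\tilde f(s)$, where $\mu\in(0,p)$, and $\tilde f:\mathbb{R}\to[0,+\infty)$ is continuous, satisfies $\tilde f(s)>0$ for $|s|>s_0$ (for some $s_0\ge 0$), and $$\lim_{|s|\to\infty}\frac{\tilde f(s)}{|s|^{p^*_\mu-1}}=0;$$ (H1) there is a constant $c_0>0$ such that $$\limsup_{s\to+\infty}\frac{\max_{[-s,s]}\tilde f}{\max\{\tilde f(-s),\tilde f(s)\}}\le c_0 .$$ Let $\{u_k\}\subset W_0^{1,p}(\Omega)$ be any sequence of weak solutions of $-\Delta_p u=f(x,u)$ in $\Omega$, $u=0$ on $\partial\Omega$, such that there exists a constant $C_0>0$ with $\|u_k\|_{p^*}\le C_0$ for all $k$. Then there exists a constant $C>0$ such that $\|u_k\|_\infty\le C$ for all $k$.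
   Context: $\Delta_p u=\operatorname{div}(|\nabla u|^{p-2}\nabla u)$ is the $p$-Laplacian. $p^*=\frac{Np}{N-p}$ is the critical Sobolev exponent, $(p^* )'=\frac{p^*}{p^*-1}$, and $p^*_\mu:=\frac{p(N-\mu)}{N-p}$ is the critical Hardy–Sobolev exponent. $\|\cdot\|_q$ denotes the norm of $L^q(\Omega)$. $f$ is Carathéodory: $f(\cdot,s)$ is measurable for all $s\in\mathbb{R}$ and $f(x,\cdot)$ is continuous for almost all $x\in\Omega$. A weak solution is $u\in W_0^{1,p}(\Omega)$ such that $f(\cdot,u)\in L^{(p^* )'}(\Omega)$ and $\int_\Omega|\nabla u|^{p-2}\nabla u\cdot\nabla\varphi\,dx=\int_\Omega f(x,u)\varphi\,dx$ for all $\varphi\in W_0^{1,p}(\Omega)$. *)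

theory Defs
  imports "HOL-Analysis.Analysis" "HOL-Probability.Essential_Supremum"
begin

text \<open>
  The space \<open>R^N\<close> is an arbitrary type of class \<open>euclidean_space\<close>, with \<open>N = DIM('a)\<close>.
  Elements of Lebesgue and Sobolev spaces on \<open>\<Omega>\<close> are represented by total functions, of which only
  the restriction to \<open>\<Omega>\<close>, up to Lebesgue null sets, matters.
\<close>

section \<open>Exponents\<close>

definition critical_exponent :: "real \<Rightarrow> real \<Rightarrow> real" where
  "critical_exponent N p = N * p / (N - p)"

definition conj_exponent :: "real \<Rightarrow> real" where
  "conj_exponent q = q / (q - 1)"

definition hardy_sobolev_exponent :: "real \<Rightarrow> real \<Rightarrow> real \<Rightarrow> real" where
  "hardy_sobolev_exponent N p \<mu> = p * (N - \<mu>) / (N - p)"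

section \<open>Functions of class \<open>C^k\<close> and the domain\<close>

definition partial_deriv :: "'a::euclidean_space \<Rightarrow> ('a \<Rightarrow> real) \<Rightarrow> 'a \<Rightarrow> real" where
  "partial_deriv b g x = frechet_derivative g (at x) b"

primrec C_diff :: "nat \<Rightarrow> ('a::euclidean_space \<Rightarrow> real) \<Rightarrow> bool" where
  "C_diff 0 g \<longleftrightarrow> continuous_on UNIV g"
| "C_diff (Suc k) g \<longleftrightarrow>
     (\<forall>x. g differentiable (at x)) \<and> (\<forall>b\<in>Basis. C_diff k (partial_deriv b g))"

text \<open>
  Near each boundary point, \<open>\<Omega>\<close> is the part of a ball lying above a \<open>C^2\<close> graph over the
  hyperplane orthogonal to a unit vector \<open>\<nu>\<close>.  The function \<open>\<gamma>\<close> is evaluated only on that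
  hyperplane; a \<open>C^2\<close> function on the hyperplane extends to the whole space by making it
  constant along \<open>\<nu>\<close>, so asking for \<open>\<gamma>\<close> to be \<open>C^2\<close> on the whole space is no restriction.
\<close>
definition C2_boundary :: "'a::euclidean_space set \<Rightarrow> bool" where
  "C2_boundary \<Omega> \<longleftrightarrow>
     (\<forall>x0\<in>frontier \<Omega>. \<exists>r>0. \<exists>\<nu> \<gamma>. norm \<nu> = 1 \<and> C_diff 2 \<gamma> \<and>
        \<Omega> \<inter> ball x0 r = {x \<in> ball x0 r. \<gamma> (x - (x \<bullet> \<nu>) *\<^sub>R \<nu>) < x \<bullet> \<nu>})"

text \<open>
  The end points range over the closure: with end points in an open set \<open>S\<close> itself the
  condition would be plain convexity.
\<close>
definition strictly_convex :: "'a::euclidean_space set \<Rightarrow> bool" where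
  "strictly_convex S \<longleftrightarrow>
     (\<forall>x\<in>closure S. \<forall>y\<in>closure S. x \<noteq> y \<longrightarrow> open_segment x y \<subseteq> interior S)"

section \<open>Lebesgue spaces\<close>

definition in_Lp :: "'a measure \<Rightarrow> real \<Rightarrow> ('a \<Rightarrow> 'b::real_normed_vector) \<Rightarrow> bool" where
  "in_Lp M q u \<longleftrightarrow> u \<in> borel_measurable M \<and> integrable M (\<lambda>x. norm (u x) powr q)"

definition Lp_norm :: "'a measure \<Rightarrow> real \<Rightarrow> ('a \<Rightarrow> 'b::real_normed_vector) \<Rightarrow> ereal" where
  "Lp_norm M q u =
     (if in_Lp M q u then ereal ((\<integral>x. norm (u x) powr q \<partial>M) powr (1 / q)) else \<infinity>)"

definition Linf_norm :: "'a measure \<Rightarrow> ('a \<Rightarrow> real) \<Rightarrow> ereal" where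
  "Linf_norm M u = esssup M (\<lambda>x. ereal \<bar>u x\<bar>)"

section \<open>Sobolev spaces\<close>

definition test_function :: "'a::euclidean_space set \<Rightarrow> ('a \<Rightarrow> real) \<Rightarrow> bool" where
  "test_function \<Omega> \<phi> \<longleftrightarrow>
     (\<forall>k. C_diff k \<phi>) \<and> compact (closure {x. \<phi> x \<noteq> 0}) \<and> closure {x. \<phi> x \<noteq> 0} \<subseteq> \<Omega>"

definition locally_integrable ::
    "'a::euclidean_space set \<Rightarrow> ('a \<Rightarrow> 'b::{banach, second_countable_topology}) \<Rightarrow> bool" where
  "locally_integrable \<Omega> u \<longleftrightarrow> (\<forall>K. compact K \<and> K \<subseteq> \<Omega> \<longrightarrow> set_integrable lebesgue K u)"

definition has_weak_gradient ::
    "'a::euclidean_space set \<Rightarrow> ('a \<Rightarrow> real) \<Rightarrow> ('a \<Rightarrow> 'a) \<Rightarrow> bool" where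
  "has_weak_gradient \<Omega> u G \<longleftrightarrow>
     locally_integrable \<Omega> u \<and> locally_integrable \<Omega> G \<and>
     (\<forall>\<phi>. test_function \<Omega> \<phi> \<longrightarrow> (\<forall>b\<in>Basis.
        (\<integral>x. u x * partial_deriv b \<phi> x \<partial>lebesgue_on \<Omega>)
          = - (\<integral>x. (G x \<bullet> b) * \<phi> x \<partial>lebesgue_on \<Omega>)))"

text \<open>
  The weak gradient is determined only almost everywhere; any representative serves, and the value
  is meaningless for functions that are not weakly differentiable.
\<close>
definition weak_grad :: "'a::euclidean_space set \<Rightarrow> ('a \<Rightarrow> real) \<Rightarrow> 'a \<Rightarrow> 'a" where
  "weak_grad \<Omega> u = (SOME G. has_weak_gradient \<Omega> u G)"

definition W1p :: "'a::euclidean_space set \<Rightarrow> real \<Rightarrow> ('a \<Rightarrow> real) set" where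
  "W1p \<Omega> p = {u. in_Lp (lebesgue_on \<Omega>) p u \<and>
                  (\<exists>G. has_weak_gradient \<Omega> u G \<and> in_Lp (lebesgue_on \<Omega>) p G)}"

definition W1p_norm :: "'a::euclidean_space set \<Rightarrow> real \<Rightarrow> ('a \<Rightarrow> real) \<Rightarrow> ereal" where
  "W1p_norm \<Omega> p u = Lp_norm (lebesgue_on \<Omega>) p u + Lp_norm (lebesgue_on \<Omega>) p (weak_grad \<Omega> u)"

definition W0_1p :: "'a::euclidean_space set \<Rightarrow> real \<Rightarrow> ('a \<Rightarrow> real) set" where
  "W0_1p \<Omega> p = {u \<in> W1p \<Omega> p. \<forall>e>0. \<exists>\<phi>. test_function \<Omega> \<phi> \<and>
                    W1p_norm \<Omega> p (\<lambda>x. u x - \<phi> x) < ereal e}"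

section \<open>The boundary value problem\<close>

definition caratheodory :: "'a::euclidean_space set \<Rightarrow> ('a \<Rightarrow> real \<Rightarrow> real) \<Rightarrow> bool" where
  "caratheodory \<Omega> f \<longleftrightarrow>
     (\<forall>s. (\<lambda>x. f x s) \<in> borel_measurable (lebesgue_on (closure \<Omega>))) \<and>
     (AE x in lebesgue_on \<Omega>. continuous_on UNIV (f x))"

text \<open>
  Where the gradient vanishes, \<open>norm G powr (p - 2) *\<^sub>R G\<close> is \<open>0\<close> also for \<open>p < 2\<close>, as intended.
\<close>
definition weak_solution ::
    "'a::euclidean_space set \<Rightarrow> real \<Rightarrow> ('a \<Rightarrow> real \<Rightarrow> real) \<Rightarrow> ('a \<Rightarrow> real) \<Rightarrow> bool" where
  "weak_solution \<Omega> p f u \<longleftrightarrow>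
     u \<in> W0_1p \<Omega> p \<and>
     in_Lp (lebesgue_on \<Omega>) (conj_exponent (critical_exponent (real DIM('a)) p)) (\<lambda>x. f x (u x)) \<and>
     (\<forall>\<phi>\<in>W0_1p \<Omega> p.
        (\<integral>x. (norm (weak_grad \<Omega> u x) powr (p - 2) *\<^sub>R weak_grad \<Omega> u x) \<bullet> weak_grad \<Omega> \<phi> x
            \<partial>lebesgue_on \<Omega>)
          = (\<integral>x. f x (u x) * \<phi> x \<partial>lebesgue_on \<Omega>))"

text \<open>
  The bound is imposed away from the origin, where the weight is infinite; Isabelle's convention
  \<open>0 powr a = 0\<close> would otherwise force \<open>f 0 s = 0\<close>.
\<close>
definition hypothesis_H0' ::
    "'a::euclidean_space set \<Rightarrow> real \<Rightarrow> real \<Rightarrow> ('a \<Rightarrow> real \<Rightarrow> real) \<Rightarrow> (real \<Rightarrow> real) \<Rightarrow> bool" where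
  "hypothesis_H0' \<Omega> p \<mu> f ft \<longleftrightarrow>
     0 < \<mu> \<and> \<mu> < p \<and>
     (\<forall>x\<in>closure \<Omega> - {0}. \<forall>s. \<bar>f x s\<bar> \<le> norm x powr (- \<mu>) * ft s) \<and>
     continuous_on UNIV ft \<and> (\<forall>s. 0 \<le> ft s) \<and>
     (\<exists>s0\<ge>0. \<forall>s. \<bar>s\<bar> > s0 \<longrightarrow> ft s > 0) \<and>
     ((\<lambda>s. ft s / \<bar>s\<bar> powr (hardy_sobolev_exponent (real DIM('a)) p \<mu> - 1)) \<longlongrightarrow> 0) at_infinity"

text \<open>The supremum over \<open>[-s, s]\<close> is a maximum, as it is used for continuous \<open>ft\<close> and \<open>s \<ge> 0\<close> only.\<close>
definition hypothesis_H1 :: "(real \<Rightarrow> real) \<Rightarrow> bool" where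
  "hypothesis_H1 ft \<longleftrightarrow>
     (\<exists>c0>0. Limsup at_top (\<lambda>s. ereal ((SUP t\<in>{-s..s}. ft t) / max (ft (-s)) (ft s))) \<le> ereal c0)"

end

theory Submission
  imports Defs "HOL-Computational_Algebra.Polynomial"
begin

text \<open>
  Write \<open>a t\<close> for the measure of \<open>{|u| > t}\<close> and \<open>F k\<close> for the integral of \<open>|f(x,u)|\<close> over \<open>{|u| > k}\<close>.
  Testing the equation with a smooth odd truncation \<open>w\<close> of \<open>u\<close> between the levels \<open>k\<close> and \<open>k + d\<close>, and
  bounding the level sets of \<open>w\<close> through the translation estimate
  \<open>\<parallel>w(\<cdot> + z) - w\<parallel>\<^sub>1 \<le> |z| \<parallel>\<nabla>w\<parallel>\<^sub>1\<close> averaged over a ball of volume \<open>2 a k\<close>, gives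
  \<open>d a(k + d) \<le> C a(k)^(1/N + 1 - 1/p) (d F(k))^(1/p)\<close>.  Splitting \<open>{|u| > k}\<close> dyadically and using
  \<open>\<integral>\<^sub>A |x|^(-\<mu>) \<le> C |A|^(1 - \<mu>/N)\<close>, the growth condition bounds \<open>F k\<close> by \<open>\<epsilon>\<close> times an expression in \<open>a\<close>
  that has exactly the scaling of the critical norm.  Hence \<open>sup\<^bsub>t \<ge> k\<^esub> t^(p*) a t\<close> shrinks by any
  prescribed factor when \<open>k\<close> is doubled, so that \<open>a\<close> decays faster than any given power, uniformly in \<open>u\<close>.
  The recursion for \<open>a\<close> then becomes superlinear, and Stampacchia's lemma makes \<open>a\<close> vanish at a finite
  level.  Sobolev's and Hardy's inequalities are not needed.
\<close>

section \<open>Smooth functions\<close>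

text \<open>A bound in the critical norm alone does not exclude concentration at high levels: the
  recursion for \<open>a\<close> is invariant under the critical scaling, so the powers of the level
  cancel and iteration by itself gains nothing. Smallness can come only from the factor
  \<open>\<epsilon>\<close>, which the growth condition grants above some threshold. That threshold
  is read off from \<open>ft\<close>, and \<open>\<epsilon>\<close> is fixed by the constants of the
  problem, so neither depends on the solution; this is the source of uniformity. Once
  \<open>a\<close> has strong power decay, a small part of its exponent pays for the convergence of
  the dyadic sum, and what remains still exceeds 1 because \<open>\<mu> < p\<close>. The truncation
  is smooth rather than piecewise linear because \<open>W0_1p\<close> is defined through test
  functions: a smooth function vanishing at 0, composed with a test function, is again a test
  function. Since \<open>weak_grad\<close> is an arbitrary choice of a weak gradient, no gradient
  can be computed before uniqueness almost everywhere is known.\<close>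

lemma partial_deriv_eq:
  assumes "(g has_derivative D) (at x)"
  shows "partial_deriv b g x = D b"
  using frechet_derivative_at[OF assms] by (simp add: partial_deriv_def)

lemma C_diff_imp_continuous: "C_diff k g \<Longrightarrow> continuous_on UNIV g"
  by (cases k) (auto intro!: differentiable_imp_continuous_on simp: differentiable_on_def)

lemma C_diff_SucD: "C_diff (Suc k) g \<Longrightarrow> C_diff k g"
proof (induction k arbitrary: g)
  case 0
  then show ?case using C_diff_imp_continuous by fastforce
next
  case (Suc k)
  then show ?case by (metis C_diff.simps(2))
qed

lemma C_diff_has_derivative:
  assumes "C_diff (Suc k) g"
  shows "(g has_derivative (\<lambda>h. \<Sum>b\<in>Basis. (h \<bullet> b) * partial_deriv b g x)) (at x)"
proof -
  have d: "(g has_derivative frechet_derivative g (at x)) (at x)"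
    using assms by (auto simp: frechet_derivative_works)
  have "frechet_derivative g (at x) h = (\<Sum>b\<in>Basis. (h \<bullet> b) * partial_deriv b g x)" for h
  proof -
    have "linear (frechet_derivative g (at x))"
      using d has_derivative_bounded_linear bounded_linear.linear by blast
    then have "frechet_derivative g (at x) (\<Sum>b\<in>Basis. (h \<bullet> b) *\<^sub>R b)
        = (\<Sum>b\<in>Basis. (h \<bullet> b) * frechet_derivative g (at x) b)"
      by (simp add: linear_sum linear_cmul)
    then show ?thesis
      by (simp add: euclidean_representation partial_deriv_def)
  qed
  then have "frechet_derivative g (at x) = (\<lambda>h. \<Sum>b\<in>Basis. (h \<bullet> b) * partial_deriv b g x)"
    by (rule ext)
  then show ?thesis
    using d by simp
qed

lemma C_diff_SucI:
  assumes "\<And>x. (g has_derivative D x) (at x)" "\<And>b. b \<in> Basis \<Longrightarrow> C_diff k (\<lambda>x. D x b)"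
  shows "C_diff (Suc k) g"
proof -
  have "partial_deriv b g = (\<lambda>x. D x b)" for b
    using assms(1) partial_deriv_eq by blast
  then show ?thesis
    using assms by (auto simp: differentiable_def)
qed

lemma C_diff_const [simp]: "C_diff k (\<lambda>x. c)"
proof (induction k arbitrary: c)
  case (Suc k)
  show ?case
    by (rule C_diff_SucI[where D = "\<lambda>_ _. 0"]) (auto simp: Suc)
qed auto

lemma C_diff_inner [simp]: "C_diff k (\<lambda>x. x \<bullet> c)"
proof (cases k)
  case (Suc k)
  show ?thesis unfolding Suc
    by (rule C_diff_SucI[where D = "\<lambda>_ h. h \<bullet> c"]) (auto intro!: derivative_eq_intros)
qed (auto intro!: continuous_intros)

lemma C_diff_add: "C_diff k f \<Longrightarrow> C_diff k g \<Longrightarrow> C_diff k (\<lambda>x. f x + g x)"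
proof (induction k arbitrary: f g)
  case 0
  then show ?case by (auto intro!: continuous_intros)
next
  case (Suc k)
  show ?case
  proof (rule C_diff_SucI)
    show "((\<lambda>x. f x + g x) has_derivative (\<lambda>h. frechet_derivative f (at x) h + frechet_derivative g (at x) h)) (at x)" for x
      using Suc.prems by (intro has_derivative_add) (auto simp: frechet_derivative_works)
    show "C_diff k (\<lambda>x. frechet_derivative f (at x) b + frechet_derivative g (at x) b)" if "b \<in> Basis" for b
      using Suc.prems that by (intro Suc.IH) (auto simp: partial_deriv_def[abs_def])
  qed
qed

lemma C_diff_mult: "C_diff k f \<Longrightarrow> C_diff k g \<Longrightarrow> C_diff k (\<lambda>x. f x * g x)"
proof (induction k arbitrary: f g)
  case 0
  then show ?case by (auto intro!: continuous_intros)
next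
  case (Suc k)
  show ?case
  proof (rule C_diff_SucI)
    show "((\<lambda>x. f x * g x) has_derivative (\<lambda>h. f x * frechet_derivative g (at x) h + frechet_derivative f (at x) h * g x)) (at x)" for x
      using Suc.prems by (intro has_derivative_mult) (auto simp: frechet_derivative_works)
    show "C_diff k (\<lambda>x. f x * frechet_derivative g (at x) b + frechet_derivative f (at x) b * g x)" if "b \<in> Basis" for b
      using Suc.prems that
      using C_diff_SucD[OF Suc.prems(1)] C_diff_SucD[OF Suc.prems(2)]
      by (intro C_diff_add Suc.IH) (auto simp: partial_deriv_def[abs_def])
  qed
qed

lemma C_diff_prod: "(\<And>i. i \<in> I \<Longrightarrow> C_diff k (f i)) \<Longrightarrow> C_diff k (\<lambda>x. \<Prod>i\<in>I. f i x)"
  by (induction I rule: infinite_finite_induct) (auto intro: C_diff_mult)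

text \<open>The outer function comes with its whole tower of derivatives, and the claim is made for
  every \<open>i\<close>: differentiating \<open>F i (g x)\<close> produces
  \<open>F (Suc i) (g x)\<close>, so the induction on \<open>k\<close> has to shift the index.
  \<open>smooth\<close> packages such a tower.\<close>

lemma C_diff_compose:
  assumes "\<And>i t. (F i has_real_derivative F (Suc i) t) (at t)" and "C_diff k g"
  shows "C_diff k (\<lambda>x. F i (g x))"
  using assms(2)
proof (induction k arbitrary: i)
  case 0
  have "continuous_on UNIV (F i)"
    using assms(1) by (meson DERIV_continuous_on has_field_derivative_at_within)
  then show ?case
    using 0 continuous_on_compose2[of UNIV "F i" UNIV g] by auto
next
  case (Suc k)
  show ?case
  proof (rule C_diff_SucI)
    show "((\<lambda>x. F i (g x)) has_derivative (\<lambda>h. F (Suc i) (g x) * frechet_derivative g (at x) h)) (at x)" for x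
      using has_derivative_compose[of g _ x UNIV "F i" "(*) (F (Suc i) (g x))"] Suc.prems assms(1)
      by (auto simp: frechet_derivative_works has_field_derivative_def)
    show "C_diff k (\<lambda>x. F (Suc i) (g x) * frechet_derivative g (at x) b)" if "b \<in> Basis" for b
      using Suc.prems that
      using C_diff_SucD[OF Suc.prems]
      by (intro C_diff_mult Suc.IH) (auto simp: partial_deriv_def[abs_def])
  qed
qed

section \<open>Smooth functions of one variable and a flat step\<close>

definition smooth :: "(real \<Rightarrow> real) \<Rightarrow> bool" where
  "smooth H \<longleftrightarrow> (\<exists>F. F 0 = H \<and> (\<forall>i t. (F i has_real_derivative F (Suc i) t) (at t)))"

lemma C_diff_smooth: "smooth H \<Longrightarrow> C_diff k g \<Longrightarrow> C_diff k (\<lambda>x. H (g x))"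
  unfolding smooth_def using C_diff_compose by blast

lemma smooth_affine:
  assumes "smooth H"
  shows "smooth (\<lambda>t. d * H (c * t + e))"
proof -
  obtain F where F: "F 0 = H" "\<And>i t. (F i has_real_derivative F (Suc i) t) (at t)"
    using assms unfolding smooth_def by blast
  have "((\<lambda>t. d * c ^ i * F i (c * t + e)) has_real_derivative d * c ^ Suc i * F (Suc i) (c * t + e)) (at t)" for i t
    by (auto intro!: derivative_eq_intros DERIV_chain2[OF F(2)])
  then show ?thesis
    unfolding smooth_def using F(1)
    by (intro exI[of _ "\<lambda>i t. d * c ^ i * F i (c * t + e)"]) (auto simp: mult_ac)
qed

lemma smooth_diff:
  assumes "smooth H" "smooth G"
  shows "smooth (\<lambda>t. H t - G t)"
proof -
  obtain F where F: "F 0 = H" "\<And>i t. (F i has_real_derivative F (Suc i) t) (at t)"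
    using assms unfolding smooth_def by blast
  obtain E where E: "E 0 = G" "\<And>i t. (E i has_real_derivative E (Suc i) t) (at t)"
    using assms unfolding smooth_def by blast
  show ?thesis
    unfolding smooth_def using F E
    by (intro exI[of _ "\<lambda>i t. F i t - E i t"]) (auto intro: DERIV_diff)
qed

text \<open>This class is closed under differentiation: with s = 1/t, the derivative replaces P by
  s^2 (P - P'). So every derivative of the step below has a closed form.\<close>

definition flat :: "real poly \<Rightarrow> real \<Rightarrow> real" where
  "flat P t = (if 0 < t then poly P (1 / t) * exp (- (1 / t)) else 0)"

lemma poly_exp_tendsto_0: "((\<lambda>s. poly P s * exp (- s)) \<longlongrightarrow> (0::real)) at_top"
proof -
  have "((\<lambda>s. \<Sum>i\<le>degree P. coeff P i * (s ^ i / exp s)) \<longlongrightarrow> (\<Sum>i\<le>degree P. coeff P i * 0)) at_top"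
    by (intro tendsto_sum tendsto_mult tendsto_const tendsto_power_div_exp_0)
  then show ?thesis
    by (simp add: poly_altdef exp_minus sum_distrib_right divide_inverse mult.assoc)
qed

lemma flat_tendsto_0: "(flat P \<longlongrightarrow> 0) (at 0)"
proof -
  have "((\<lambda>t. poly P (inverse t) * exp (- inverse t)) \<longlongrightarrow> 0) (at_right 0)"
    by (rule filterlim_compose[OF poly_exp_tendsto_0 filterlim_inverse_at_top_right])
  then have "(flat P \<longlongrightarrow> 0) (at_right 0)"
    by (rule Lim_transform_eventually)
       (auto simp: flat_def eventually_at_filter divide_inverse)
  moreover have "(flat P \<longlongrightarrow> 0) (at_left 0)"
    by (rule Lim_transform_eventually[OF tendsto_const])
       (auto simp: flat_def eventually_at_filter)
  ultimately show ?thesis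
    by (simp add: filterlim_split_at)
qed

lemma DERIV_flat: "(flat P has_real_derivative flat ([:0, 0, 1:] * (P - pderiv P)) t) (at t)"
proof -
  consider "t > 0" | "t < 0" | "t = 0" by linarith
  then show ?thesis
  proof cases
    case 1
    have "((\<lambda>t. poly P (1 / t) * exp (- (1 / t))) has_real_derivative
        flat ([:0, 0, 1:] * (P - pderiv P)) t) (at t)"
      using 1 by (auto intro!: derivative_eq_intros DERIV_chain2[OF poly_DERIV] simp: flat_def field_simps power2_eq_square)
    then show ?thesis
      by (rule DERIV_cong_ev[THEN iffD1, rotated -1])
         (use 1 eventually_nhds_in_open[of "{0<..}" t] in \<open>auto simp: flat_def elim!: eventually_mono\<close>)
  next
    case 2
    have "((\<lambda>t. 0) has_real_derivative flat ([:0, 0, 1:] * (P - pderiv P)) t) (at t)"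
      using 2 by (auto simp: flat_def)
    then show ?thesis
      by (rule DERIV_cong_ev[THEN iffD1, rotated -1])
         (use 2 eventually_nhds_in_open[of "{..<0}" t] in \<open>auto simp: flat_def elim!: eventually_mono\<close>)
  next
    case 3
    \<comment> \<open>The difference quotient at 0 belongs to the same class, with the polynomial X
      P, and so tends to 0.\<close>
    have "(flat P t - flat P 0) / (t - 0) = flat ([:0, 1:] * P) t" for t
      by (auto simp: flat_def)
    then show ?thesis
      unfolding 3 has_field_derivative_iff using flat_tendsto_0[of "[:0, 1:] * P"]
      by (simp add: flat_def[of _ 0])
  qed
qed

lemma smooth_flat: "smooth (flat P)"
  unfolding smooth_def
proof (intro exI[of _ "\<lambda>i. flat (((\<lambda>Q. [:0, 0, 1:] * (Q - pderiv Q)) ^^ i) P)"] conjI allI)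
  show "flat (((\<lambda>Q. [:0, 0, 1:] * (Q - pderiv Q)) ^^ 0) P) = flat P" by simp
  show "(flat (((\<lambda>Q. [:0, 0, 1:] * (Q - pderiv Q)) ^^ i) P) has_real_derivative
      flat (((\<lambda>Q. [:0, 0, 1:] * (Q - pderiv Q)) ^^ Suc i) P) t) (at t)" for i t
    using DERIV_flat[of "((\<lambda>Q. [:0, 0, 1:] * (Q - pderiv Q)) ^^ i) P" t] by simp
qed

text \<open>The step approaches 1 without reaching it. What counts is flatness at 0, monotonicity, a
  bounded derivative, and the value 1/e at 1.\<close>

definition smoothstep :: "real \<Rightarrow> real" where
  "smoothstep t = (if 0 < t then exp (- (1 / t)) else 0)"

definition smoothstep_deriv :: "real \<Rightarrow> real" where
  "smoothstep_deriv t = (if 0 < t then (1 / t)\<^sup>2 * exp (- (1 / t)) else 0)"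

lemma smoothstep_flat: "smoothstep = flat 1"
  by (auto simp: smoothstep_def flat_def)

lemma smooth_smoothstep: "smooth smoothstep"
  by (simp add: smoothstep_flat smooth_flat)

lemma DERIV_smoothstep: "(smoothstep has_real_derivative smoothstep_deriv t) (at t)"
proof -
  have "flat ([:0, 0, 1:] * (1 - pderiv 1)) t = smoothstep_deriv t"
    by (auto simp: flat_def smoothstep_deriv_def power2_eq_square)
  then show ?thesis
    using DERIV_flat[of 1 t] by (simp add: smoothstep_flat)
qed

lemma smoothstep_bounds: "0 \<le> smoothstep t" "smoothstep t \<le> 1"
  by (auto simp: smoothstep_def)

lemma smoothstep_mono: "s \<le> t \<Longrightarrow> smoothstep s \<le> smoothstep t"
  by (auto simp: smoothstep_def frac_le)

lemma smoothstep_tendsto_1: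
  assumes "0 < t"
  shows "(\<lambda>n. smoothstep (real n * t)) \<longlonglongrightarrow> 1"
proof -
  have "(\<lambda>n. exp (- ((1 / t) / real n))) \<longlonglongrightarrow> exp (- 0)"
    by (intro tendsto_exp tendsto_minus lim_const_over_n)
  then show ?thesis
    using assms
    by (auto simp: smoothstep_def mult.commute elim!: Lim_transform_eventually intro: eventually_mono[OF eventually_gt_at_top[of 0]])
qed

text \<open>With s = 1/t the upper bound reads s^2 <= 2 exp s, which is the quadratic Taylor
  bound.\<close>

lemma smoothstep_deriv_bounds: "0 \<le> smoothstep_deriv t" "smoothstep_deriv t \<le> 2"
proof -
  have "s\<^sup>2 \<le> 2 * exp s" if "0 \<le> s" for s :: real
    using exp_lower_Taylor_quadratic[OF that] that by linarith
  from this[of "1 / t"] have "(1 / t)\<^sup>2 * exp (- (1 / t)) \<le> 2" if "0 < t"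
    using that by (simp add: exp_minus divide_le_eq flip: divide_inverse)
  then show "0 \<le> smoothstep_deriv t" "smoothstep_deriv t \<le> 2"
    by (auto simp: smoothstep_deriv_def)
qed

lemma smoothstep_deriv_continuous: "continuous_on UNIV smoothstep_deriv"
proof -
  have "smoothstep_deriv = flat [:0, 0, 1:]"
    by (auto simp: smoothstep_deriv_def flat_def power2_eq_square)
  then show ?thesis
    using DERIV_flat by (metis DERIV_continuous_on has_field_derivative_at_within)
qed

section \<open>Test functions\<close>

definition grad :: "('a::euclidean_space \<Rightarrow> real) \<Rightarrow> 'a \<Rightarrow> 'a" where
  "grad g x = (\<Sum>b\<in>Basis. partial_deriv b g x *\<^sub>R b)"

lemma grad_inner_Basis: "b \<in> Basis \<Longrightarrow> grad g x \<bullet> b = partial_deriv b g x"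
  by (simp add: grad_def inner_sum_left inner_Basis if_distrib cong: if_cong)

lemma grad_eqI:
  assumes "(g has_derivative (\<lambda>h. v \<bullet> h)) (at x)"
  shows "grad g x = v"
  by (rule euclidean_eqI) (simp add: grad_inner_Basis partial_deriv_eq[OF assms])

lemma C_diff_grad: "C_diff (Suc k) g \<Longrightarrow> (g has_derivative (\<lambda>h. grad g x \<bullet> h)) (at x)"
proof -
  have "(\<lambda>h. grad g x \<bullet> h) = (\<lambda>h. \<Sum>b\<in>Basis. (h \<bullet> b) * partial_deriv b g x)"
    by (intro ext) (subst inner_commute, simp add: grad_def inner_sum_right mult.commute)
  then show "C_diff (Suc k) g \<Longrightarrow> (g has_derivative (\<lambda>h. grad g x \<bullet> h)) (at x)"
    using C_diff_has_derivative[of k g x] by simp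
qed

lemma C_diff_continuous_grad:
  assumes "C_diff (Suc k) g"
  shows "continuous_on UNIV (grad g)"
proof -
  have "continuous_on UNIV (\<lambda>x. partial_deriv b g x)" if "b \<in> Basis" for b
    using assms that C_diff_imp_continuous by auto
  then show ?thesis
    unfolding grad_def[abs_def] by (intro continuous_intros)
qed

lemma test_function_has_derivative:
  "test_function \<Omega> \<phi> \<Longrightarrow> (\<phi> has_derivative (\<lambda>h. grad \<phi> x \<bullet> h)) (at x)"
  by (rule C_diff_grad[of 0]) (simp only: test_function_def)

lemma test_function_continuous: "test_function \<Omega> \<phi> \<Longrightarrow> continuous_on UNIV \<phi>"
  by (rule C_diff_imp_continuous[of 0]) (simp only: test_function_def)

lemma test_function_continuous_grad: "test_function \<Omega> \<phi> \<Longrightarrow> continuous_on UNIV (grad \<phi>)"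
  by (rule C_diff_continuous_grad[of 0]) (simp only: test_function_def)

lemma test_function_borel [measurable_dest]:
  "test_function \<Omega> \<phi> \<Longrightarrow> \<phi> \<in> borel_measurable borel"
  "test_function \<Omega> \<phi> \<Longrightarrow> grad \<phi> \<in> borel_measurable borel"
  by (auto intro: borel_measurable_continuous_onI test_function_continuous test_function_continuous_grad)

lemma test_functionE:
  assumes "test_function \<Omega> \<phi>"
  obtains K where "compact K" "K \<subseteq> \<Omega>" "\<And>x. x \<notin> K \<Longrightarrow> \<phi> x = 0" "\<And>x. x \<notin> K \<Longrightarrow> grad \<phi> x = 0"
proof -
  define K where "K = closure {x. \<phi> x \<noteq> 0}"
  have z: "\<phi> x = 0" if "x \<notin> K" for x
    using that closure_subset[of "{x. \<phi> x \<noteq> 0}"] by (auto simp: K_def)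
  have "grad \<phi> x = 0" if "x \<notin> K" for x
  proof (rule grad_eqI)
    have "open (- K)" by (simp add: K_def open_Compl)
    then have "((\<lambda>_. 0) has_derivative (\<lambda>h. 0 \<bullet> h)) (at x)" by simp
    then show "(\<phi> has_derivative (\<lambda>h. 0 \<bullet> h)) (at x)"
      by (rule has_derivative_transform_within_open[OF _ \<open>open (- K)\<close>]) (use that z in auto)
  qed
  moreover have "compact K" "K \<subseteq> \<Omega>"
    using assms by (simp_all add: test_function_def K_def)
  ultimately show ?thesis
    using that z by blast
qed

lemma test_functionI:
  assumes "\<And>k. C_diff k \<phi>" "compact K" "K \<subseteq> \<Omega>" "\<And>x. x \<notin> K \<Longrightarrow> \<phi> x = 0"
  shows "test_function \<Omega> \<phi>"
proof -
  have "closure {x. \<phi> x \<noteq> 0} \<subseteq> K"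
    using assms compact_imp_closed by (intro closure_minimal) auto
  then show ?thesis
    unfolding test_function_def using assms compact_Int_closed[of K "closure {x. \<phi> x \<noteq> 0}"]
    by (auto simp: Int_absorb1)
qed

lemma test_function_mult:
  assumes "test_function \<Omega> \<phi>" "test_function \<Omega> \<psi>"
  shows "test_function \<Omega> (\<lambda>x. \<phi> x * \<psi> x)"
proof -
  obtain K where "compact K" "K \<subseteq> \<Omega>" "\<And>x. x \<notin> K \<Longrightarrow> \<phi> x = 0" "\<And>x. x \<notin> K \<Longrightarrow> grad \<phi> x = 0"
    using test_functionE[OF assms(1)] by metis
  moreover have "C_diff k (\<lambda>x. \<phi> x * \<psi> x)" for k
    using assms by (simp add: C_diff_mult test_function_def)
  ultimately show ?thesis
    by (intro test_functionI[of _ K]) simp_all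
qed

lemma grad_mult:
  assumes "test_function \<Omega> \<phi>" "test_function \<Omega> \<psi>"
  shows "grad (\<lambda>x. \<phi> x * \<psi> x) x = \<phi> x *\<^sub>R grad \<psi> x + \<psi> x *\<^sub>R grad \<phi> x"
  by (rule grad_eqI)
    (use has_derivative_mult[OF assms[THEN test_function_has_derivative], of x] in
      \<open>simp add: inner_left_distrib mult.commute\<close>)

lemma test_function_smooth:
  assumes "test_function \<Omega> \<phi>" "smooth H" "H 0 = 0"
  shows "test_function \<Omega> (\<lambda>x. H (\<phi> x))"
proof -
  obtain K where "compact K" "K \<subseteq> \<Omega>" "\<And>x. x \<notin> K \<Longrightarrow> \<phi> x = 0" "\<And>x. x \<notin> K \<Longrightarrow> grad \<phi> x = 0"
    using test_functionE[OF assms(1)] by metis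
  moreover have "C_diff k (\<lambda>x. H (\<phi> x))" for k
    using assms by (simp add: C_diff_smooth test_function_def)
  ultimately show ?thesis
    using assms(3) by (intro test_functionI[of _ K]) simp_all
qed

lemma grad_compose:
  assumes "test_function \<Omega> \<phi>" "\<And>t. (H has_real_derivative H' t) (at t)"
  shows "grad (\<lambda>x. H (\<phi> x)) x = H' (\<phi> x) *\<^sub>R grad \<phi> x"
proof (rule grad_eqI)
  have "(H has_derivative (*) (H' (\<phi> x))) (at (\<phi> x))"
    using assms(2) by (simp add: has_field_derivative_def)
  from has_derivative_compose[OF test_function_has_derivative[OF assms(1)] this]
  show "((\<lambda>x. H (\<phi> x)) has_derivative (\<lambda>h. (H' (\<phi> x) *\<^sub>R grad \<phi> x) \<bullet> h)) (at x)"
    by (simp only: inner_scaleR_left)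
qed

section \<open>Integrals and translations of test functions\<close>

lemma integrable_compact_support:
  fixes f :: "'a::euclidean_space \<Rightarrow> 'b::euclidean_space"
  assumes "continuous_on UNIV f" "compact K" "\<And>x. x \<notin> K \<Longrightarrow> f x = 0"
  shows "integrable lborel f"
proof -
  have "integrable lborel (\<lambda>x. indicator K x *\<^sub>R f x)"
    using borel_integrable_compact[OF assms(2) continuous_on_subset[OF assms(1)]]
    by (simp add: indicator_scaleR_eq_if)
  moreover have "(\<lambda>x. indicator K x *\<^sub>R f x) = f"
    using assms(3) by (auto simp: indicator_def)
  ultimately show ?thesis by simp
qed

lemma integrable_test_function:
  assumes "test_function \<Omega> \<phi>"
  shows "integrable lborel \<phi>" "integrable lborel (grad \<phi>)"
proof -
  obtain K where "compact K" "K \<subseteq> \<Omega>" "\<And>x. x \<notin> K \<Longrightarrow> \<phi> x = 0" "\<And>x. x \<notin> K \<Longrightarrow> grad \<phi> x = 0"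
    using test_functionE[OF assms(1)] by metis
  then show "integrable lborel \<phi>" "integrable lborel (grad \<phi>)"
    using integrable_compact_support assms test_function_continuous test_function_continuous_grad by blast+
qed

lemma test_function_bounded:
  assumes "test_function \<Omega> \<phi>"
  obtains L where "0 < L" "\<And>x. \<bar>\<phi> x\<bar> \<le> L" "\<And>x. norm (grad \<phi> x) \<le> L"
proof -
  obtain K where K: "compact K" "K \<subseteq> \<Omega>" "\<And>x. x \<notin> K \<Longrightarrow> \<phi> x = 0" "\<And>x. x \<notin> K \<Longrightarrow> grad \<phi> x = 0"
    using test_functionE[OF assms(1)] by metis
  have "bounded (\<phi> ` K)" "bounded (grad \<phi> ` K)"
    using K(1) test_function_continuous[OF assms] test_function_continuous_grad[OF assms]
    by (auto intro!: compact_imp_bounded compact_continuous_image intro: continuous_on_subset)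
  then obtain L1 L2 where L: "\<And>x. x \<in> K \<Longrightarrow> \<bar>\<phi> x\<bar> \<le> L1" "\<And>x. x \<in> K \<Longrightarrow> norm (grad \<phi> x) \<le> L2"
    by (auto simp: bounded_iff)
  define L where "L = \<bar>L1\<bar> + \<bar>L2\<bar> + 1"
  have "\<bar>\<phi> x\<bar> \<le> L \<and> norm (grad \<phi> x) \<le> L" for x
    using L(1)[of x] L(2)[of x] K(3,4)[of x] by (cases "x \<in> K") (auto simp: L_def)
  then show ?thesis
    by (intro that[of L]) (auto simp: L_def)
qed

lemma test_function_lipschitz:
  assumes "test_function \<Omega> \<phi>" "\<And>x. norm (grad \<phi> x) \<le> L"
  shows "\<bar>\<phi> y - \<phi> x\<bar> \<le> L * norm (y - x)"
proof -
  have "norm (\<phi> y - \<phi> x) \<le> L * norm (y - x)"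
  proof (rule differentiable_bound[where S = UNIV])
    fix x
    show "(\<phi> has_derivative (\<lambda>h. grad \<phi> x \<bullet> h)) (at x within UNIV)"
      using test_function_has_derivative[OF assms(1)] by simp
    show "onorm (\<lambda>h. grad \<phi> x \<bullet> h) \<le> L"
      using Cauchy_Schwarz_ineq2[of "grad \<phi> x"] assms(2)[of x]
      by (intro onorm_le) (smt (verit) mult_right_mono norm_ge_zero real_norm_def)
  qed auto
  then show ?thesis by simp
qed

text \<open>Dominated convergence: the Lipschitz bound makes each quotient at most L |z|, and all of
  them vanish outside the ball of radius R + |z|, which contains every shifted support. The signed
  limit serves integration by parts, the absolute one the translation estimate.\<close>

lemma difference_quotient_L1:
  fixes \<phi> :: "'a::euclidean_space \<Rightarrow> real"
  assumes "test_function \<Omega> \<phi>"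
  shows "(\<lambda>m. \<integral>x. real (Suc m) * (\<phi> (x + z /\<^sub>R real (Suc m)) - \<phi> x) \<partial>lborel) \<longlonglongrightarrow> (\<integral>x. grad \<phi> x \<bullet> z \<partial>lborel)"
    and "(\<lambda>m. \<integral>x. \<bar>real (Suc m) * (\<phi> (x + z /\<^sub>R real (Suc m)) - \<phi> x)\<bar> \<partial>lborel) \<longlonglongrightarrow> (\<integral>x. \<bar>grad \<phi> x \<bullet> z\<bar> \<partial>lborel)"
proof -
  define q where "q m x = real (Suc m) * (\<phi> (x + z /\<^sub>R real (Suc m)) - \<phi> x)" for m x
  note [measurable] = test_function_borel[OF assms]
  obtain K where K: "compact K" "K \<subseteq> \<Omega>" "\<And>x. x \<notin> K \<Longrightarrow> \<phi> x = 0" "\<And>x. x \<notin> K \<Longrightarrow> grad \<phi> x = 0"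
    using test_functionE[OF assms] by metis
  obtain L where L: "0 < L" "\<And>x. \<bar>\<phi> x\<bar> \<le> L" "\<And>x. norm (grad \<phi> x) \<le> L"
    using test_function_bounded[OF assms] by metis
  obtain R where R: "\<And>x. x \<in> K \<Longrightarrow> norm x \<le> R"
    using compact_imp_bounded[OF K(1)] by (auto simp: bounded_iff)
  define w where "w x = indicator (cball 0 (R + norm z)) x * (L * norm z)" for x :: 'a
  have w: "integrable lborel w"
    unfolding w_def by (intro integrable_mult_left integrable_real_indicator emeasure_compact_finite) auto
  have q_le: "\<bar>q m x\<bar> \<le> w x" for m x
  proof (cases "x \<in> cball 0 (R + norm z)")
    case True
    have "\<bar>q m x\<bar> = real (Suc m) * \<bar>\<phi> (x + z /\<^sub>R real (Suc m)) - \<phi> x\<bar>"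
      by (simp add: q_def abs_mult)
    also have "\<dots> \<le> real (Suc m) * (L * norm ((x + z /\<^sub>R real (Suc m)) - x))"
      by (intro mult_left_mono test_function_lipschitz[OF assms L(3)]) auto
    also have "\<dots> = L * norm z" by (simp add: divide_simps)
    finally show ?thesis using True by (simp add: w_def)
  next
    case False
    have "norm x \<le> norm (x + z /\<^sub>R real (Suc m)) + norm (z /\<^sub>R real (Suc m))"
      using norm_triangle_ineq4[of "x + z /\<^sub>R real (Suc m)" "z /\<^sub>R real (Suc m)"] by simp
    moreover have "norm (z /\<^sub>R real (Suc m)) \<le> norm z"
      by (simp add: divide_simps mult_le_cancel_left1)
    ultimately have "\<not> norm x \<le> R" "\<not> norm (x + z /\<^sub>R real (Suc m)) \<le> R"
      using False norm_ge_zero[of z] by (simp_all del: norm_scaleR norm_ge_zero of_nat_Suc)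
    then have "x \<notin> K" "x + z /\<^sub>R real (Suc m) \<notin> K"
      using R by blast+
    then show ?thesis using L(1) by (simp add: q_def K(3) w_def)
  qed
  have lim: "(\<lambda>m. q m x) \<longlonglongrightarrow> grad \<phi> x \<bullet> z" for x
  proof -
    have "((\<lambda>t. \<phi> (x + t *\<^sub>R z)) has_derivative (\<lambda>t. grad \<phi> x \<bullet> (t *\<^sub>R z))) (at 0)"
      using test_function_has_derivative[OF assms, of x]
      by (intro has_derivative_compose[of "\<lambda>t. x + t *\<^sub>R z" _ 0 UNIV \<phi>])
         (auto intro!: derivative_eq_intros)
    then have "((\<lambda>t. \<phi> (x + t *\<^sub>R z)) has_real_derivative grad \<phi> x \<bullet> z) (at 0)"
      by (simp add: has_field_derivative_def mult.commute[of _ "grad \<phi> x \<bullet> z"])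
    then have "((\<lambda>t. (\<phi> (x + t *\<^sub>R z) - \<phi> x) / t) \<longlongrightarrow> grad \<phi> x \<bullet> z) (at 0)"
      by (simp add: has_field_derivative_iff)
    moreover have "filterlim (\<lambda>m. inverse (real (Suc m))) (at 0) sequentially"
      using LIMSEQ_inverse_real_of_nat by (simp add: filterlim_at)
    ultimately have "(\<lambda>m. (\<phi> (x + inverse (real (Suc m)) *\<^sub>R z) - \<phi> x) / inverse (real (Suc m))) \<longlonglongrightarrow> grad \<phi> x \<bullet> z"
      by (rule filterlim_compose)
    then show ?thesis by (simp add: q_def[abs_def] divide_inverse mult.commute)
  qed
  have [measurable]: "q m \<in> borel_measurable borel" for m
    unfolding q_def by measurable
  have "(\<lambda>m. \<integral>x. q m x \<partial>lborel) \<longlonglongrightarrow> (\<integral>x. grad \<phi> x \<bullet> z \<partial>lborel)"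
    by (rule integral_dominated_convergence[OF _ _ w]) (simp_all add: lim q_le)
  moreover have "(\<lambda>m. \<integral>x. \<bar>q m x\<bar> \<partial>lborel) \<longlonglongrightarrow> (\<integral>x. \<bar>grad \<phi> x \<bullet> z\<bar> \<partial>lborel)"
    by (rule integral_dominated_convergence[OF _ _ w]) (simp_all add: lim q_le tendsto_rabs)
  ultimately show "(\<lambda>m. \<integral>x. real (Suc m) * (\<phi> (x + z /\<^sub>R real (Suc m)) - \<phi> x) \<partial>lborel) \<longlonglongrightarrow> (\<integral>x. grad \<phi> x \<bullet> z \<partial>lborel)"
    and "(\<lambda>m. \<integral>x. \<bar>real (Suc m) * (\<phi> (x + z /\<^sub>R real (Suc m)) - \<phi> x)\<bar> \<partial>lborel) \<longlonglongrightarrow> (\<integral>x. \<bar>grad \<phi> x \<bullet> z\<bar> \<partial>lborel)"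
    by (simp_all add: q_def)
qed

lemma integral_lborel_shift:
  fixes f :: "'a::euclidean_space \<Rightarrow> 'b::{banach, second_countable_topology}"
  assumes [measurable]: "f \<in> borel_measurable borel"
  shows "(\<integral>x. f (x + c) \<partial>lborel) = (\<integral>x. f x \<partial>lborel)"
    and "integrable lborel f \<Longrightarrow> integrable lborel (\<lambda>x. f (x + c))"
proof -
  have 1: "(\<integral>x. f x \<partial>distr lborel borel ((+) c)) = (\<integral>x. f (c + x) \<partial>lborel)"
    by (rule integral_distr) auto
  show "(\<integral>x. f (x + c) \<partial>lborel) = (\<integral>x. f x \<partial>lborel)"
    using 1 by (simp add: lborel_distr_plus add.commute)
  have 2: "integrable (distr lborel borel ((+) c)) f \<longleftrightarrow> integrable lborel (\<lambda>x. f (c + x))"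
    by (rule integrable_distr_eq) auto
  show "integrable lborel f \<Longrightarrow> integrable lborel (\<lambda>x. f (x + c))"
    using 2 by (simp add: lborel_distr_plus add.commute)
qed

text \<open>Translation invariance gives every difference quotient the integral 0, and the L1 limit
  hands this on to the gradient.\<close>

lemma integral_grad_eq_0:
  assumes "test_function \<Omega> \<phi>"
  shows "(\<integral>x. grad \<phi> x \<bullet> z \<partial>lborel) = 0"
proof -
  note [measurable] = test_function_borel[OF assms]
  note i = integrable_test_function(1)[OF assms]
  have "(\<integral>x. real (Suc m) * (\<phi> (x + z /\<^sub>R real (Suc m)) - \<phi> x) \<partial>lborel) = 0" for m
    using i integral_lborel_shift(1)[of \<phi> "z /\<^sub>R real (Suc m)"]
      integral_lborel_shift(2)[of \<phi> "z /\<^sub>R real (Suc m)"]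
    by (simp del: of_nat_Suc)
  then show ?thesis
    using difference_quotient_L1(1)[OF assms, of z] by (simp add: LIMSEQ_const_iff)
qed

text \<open>The left-hand side is subadditive in \<open>z\<close>, so it suffices to let \<open>z\<close> tend to \<open>0\<close> along a ray; this
  avoids Fubini's theorem.\<close>
lemma test_function_translation_L1:
  assumes "test_function \<Omega> \<phi>"
  shows "(\<integral>x. \<bar>\<phi> (x + z) - \<phi> x\<bar> \<partial>lborel) \<le> norm z * (\<integral>x. norm (grad \<phi> x) \<partial>lborel)"
proof -
  note [measurable] = test_function_borel[OF assms]
  note i = integrable_test_function[OF assms]
  define N where "N z = (\<integral>x. \<bar>\<phi> (x + z) - \<phi> x\<bar> \<partial>lborel)" for z
  have int: "integrable lborel (\<lambda>x. \<bar>\<phi> (x + a) - \<phi> (x + b)\<bar>)" for a b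
    by (intro integrable_abs Bochner_Integration.integrable_diff integral_lborel_shift(2) i) auto
  have sub: "N (a + b) \<le> N a + N b" for a b
  proof -
    have "N (a + b) \<le> (\<integral>x. \<bar>\<phi> (x + b + a) - \<phi> (x + b)\<bar> + \<bar>\<phi> (x + b) - \<phi> x\<bar> \<partial>lborel)"
      unfolding N_def using int[of "a + b" 0] int[of "b + a" b] int[of b 0]
      by (intro integral_mono) (simp_all add: add.assoc add.commute[of b a])
    also have "\<dots> = (\<integral>x. \<bar>\<phi> (x + b + a) - \<phi> (x + b)\<bar> \<partial>lborel) + N b"
      unfolding N_def using int[of "b + a" b] int[of b 0]
      by (intro Bochner_Integration.integral_add) (simp_all add: add.assoc)
    also have "(\<integral>x. \<bar>\<phi> (x + b + a) - \<phi> (x + b)\<bar> \<partial>lborel) = N a"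
      using integral_lborel_shift(1)[of "\<lambda>x. \<bar>\<phi> (x + a) - \<phi> x\<bar>" b] by (simp add: N_def)
    finally show ?thesis .
  qed
  have mult: "N (real m *\<^sub>R a) \<le> real m * N a" for m a
  proof (induction m)
    case (Suc m)
    then show ?case using sub[of "real m *\<^sub>R a" a] by (simp add: algebra_simps)
  qed (simp add: N_def)
  have "N z \<le> (\<integral>x. \<bar>real (Suc m) * (\<phi> (x + z /\<^sub>R real (Suc m)) - \<phi> x)\<bar> \<partial>lborel)" for m
  proof -
    have "N z \<le> real (Suc m) * N (z /\<^sub>R real (Suc m))"
      using mult[of "Suc m" "z /\<^sub>R real (Suc m)"] by (simp del: of_nat_Suc)
    then show ?thesis by (simp add: N_def abs_mult del: of_nat_Suc)
  qed
  then have "N z \<le> (\<integral>x. \<bar>grad \<phi> x \<bullet> z\<bar> \<partial>lborel)"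
    by (intro LIMSEQ_le_const[OF difference_quotient_L1(2)[OF assms]]) auto
  also have "\<dots> \<le> (\<integral>x. norm z * norm (grad \<phi> x) \<partial>lborel)"
    using i Cauchy_Schwarz_ineq2[of "grad \<phi> _" z] by (intro integral_mono) (simp_all add: mult.commute)
  finally show ?thesis by (simp add: N_def)
qed

section \<open>Weak gradients\<close>

lemma integral_lebesgue_on_support:
  fixes h :: "'a::euclidean_space \<Rightarrow> 'b::{banach, second_countable_topology}"
  assumes "\<Omega> \<in> sets lebesgue" "h \<in> borel_measurable borel" "\<And>x. x \<notin> \<Omega> \<Longrightarrow> h x = 0"
  shows "(\<integral>x. h x \<partial>lebesgue_on \<Omega>) = (\<integral>x. h x \<partial>lborel)"
proof -
  have "(\<lambda>x. indicator \<Omega> x *\<^sub>R h x) = h"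
    using assms(3) by (auto simp: indicator_def)
  then show ?thesis
    using assms by (simp add: integral_restrict_space integral_completion)
qed

lemma locally_integrable_test_mult:
  fixes g :: "'a::euclidean_space \<Rightarrow> 'b::euclidean_space"
  assumes "\<Omega> \<in> sets lebesgue" "locally_integrable \<Omega> g" "continuous_on UNIV \<phi>" "compact K" "K \<subseteq> \<Omega>"
    "\<And>x. x \<notin> K \<Longrightarrow> \<phi> x = (0::real)"
  shows "integrable (lebesgue_on \<Omega>) (\<lambda>x. \<phi> x *\<^sub>R g x)"
proof -
  have "bounded (\<phi> ` K)"
    using assms by (auto intro!: compact_imp_bounded compact_continuous_image intro: continuous_on_subset)
  then obtain L where L: "\<And>x. x \<in> K \<Longrightarrow> \<bar>\<phi> x\<bar> \<le> L"
    by (auto simp: bounded_iff)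
  have [measurable]: "\<phi> \<in> borel_measurable lebesgue"
    by (rule measurable_completion) (simp add: borel_measurable_continuous_onI[OF assms(3)])
  have 1: "integrable lebesgue (\<lambda>x. indicator K x *\<^sub>R g x)"
    using assms(2,4,5) unfolding locally_integrable_def set_integrable_def by blast
  have "integrable lebesgue (\<lambda>x. \<phi> x *\<^sub>R (indicator K x *\<^sub>R g x))"
  proof (rule Bochner_Integration.integrable_bound[OF integrable_scaleR_right[OF 1, of L]])
    show "(\<lambda>x. \<phi> x *\<^sub>R indicator K x *\<^sub>R g x) \<in> borel_measurable lebesgue"
      using borel_measurable_integrable[OF 1] by measurable
    have "norm (\<phi> x *\<^sub>R indicator K x *\<^sub>R g x) \<le> norm (L *\<^sub>R indicator K x *\<^sub>R g x)" for x
      using L[of x] by (cases "x \<in> K") (auto intro!: mult_right_mono)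
    then show "AE x in lebesgue. norm (\<phi> x *\<^sub>R indicator K x *\<^sub>R g x) \<le> norm (L *\<^sub>R indicator K x *\<^sub>R g x)"
      by simp
  qed
  moreover have "(\<lambda>x. indicator \<Omega> x *\<^sub>R \<phi> x *\<^sub>R g x) = (\<lambda>x. \<phi> x *\<^sub>R (indicator K x *\<^sub>R g x))"
    using assms(5) assms(6) by (intro ext) (auto simp: indicator_def)
  ultimately show ?thesis
    using assms(1) by (subst integrable_restrict_space) (simp, simp only:)
qed

lemma locally_integrable_test_mult_real:
  fixes g :: "'a::euclidean_space \<Rightarrow> real"
  assumes "\<Omega> \<in> sets lebesgue" "locally_integrable \<Omega> g" "test_function \<Omega> \<phi>"
  shows "integrable (lebesgue_on \<Omega>) (\<lambda>x. g x * \<phi> x)"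
    "b \<in> Basis \<Longrightarrow> integrable (lebesgue_on \<Omega>) (\<lambda>x. g x * partial_deriv b \<phi> x)"
proof -
  obtain K where K: "compact K" "K \<subseteq> \<Omega>" "\<And>x. x \<notin> K \<Longrightarrow> \<phi> x = 0" "\<And>x. x \<notin> K \<Longrightarrow> grad \<phi> x = 0"
    using test_functionE[OF assms(3)] by metis
  show "integrable (lebesgue_on \<Omega>) (\<lambda>x. g x * \<phi> x)"
    using locally_integrable_test_mult[OF assms(1,2) test_function_continuous[OF assms(3)] K(1,2,3)]
    by (simp add: mult.commute)
  assume b: "b \<in> Basis"
  have "continuous_on UNIV (\<lambda>x. grad \<phi> x \<bullet> b)"
    using test_function_continuous_grad[OF assms(3)] by (intro continuous_intros)
  then show "integrable (lebesgue_on \<Omega>) (\<lambda>x. g x * partial_deriv b \<phi> x)"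
    using locally_integrable_test_mult[OF assms(1,2) _ K(1,2), of "\<lambda>x. grad \<phi> x \<bullet> b"] K(4) b
    by (simp add: mult.commute grad_inner_Basis)
qed

lemma locally_integrable_diff:
  "locally_integrable \<Omega> f \<Longrightarrow> locally_integrable \<Omega> g \<Longrightarrow> locally_integrable \<Omega> (\<lambda>x. f x - g x)"
  unfolding locally_integrable_def using set_integral_diff(1) by blast

lemma locally_integrable_inner:
  fixes g :: "'a::euclidean_space \<Rightarrow> 'b::euclidean_space"
  shows "locally_integrable \<Omega> g \<Longrightarrow> locally_integrable \<Omega> (\<lambda>x. g x \<bullet> b)"
  unfolding locally_integrable_def set_integrable_def
  by (simp flip: inner_scaleR_left)

lemma locally_integrable_continuous:
  fixes g :: "'a::euclidean_space \<Rightarrow> 'b::euclidean_space"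
  assumes "continuous_on UNIV g"
  shows "locally_integrable \<Omega> g"
proof -
  have "set_integrable lebesgue K g" if "compact K" for K
  proof -
    have [measurable]: "g \<in> borel_measurable borel" "K \<in> sets borel"
      using assms borel_compact[OF that] by (auto intro: borel_measurable_continuous_onI)
    have "integrable lborel (\<lambda>x. indicator K x *\<^sub>R g x)"
      using borel_integrable_compact[OF that continuous_on_subset[OF assms]]
      by (simp add: indicator_scaleR_eq_if)
    then show ?thesis
      unfolding set_integrable_def by (subst integrable_completion) auto
  qed
  then show ?thesis by (simp add: locally_integrable_def)
qed

lemma integrable_imp_locally_integrable:
  assumes "\<Omega> \<in> sets lebesgue" "integrable (lebesgue_on \<Omega>) g"
  shows "locally_integrable \<Omega> g"
  unfolding locally_integrable_def
proof (intro allI impI)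
  fix K assume K: "compact K \<and> K \<subseteq> \<Omega>"
  have "set_integrable lebesgue \<Omega> g"
    using assms by (simp add: integrable_restrict_space set_integrable_def)
  then show "set_integrable lebesgue K g"
    by (rule set_integrable_subset) (use K borel_compact in \<open>auto intro!: sets_completionI_sets\<close>)
qed

text \<open>Integration by parts: the product of two test functions is a test function, its gradient
  integrates to 0, and the product rule splits that integral into the two sides of the defining
  identity.\<close>

lemma has_weak_gradient_test_function:
  assumes "open \<Omega>" "test_function \<Omega> \<phi>"
  shows "has_weak_gradient \<Omega> \<phi> (grad \<phi>)"
  unfolding has_weak_gradient_def
proof (intro conjI allI impI ballI)
  show "locally_integrable \<Omega> \<phi>" "locally_integrable \<Omega> (grad \<phi>)"
    using locally_integrable_continuous test_function_continuous[OF assms(2)]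
      test_function_continuous_grad[OF assms(2)] by blast+
  fix \<psi> :: "'a \<Rightarrow> real" and b :: 'a
  assume \<psi>: "test_function \<Omega> \<psi>" and b: "b \<in> Basis"
  have \<Omega>: "\<Omega> \<in> sets lebesgue"
    using assms(1) by (simp add: sets_completionI_sets)
  note [measurable] = test_function_borel[OF assms(2)] test_function_borel[OF \<psi>]
  obtain K where K: "compact K" "K \<subseteq> \<Omega>" "\<And>x. x \<notin> K \<Longrightarrow> \<phi> x = 0" "\<And>x. x \<notin> K \<Longrightarrow> grad \<phi> x = 0"
    using test_functionE[OF assms(2)] by metis
  have m [measurable]: "partial_deriv b \<psi> \<in> borel_measurable borel"
  proof -
    have "partial_deriv b \<psi> = (\<lambda>x. grad \<psi> x \<bullet> b)"
      using b by (simp add: grad_inner_Basis)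
    then show ?thesis by simp
  qed
  have i1: "integrable lborel (\<lambda>x. \<phi> x * (grad \<psi> x \<bullet> b))"
    by (rule integrable_compact_support[OF continuous_on_mult[OF test_function_continuous[OF assms(2)]
          continuous_on_inner[OF test_function_continuous_grad[OF \<psi>] continuous_on_const]] K(1)])
      (simp add: K)
  have i2: "integrable lborel (\<lambda>x. (grad \<phi> x \<bullet> b) * \<psi> x)"
    by (rule integrable_compact_support[OF continuous_on_mult[OF
          continuous_on_inner[OF test_function_continuous_grad[OF assms(2)] continuous_on_const]
          test_function_continuous[OF \<psi>]] K(1)])
      (simp add: K)
  have "0 = (\<integral>x. grad (\<lambda>x. \<phi> x * \<psi> x) x \<bullet> b \<partial>lborel)"
    using integral_grad_eq_0[OF test_function_mult[OF assms(2) \<psi>]] by simp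
  also have "\<dots> = (\<integral>x. \<phi> x * (grad \<psi> x \<bullet> b) + (grad \<phi> x \<bullet> b) * \<psi> x \<partial>lborel)"
    by (intro Bochner_Integration.integral_cong refl)
      (simp add: grad_mult[OF assms(2) \<psi>] inner_left_distrib mult.commute)
  also have "\<dots> = (\<integral>x. \<phi> x * (grad \<psi> x \<bullet> b) \<partial>lborel) + (\<integral>x. (grad \<phi> x \<bullet> b) * \<psi> x \<partial>lborel)"
    using i1 i2 by (rule Bochner_Integration.integral_add)
  finally have "(\<integral>x. \<phi> x * (grad \<psi> x \<bullet> b) \<partial>lborel) = - (\<integral>x. (grad \<phi> x \<bullet> b) * \<psi> x \<partial>lborel)"
    by simp
  moreover have "(\<integral>x. \<phi> x * partial_deriv b \<psi> x \<partial>lebesgue_on \<Omega>) = (\<integral>x. \<phi> x * partial_deriv b \<psi> x \<partial>lborel)"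
    using K by (intro integral_lebesgue_on_support[OF \<Omega>]) auto
  moreover have "(\<integral>x. (grad \<phi> x \<bullet> b) * \<psi> x \<partial>lebesgue_on \<Omega>) = (\<integral>x. (grad \<phi> x \<bullet> b) * \<psi> x \<partial>lborel)"
  proof (rule integral_lebesgue_on_support[OF \<Omega>])
    show "(grad \<phi> x \<bullet> b) * \<psi> x = 0" if "x \<notin> \<Omega>" for x
    proof -
      have "x \<notin> K" using K(2) that by blast
      then show ?thesis by (simp add: K(4))
    qed
  qed measurable
  ultimately show "(\<integral>x. \<phi> x * partial_deriv b \<psi> x \<partial>lebesgue_on \<Omega>)
      = - (\<integral>x. (grad \<phi> x \<bullet> b) * \<psi> x \<partial>lebesgue_on \<Omega>)"
    using b by (simp add: grad_inner_Basis)
qed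

lemma has_weak_gradient_diff:
  assumes "\<Omega> \<in> sets lebesgue" "has_weak_gradient \<Omega> u G" "has_weak_gradient \<Omega> v H"
  shows "has_weak_gradient \<Omega> (\<lambda>x. u x - v x) (\<lambda>x. G x - H x)"
  unfolding has_weak_gradient_def
proof (intro conjI allI impI ballI)
  have l: "locally_integrable \<Omega> u" "locally_integrable \<Omega> G" "locally_integrable \<Omega> v" "locally_integrable \<Omega> H"
    using assms by (auto simp: has_weak_gradient_def)
  then show "locally_integrable \<Omega> (\<lambda>x. u x - v x)" "locally_integrable \<Omega> (\<lambda>x. G x - H x)"
    by (auto intro: locally_integrable_diff)
  fix \<psi> :: "'a \<Rightarrow> real" and b :: 'a
  assume \<psi>: "test_function \<Omega> \<psi>" and b: "b \<in> Basis"
  have e: "(\<integral>x. u x * partial_deriv b \<psi> x \<partial>lebesgue_on \<Omega>) = - (\<integral>x. (G x \<bullet> b) * \<psi> x \<partial>lebesgue_on \<Omega>)"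
    "(\<integral>x. v x * partial_deriv b \<psi> x \<partial>lebesgue_on \<Omega>) = - (\<integral>x. (H x \<bullet> b) * \<psi> x \<partial>lebesgue_on \<Omega>)"
    using assms(2,3) \<psi> b by (auto simp: has_weak_gradient_def)
  note i = locally_integrable_test_mult_real[OF assms(1) _ \<psi>]
  have "(\<integral>x. (u x - v x) * partial_deriv b \<psi> x \<partial>lebesgue_on \<Omega>)
      = (\<integral>x. u x * partial_deriv b \<psi> x \<partial>lebesgue_on \<Omega>) - (\<integral>x. v x * partial_deriv b \<psi> x \<partial>lebesgue_on \<Omega>)"
    using i(2)[OF l(1) b] i(2)[OF l(3) b] by (simp add: left_diff_distrib)
  moreover have "(\<integral>x. ((G x - H x) \<bullet> b) * \<psi> x \<partial>lebesgue_on \<Omega>)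
      = (\<integral>x. (G x \<bullet> b) * \<psi> x \<partial>lebesgue_on \<Omega>) - (\<integral>x. (H x \<bullet> b) * \<psi> x \<partial>lebesgue_on \<Omega>)"
    using i(1)[OF locally_integrable_inner[OF l(2)], of b] i(1)[OF locally_integrable_inner[OF l(4)], of b]
    by (simp add: left_diff_distrib inner_diff_left)
  ultimately show "(\<integral>x. (u x - v x) * partial_deriv b \<psi> x \<partial>lebesgue_on \<Omega>)
      = - (\<integral>x. ((G x - H x) \<bullet> b) * \<psi> x \<partial>lebesgue_on \<Omega>)"
    using e by simp
qed

lemma integral_mult_tendsto_L1:
  fixes v :: "nat \<Rightarrow> 'a \<Rightarrow> real"
  assumes "\<And>n. integrable M (v n)" "integrable M w" "\<psi> \<in> borel_measurable M" "\<And>x. \<bar>\<psi> x\<bar> \<le> L"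
    "(\<lambda>n. \<integral>x. \<bar>v n x - w x\<bar> \<partial>M) \<longlonglongrightarrow> 0"
  shows "(\<lambda>n. \<integral>x. v n x * \<psi> x \<partial>M) \<longlonglongrightarrow> (\<integral>x. w x * \<psi> x \<partial>M)"
proof (rule LIM_zero_cancel, rule Lim_null_comparison)
  have i: "integrable M (\<lambda>x. f x * \<psi> x)" if "integrable M f" for f :: "'a \<Rightarrow> real"
  proof (rule Bochner_Integration.integrable_bound[OF integrable_mult_right[OF that, of L]])
    show "AE x in M. norm (f x * \<psi> x) \<le> norm (L * f x)"
      using assms(4) by (intro AE_I2) (simp add: abs_mult mult.commute mult_mono' order.trans[OF _ abs_ge_self])
  qed (use that assms(3) in auto)
  show "\<forall>\<^sub>F n in sequentially. norm ((\<integral>x. v n x * \<psi> x \<partial>M) - (\<integral>x. w x * \<psi> x \<partial>M)) \<le> L * (\<integral>x. \<bar>v n x - w x\<bar> \<partial>M)"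
  proof (intro always_eventually allI)
    fix n
    have "(\<integral>x. v n x * \<psi> x \<partial>M) - (\<integral>x. w x * \<psi> x \<partial>M) = (\<integral>x. (v n x - w x) * \<psi> x \<partial>M)"
      using i assms by (simp add: left_diff_distrib)
    also have "norm \<dots> \<le> (\<integral>x. norm ((v n x - w x) * \<psi> x) \<partial>M)"
      by (rule integral_norm_bound)
    also have "\<dots> \<le> (\<integral>x. L * \<bar>v n x - w x\<bar> \<partial>M)"
    proof (rule integral_mono)
      show "integrable M (\<lambda>x. norm ((v n x - w x) * \<psi> x))"
        using i[of "\<lambda>x. v n x - w x"] assms by (intro integrable_norm) auto
      show "integrable M (\<lambda>x. L * \<bar>v n x - w x\<bar>)"
        using assms by auto
      show "norm ((v n x - w x) * \<psi> x) \<le> L * \<bar>v n x - w x\<bar>" for x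
        using mult_right_mono[OF assms(4)[of x], of "\<bar>v n x - w x\<bar>"] by (simp add: abs_mult mult.commute)
    qed
    finally show "norm ((\<integral>x. v n x * \<psi> x \<partial>M) - (\<integral>x. w x * \<psi> x \<partial>M)) \<le> L * (\<integral>x. \<bar>v n x - w x\<bar> \<partial>M)"
      by simp
  qed
  show "(\<lambda>n. L * (\<integral>x. \<bar>v n x - w x\<bar> \<partial>M)) \<longlonglongrightarrow> 0"
    using tendsto_mult_right_zero[OF assms(5), of L] by simp
qed

text \<open>Test functions and their partial derivatives are bounded, so L1 convergence of the
  functions and of their gradients suffices to pass to the limit on both sides of the defining
  identity.\<close>

lemma has_weak_gradient_limit:
  fixes v :: "nat \<Rightarrow> 'a::euclidean_space \<Rightarrow> real"
  assumes "\<Omega> \<in> sets lebesgue" "\<And>n. has_weak_gradient \<Omega> (v n) (H n)"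
    and "\<And>n. integrable (lebesgue_on \<Omega>) (v n)" "\<And>n. integrable (lebesgue_on \<Omega>) (H n)"
    and "integrable (lebesgue_on \<Omega>) u" "integrable (lebesgue_on \<Omega>) G"
    and "(\<lambda>n. \<integral>x. \<bar>v n x - u x\<bar> \<partial>lebesgue_on \<Omega>) \<longlonglongrightarrow> 0"
    and "(\<lambda>n. \<integral>x. norm (H n x - G x) \<partial>lebesgue_on \<Omega>) \<longlonglongrightarrow> 0"
  shows "has_weak_gradient \<Omega> u G"
  unfolding has_weak_gradient_def
proof (intro conjI allI impI ballI)
  show "locally_integrable \<Omega> u" "locally_integrable \<Omega> G"
    using assms by (auto intro: integrable_imp_locally_integrable)
  fix \<psi> :: "'a \<Rightarrow> real" and b :: 'a
  assume \<psi>: "test_function \<Omega> \<psi>" and b: "b \<in> Basis"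
  obtain L where L: "0 < L" "\<And>x. \<bar>\<psi> x\<bar> \<le> L" "\<And>x. norm (grad \<psi> x) \<le> L"
    using test_function_bounded[OF \<psi>] by metis
  have m: "\<psi> \<in> borel_measurable (lebesgue_on \<Omega>)" "(\<lambda>x. grad \<psi> x \<bullet> b) \<in> borel_measurable (lebesgue_on \<Omega>)"
    using test_function_borel[OF \<psi>]
    by (auto intro!: measurable_restrict_space1 measurable_completion borel_measurable_inner)
  have m2: "partial_deriv b \<psi> \<in> borel_measurable (lebesgue_on \<Omega>)"
    using m(2) b by (simp add: grad_inner_Basis)
  have L2: "\<bar>partial_deriv b \<psi> x\<bar> \<le> L" for x
    using Basis_le_norm[OF b, of "grad \<psi> x"] L(3)[of x] b by (simp add: grad_inner_Basis)
  have 1: "(\<lambda>n. \<integral>x. v n x * partial_deriv b \<psi> x \<partial>lebesgue_on \<Omega>) \<longlonglongrightarrow> (\<integral>x. u x * partial_deriv b \<psi> x \<partial>lebesgue_on \<Omega>)"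
    by (rule integral_mult_tendsto_L1[OF assms(3,5) m2 L2 assms(7)])
  have 2: "(\<lambda>n. \<integral>x. (H n x \<bullet> b) * \<psi> x \<partial>lebesgue_on \<Omega>) \<longlonglongrightarrow> (\<integral>x. (G x \<bullet> b) * \<psi> x \<partial>lebesgue_on \<Omega>)"
  proof (rule integral_mult_tendsto_L1[OF _ _ m(1) L(2)])
    show "integrable (lebesgue_on \<Omega>) (\<lambda>x. H n x \<bullet> b)" "integrable (lebesgue_on \<Omega>) (\<lambda>x. G x \<bullet> b)" for n
      using assms by auto
    have "norm (\<integral>x. \<bar>H n x \<bullet> b - G x \<bullet> b\<bar> \<partial>lebesgue_on \<Omega>) \<le> (\<integral>x. norm (H n x - G x) \<partial>lebesgue_on \<Omega>)" for n
    proof -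
      have "(\<integral>x. \<bar>H n x \<bullet> b - G x \<bullet> b\<bar> \<partial>lebesgue_on \<Omega>) \<le> (\<integral>x. norm (H n x - G x) \<partial>lebesgue_on \<Omega>)"
        using assms(4)[of n] assms(6) Basis_le_norm[OF b]
        by (intro integral_mono integrable_abs integrable_norm Bochner_Integration.integrable_diff
            integrable_inner_left) (auto simp flip: inner_diff_left)
      then show ?thesis by (simp add: integral_nonneg_AE)
    qed
    then show "(\<lambda>n. \<integral>x. \<bar>H n x \<bullet> b - G x \<bullet> b\<bar> \<partial>lebesgue_on \<Omega>) \<longlonglongrightarrow> 0"
      by (intro Lim_null_comparison[OF always_eventually assms(8)]) blast
  qed
  have "(\<integral>x. v n x * partial_deriv b \<psi> x \<partial>lebesgue_on \<Omega>) = - (\<integral>x. (H n x \<bullet> b) * \<psi> x \<partial>lebesgue_on \<Omega>)" for n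
    using assms(2)[of n] \<psi> b by (simp add: has_weak_gradient_def)
  then show "(\<integral>x. u x * partial_deriv b \<psi> x \<partial>lebesgue_on \<Omega>) = - (\<integral>x. (G x \<bullet> b) * \<psi> x \<partial>lebesgue_on \<Omega>)"
    using LIMSEQ_unique[OF 1] tendsto_minus[OF 2] by simp
qed

section \<open>Uniqueness of weak gradients\<close>

text \<open>A smooth approximation from below of the indicator of the open box. The factor
  \<open>n\<close> steepens every face, and each factor of the product tends to 1 inside the
  box.\<close>

definition box_bump :: "'a::euclidean_space \<Rightarrow> 'a \<Rightarrow> nat \<Rightarrow> 'a \<Rightarrow> real" where
  "box_bump a b n x = (\<Prod>i\<in>Basis. smoothstep (real n * (x \<bullet> i - a \<bullet> i)) * smoothstep (real n * (b \<bullet> i - x \<bullet> i)))"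

lemma box_bump_bounds: "0 \<le> box_bump a b n x" "box_bump a b n x \<le> 1"
  unfolding box_bump_def
  by (auto intro!: prod_nonneg prod_le_1 mult_nonneg_nonneg mult_le_one simp: smoothstep_bounds)

lemma box_bump_eq_0:
  assumes "x \<notin> box a b"
  shows "box_bump a b n x = 0"
proof -
  obtain i where i: "i \<in> Basis" "x \<bullet> i \<le> a \<bullet> i \<or> b \<bullet> i \<le> x \<bullet> i"
    using assms by (auto simp: mem_box not_less)
  then have "\<not> 0 < real n * (x \<bullet> i - a \<bullet> i) \<or> \<not> 0 < real n * (b \<bullet> i - x \<bullet> i)"
    by (auto simp: zero_less_mult_iff)
  then show ?thesis
    unfolding box_bump_def using i(1) by (auto simp: smoothstep_def intro!: prod_zero bexI[of _ i])
qed

lemma box_bump_tendsto: "(\<lambda>n. box_bump a b n x) \<longlonglongrightarrow> indicator (box a b) x"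
proof (cases "x \<in> box a b")
  case True
  have "(\<lambda>n. box_bump a b n x) \<longlonglongrightarrow> (\<Prod>i\<in>(Basis::'a set). 1 * 1)"
    unfolding box_bump_def using True
    by (intro tendsto_prod tendsto_mult smoothstep_tendsto_1) (auto simp: mem_box)
  then show ?thesis using True by simp
next
  case False
  then show ?thesis by (simp add: box_bump_eq_0)
qed

lemma test_function_box_bump:
  assumes "cbox a b \<subseteq> \<Omega>"
  shows "test_function \<Omega> (box_bump a b n)"
proof (rule test_functionI[OF _ compact_cbox assms])
  have s: "C_diff k (\<lambda>x. smoothstep (real n * (c + d * (x \<bullet> i))))" for k c d and i :: 'a
    by (intro C_diff_smooth[OF smooth_smoothstep] C_diff_mult C_diff_add) auto
  show "C_diff k (box_bump a b n)" for k
    unfolding box_bump_def[abs_def] using s[of k "- (a \<bullet> i)" 1 i for i] s[of k "b \<bullet> i" "-1" i for i]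
    by (intro C_diff_prod C_diff_mult) auto
  show "box_bump a b n x = 0" if "x \<notin> cbox a b" for x
    using that box_subset_cbox[of a b] by (intro box_bump_eq_0) auto
qed

text \<open>\<open>ennreal\<close> sends negative numbers to 0, so the two densities compared are
  the positive and the negative part of \<open>g\<close>. Their measures are finite and equal on
  boxes, an intersection-stable generator of the Borel sets; hence the measures agree, and then the
  densities do.\<close>

lemma AE_zero_of_box_integrals:
  fixes g :: "'a::euclidean_space \<Rightarrow> real"
  assumes g: "integrable lborel g" and z: "\<And>a b. (\<integral>x. indicator (box a b) x * g x \<partial>lborel) = 0"
  shows "AE x in lborel. g x = 0"
proof -
  have [measurable]: "g \<in> borel_measurable borel" using g by auto
  have eq: "density lborel (\<lambda>x. ennreal (g x)) = density lborel (\<lambda>x. ennreal (- g x))" (is "?M = ?N")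
  proof (rule measure_eqI_generator_eq)
    let ?E = "range (\<lambda>(a, b). box a b::'a set)"
    let ?A = "\<lambda>n::nat. box (- (real n *\<^sub>R One)) (real n *\<^sub>R One) :: 'a set"
    have em: "emeasure (density lborel (\<lambda>x. ennreal (h x))) (box a b)
        = ennreal (\<integral>x. indicator (box a b) x * max 0 (h x) \<partial>lborel)" if h: "integrable lborel h" for a b h
    proof -
      have [measurable]: "h \<in> borel_measurable borel" using h by auto
      have "emeasure (density lborel (\<lambda>x. ennreal (h x))) (box a b)
          = (\<integral>\<^sup>+x. ennreal (h x) * indicator (box a b) x \<partial>lborel)"
        by (rule emeasure_density) auto
      also have "\<dots> = (\<integral>\<^sup>+x. ennreal (indicator (box a b) x * max 0 (h x)) \<partial>lborel)"
        by (intro nn_integral_cong) (auto simp: indicator_def max_def ennreal_neg)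
      also have "\<dots> = ennreal (\<integral>x. indicator (box a b) x * max 0 (h x) \<partial>lborel)"
        by (rule nn_integral_eq_integral)
          (use h integrable_mult_indicator[of "box a b" lborel "\<lambda>x. max 0 (h x)"] in \<open>auto\<close>)
      finally show ?thesis .
    qed
    show "Int_stable ?E"
      by (auto simp: Int_stable_def box_Int_box)
    show "?E \<subseteq> Pow UNIV" "sets ?M = sigma_sets UNIV ?E" "sets ?N = sigma_sets UNIV ?E"
      by (simp_all add: borel_eq_box)
    show "range ?A \<subseteq> ?E" "(\<Union>i. ?A i) = UNIV"
      unfolding UN_box_eq_UNIV by auto
    show "emeasure ?M (?A i) \<noteq> \<infinity>" for i
      using em[OF g] by simp
    show "emeasure ?M X = emeasure ?N X" if "X \<in> ?E" for X
    proof -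
      from that obtain a b where X: "X = box a b" by (auto simp: image_iff)
      have i: "integrable lborel (\<lambda>x. indicator (box a b) x * max 0 (g x))"
        "integrable lborel (\<lambda>x. indicator (box a b) x * max 0 (- g x))"
        using g integrable_mult_indicator[of "box a b" lborel "\<lambda>x. max 0 (g x)"]
          integrable_mult_indicator[of "box a b" lborel "\<lambda>x. max 0 (- g x)"] by auto
      have "(\<integral>x. indicator (box a b) x * max 0 (g x) \<partial>lborel) - (\<integral>x. indicator (box a b) x * max 0 (- g x) \<partial>lborel)
          = (\<integral>x. indicator (box a b) x * max 0 (g x) - indicator (box a b) x * max 0 (- g x) \<partial>lborel)"
        using i by simp
      also have "\<dots> = (\<integral>x. indicator (box a b) x * g x \<partial>lborel)"
        by (intro Bochner_Integration.integral_cong) (auto simp: max_def indicator_def)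
      finally show ?thesis
        using em[OF g, of a b] em[of "\<lambda>x. - g x" a b] g z[of a b] by (simp add: X)
    qed
  qed
  have "AE x in lborel. ennreal (g x) = ennreal (- g x)"
    by (rule sigma_finite_measure.density_unique[OF lborel.sigma_finite_measure_axioms _ _ eq]) auto
  moreover have "g x = 0" if "ennreal (g x) = ennreal (- g x)" for x
    using that ennreal_eq_0_iff[of "g x"] ennreal_eq_0_iff[of "- g x"] ennreal_neg[of "g x"] ennreal_neg[of "- g x"]
    by (cases "0 \<le> g x") auto
  ultimately show ?thesis
    by (auto elim: AE_mp)
qed

text \<open>The fundamental lemma of the calculus of variations. Bumps converge to indicators, so
  \<open>g\<close> has integral 0 over every box whose closure lies in \<open>\<Omega>\<close>;
  inside one such box the preceding lemma applies, and countably many closed boxes cover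
  \<open>\<Omega>\<close>.\<close>

lemma AE_zero_of_test_integrals:
  fixes g :: "'a::euclidean_space \<Rightarrow> real"
  assumes "open \<Omega>" and g: "locally_integrable \<Omega> g"
    and z: "\<And>\<phi>. test_function \<Omega> \<phi> \<Longrightarrow> (\<integral>x. g x * \<phi> x \<partial>lebesgue_on \<Omega>) = 0"
  shows "AE x in lebesgue_on \<Omega>. g x = 0"
proof -
  have \<Omega>: "\<Omega> \<in> sets lebesgue"
    using assms(1) by (simp add: sets_completionI_sets)
  have ib: "(indicator (box c d) :: 'a \<Rightarrow> real) \<in> borel_measurable lebesgue" for c d
    by (intro borel_measurable_indicator sets_completionI_sets) simp
  have box0: "(\<integral>x. indicator (box a b) x * g x \<partial>lebesgue) = 0" if ab: "cbox a b \<subseteq> \<Omega>" for a b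
  proof -
    have gi: "integrable lebesgue (\<lambda>x. indicator (cbox a b) x *\<^sub>R g x)"
      using g ab compact_cbox[of a b] by (simp add: locally_integrable_def set_integrable_def del: real_scaleR_def)
    have e: "box_bump a b n x * (indicator (cbox a b) x *\<^sub>R g x) = box_bump a b n x * g x" for n x
      using box_bump_eq_0[of x a b n] box_subset_cbox[of a b] by (cases "x \<in> cbox a b") auto
    have m: "box_bump a b n \<in> borel_measurable lebesgue" for n
      by (rule measurable_completion) (simp add: test_function_borel[OF test_function_box_bump[OF ab]])
    have "(\<lambda>n. \<integral>x. box_bump a b n x * (indicator (cbox a b) x *\<^sub>R g x) \<partial>lebesgue)
        \<longlonglongrightarrow> (\<integral>x. indicator (box a b) x * (indicator (cbox a b) x *\<^sub>R g x) \<partial>lebesgue)"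
    proof (rule integral_dominated_convergence[OF _ _ integrable_norm[OF gi]])
      show "AE x in lebesgue. (\<lambda>n. box_bump a b n x * (indicator (cbox a b) x *\<^sub>R g x))
          \<longlonglongrightarrow> indicator (box a b) x * (indicator (cbox a b) x *\<^sub>R g x)"
        by (intro AE_I2 tendsto_mult box_bump_tendsto tendsto_const)
      show "AE x in lebesgue. norm (box_bump a b n x * (indicator (cbox a b) x *\<^sub>R g x))
          \<le> norm (indicator (cbox a b) x *\<^sub>R g x)" for n
        using box_bump_bounds[of a b n] by (intro AE_I2) (simp add: abs_mult mult_left_le_one_le)
      show "(\<lambda>x. indicator (box a b) x * (indicator (cbox a b) x *\<^sub>R g x)) \<in> borel_measurable lebesgue"
        by (rule borel_measurable_times[OF ib borel_measurable_integrable[OF gi]])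
      show "(\<lambda>x. box_bump a b n x * (indicator (cbox a b) x *\<^sub>R g x)) \<in> borel_measurable lebesgue" for n
        using m borel_measurable_integrable[OF gi] by (rule borel_measurable_times)
    qed
    moreover have "(\<integral>x. box_bump a b n x * (indicator (cbox a b) x *\<^sub>R g x) \<partial>lebesgue) = 0" for n
    proof -
      have "(\<integral>x. g x * box_bump a b n x \<partial>lebesgue_on \<Omega>) = (\<integral>x. indicator \<Omega> x *\<^sub>R (g x * box_bump a b n x) \<partial>lebesgue)"
        using \<Omega> by (simp add: integral_restrict_space)
      also have "\<dots> = (\<integral>x. box_bump a b n x * g x \<partial>lebesgue)"
        using ab box_subset_cbox[of a b] box_bump_eq_0[of _ a b n]
        by (intro Bochner_Integration.integral_cong refl) (auto simp: indicator_def)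
      finally show ?thesis
        using z[OF test_function_box_bump[OF ab]] unfolding e by simp
    qed
    moreover have i: "indicator (box a b) x * (indicator (cbox a b) x *\<^sub>R g x) = indicator (box a b) x * g x" for x
      using box_subset_cbox[of a b] by (auto simp: indicator_def)
    ultimately show ?thesis
      unfolding i by (simp add: LIMSEQ_const_iff)
  qed
  have box: "AE x in lebesgue. x \<in> box a b \<longrightarrow> g x = 0" if ab: "cbox a b \<subseteq> \<Omega>" for a b
  proof -
    have "set_integrable lebesgue (cbox a b) g"
      using g ab compact_cbox[of a b] by (simp add: locally_integrable_def)
    then have gi: "integrable lebesgue (\<lambda>x. indicator (box a b) x * g x)"
      using set_integrable_subset[of lebesgue "cbox a b" g "box a b"] box_subset_cbox[of a b]
      unfolding set_integrable_def real_scaleR_def by simp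
    \<comment> \<open>The preceding lemma lives in \<open>lborel\<close> while \<open>g\<close> is
      only Lebesgue measurable, so its restriction to the box is replaced by a Borel
      representative.\<close>
    obtain h where h [measurable]: "h \<in> borel_measurable lborel" and hg: "AE x in lborel. indicator (box a b) x * g x = h x"
      using completion_ex_borel_measurable_real[OF borel_measurable_integrable[OF gi]] by blast
    have hg': "AE x in lebesgue. indicator (box a b) x * g x = h x"
      using hg by (rule AE_completion)
    have hm: "h \<in> borel_measurable lebesgue" using h by (rule measurable_completion)
    have "integrable lebesgue h"
      using integrable_cong_AE[OF borel_measurable_integrable[OF gi] hm hg'] gi by blast
    then have hi: "integrable lborel h" using h by (simp add: integrable_completion)
    have "AE x in lborel. h x = 0"
    proof (rule AE_zero_of_box_integrals[OF hi])
      fix c d :: 'a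
      obtain c' d' where cd: "box c d \<inter> box a b = box c' d'"
        using box_Int_box by blast
      have "(\<integral>x. indicator (box c d) x * h x \<partial>lborel) = (\<integral>x. indicator (box c d) x * h x \<partial>lebesgue)"
        by (subst integral_completion) auto
      also have "\<dots> = (\<integral>x. indicator (box c d) x * (indicator (box a b) x * g x) \<partial>lebesgue)"
      proof (rule integral_cong_AE)
        show "(\<lambda>x. indicator (box c d) x * h x) \<in> borel_measurable lebesgue"
          by (rule borel_measurable_times[OF ib hm])
        show "(\<lambda>x. indicator (box c d) x * (indicator (box a b) x * g x)) \<in> borel_measurable lebesgue"
          by (rule borel_measurable_times[OF ib borel_measurable_integrable[OF gi]])
        show "AE x in lebesgue. indicator (box c d) x * h x = indicator (box c d) x * (indicator (box a b) x * g x)"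
          using hg' by eventually_elim simp
      qed
      also have "\<dots> = (\<integral>x. indicator (box c' d') x * g x \<partial>lebesgue)"
        by (intro Bochner_Integration.integral_cong refl) (simp add: cd[symmetric] indicator_inter_arith mult.assoc)
      also have "\<dots> = 0"
      \<comment> \<open>The closure of an open box is the closed box only if the box is nonempty;
        then it stays inside \<open>cbox a b\<close>, and \<open>box0\<close> applies to it.\<close>
      proof (cases "box c' d' = {}")
        case False
        then have "cbox c' d' = closure (box c' d')" by (simp add: closure_box)
        also have "\<dots> \<subseteq> cbox a b"
          using cd box_subset_cbox[of a b] by (intro closure_minimal) auto
        finally show ?thesis using box0 ab by blast
      qed simp
      finally show "(\<integral>x. indicator (box c d) x * h x \<partial>lborel) = 0" .
    qed
    then have "AE x in lebesgue. h x = 0" by (rule AE_completion)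
    with hg' show ?thesis by eventually_elim (auto simp: indicator_def split: if_splits)
  qed
  have cbox: "AE x in lebesgue. x \<in> cbox a b \<longrightarrow> g x = 0" if "cbox a b \<subseteq> \<Omega>" for a b
  proof -
    have "AE x in lebesgue. x \<notin> cbox a b - box a b"
      by (intro AE_completion AE_not_in null_sets_cbox_Diff_box)
    with box[OF that] show ?thesis by eventually_elim blast
  qed
  obtain D where D: "countable D" "D \<subseteq> Pow \<Omega>" "\<And>X. X \<in> D \<Longrightarrow> \<exists>a b. X = cbox a b" "\<Union>D = \<Omega>"
    using open_countable_Union_open_cbox[OF assms(1)] by metis
  have "AE x in lebesgue. \<forall>X\<in>D. x \<in> X \<longrightarrow> g x = 0"
    unfolding AE_ball_countable[OF D(1)]
  proof
    fix X assume X: "X \<in> D"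
    then obtain a b where "X = cbox a b" using D(3) by blast
    then show "AE x in lebesgue. x \<in> X \<longrightarrow> g x = 0"
      using cbox[of a b] X D(2) by auto
  qed
  then have "AE x in lebesgue. x \<in> \<Omega> \<longrightarrow> g x = 0"
    by eventually_elim (use D(4) in blast)
  then show ?thesis
    using \<Omega> by (simp add: AE_restrict_space_iff)
qed

text \<open>\<open>weak_grad\<close> is a choice among all weak gradients. Uniqueness is what allows
  any gradient found by computation to replace it almost everywhere.\<close>

lemma weak_gradient_unique:
  fixes \<Omega> :: "'a::euclidean_space set"
  assumes "open \<Omega>" "has_weak_gradient \<Omega> u G" "has_weak_gradient \<Omega> u H"
  shows "AE x in lebesgue_on \<Omega>. G x = H x"
proof -
  have \<Omega>: "\<Omega> \<in> sets lebesgue"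
    using assms(1) by (simp add: sets_completionI_sets)
  have d: "has_weak_gradient \<Omega> (\<lambda>x. u x - u x) (\<lambda>x. G x - H x)"
    by (rule has_weak_gradient_diff[OF \<Omega> assms(2,3)])
  have ae: "AE x in lebesgue_on \<Omega>. (G x - H x) \<bullet> b = 0" if b: "b \<in> Basis" for b
  proof (rule AE_zero_of_test_integrals[OF assms(1)])
    have "locally_integrable \<Omega> (\<lambda>x. G x - H x)"
      using d unfolding has_weak_gradient_def by (elim conjE)
    then show "locally_integrable \<Omega> (\<lambda>x. (G x - H x) \<bullet> b)"
      by (rule locally_integrable_inner)
    fix \<phi> :: "'a \<Rightarrow> real" assume "test_function \<Omega> \<phi>"
    then have "(\<integral>x. (u x - u x) * partial_deriv b \<phi> x \<partial>lebesgue_on \<Omega>)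
        = - (\<integral>x. ((G x - H x) \<bullet> b) * \<phi> x \<partial>lebesgue_on \<Omega>)"
      using d b unfolding has_weak_gradient_def by simp
    then show "(\<integral>x. ((G x - H x) \<bullet> b) * \<phi> x \<partial>lebesgue_on \<Omega>) = 0"
      by simp
  qed
  have "AE x in lebesgue_on \<Omega>. \<forall>b\<in>Basis. (G x - H x) \<bullet> b = 0"
    by (rule eventually_ball_finite[OF finite_Basis], rule ballI, rule ae)
  then show ?thesis
  proof (rule eventually_mono)
    show "G x = H x" if "\<forall>b\<in>Basis. (G x - H x) \<bullet> b = 0" for x
      using euclidean_eqI[of "G x - H x" 0] that by simp
  qed
qed

lemma weak_grad_AE:
  assumes "open \<Omega>" "has_weak_gradient \<Omega> u G"
  shows "AE x in lebesgue_on \<Omega>. weak_grad \<Omega> u x = G x"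
proof -
  have "has_weak_gradient \<Omega> u (weak_grad \<Omega> u)"
    unfolding weak_grad_def using someI[of "has_weak_gradient \<Omega> u", OF assms(2)] by simp
  then show ?thesis
    using weak_gradient_unique assms by blast
qed

section \<open>Approximation in Sobolev spaces\<close>

lemma powr_add_le:
  fixes a b p :: real
  assumes "0 \<le> a" "0 \<le> b" "0 \<le> p"
  shows "(a + b) powr p \<le> 2 powr p * (a powr p + b powr p)"
proof -
  have "(a + b) powr p \<le> (2 * max a b) powr p"
    using assms by (intro powr_mono2) auto
  also have "\<dots> = 2 powr p * max a b powr p"
    using assms by (simp add: powr_mult)
  also have "max a b powr p \<le> a powr p + b powr p"
    by (auto simp: max_def)
  finally show ?thesis by simp
qed

text \<open>This stands in for Hoelder's inequality between first and p-th powers: up to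
  \<open>\<delta>\<close> the first term suffices, and beyond it t^(1 - p) is at most \<delta>^(1 -
  p). The free parameter is later chosen to balance the two terms.\<close>

lemma le_powr_Young:
  fixes t \<delta> p :: real
  assumes "0 \<le> t" "0 < \<delta>" "1 \<le> p"
  shows "t \<le> \<delta> + \<delta> powr (1 - p) * t powr p"
proof (cases "t \<le> \<delta>")
  case True
  then show ?thesis using assms by (simp add: add_increasing2)
next
  case False
  have "t = t powr (1 - p) * t powr p"
    using False assms by (simp flip: powr_add)
  also have "\<dots> \<le> \<delta> powr (1 - p) * t powr p"
    using False assms by (intro mult_right_mono powr_mono2') auto
  finally show ?thesis using assms by linarith
qed

context finite_measure
begin

lemma in_Lp_integrable:
  fixes v :: "'a \<Rightarrow> 'b::{banach, second_countable_topology}"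
  assumes "1 \<le> p" "in_Lp M p v"
  shows "integrable M v"
proof (rule Bochner_Integration.integrable_bound)
  show "integrable M (\<lambda>x. 1 + norm (v x) powr p)"
    using assms(2) by (auto simp: in_Lp_def)
  show "v \<in> borel_measurable M" using assms(2) by (simp add: in_Lp_def)
  show "AE x in M. norm (v x) \<le> norm (1 + norm (v x) powr p)"
    using le_powr_Young[of "norm (v _)" 1 p] assms(1) by (intro AE_I2) simp
qed

lemma Lp_tendsto_0_imp_L1:
  fixes v :: "nat \<Rightarrow> 'a \<Rightarrow> 'b::{banach, second_countable_topology}"
  assumes "1 \<le> p" "\<And>n. in_Lp M p (v n)" and lim: "(\<lambda>n. \<integral>x. norm (v n x) powr p \<partial>M) \<longlonglongrightarrow> 0"
  shows "(\<lambda>n. \<integral>x. norm (v n x) \<partial>M) \<longlonglongrightarrow> 0"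
proof (rule LIMSEQ_I)
  fix e :: real assume e: "0 < e"
  \<comment> \<open>Keeps the contribution of the first term of the Young-type bound below e / 2;
    the \<open>+ 1\<close> covers a space of measure 0.\<close>
  define \<delta> where "\<delta> = e / (2 * (measure M (space M) + 1))"
  have m: "0 \<le> measure M (space M)" by simp
  have \<delta>: "0 < \<delta>" unfolding \<delta>_def using e m by (intro divide_pos_pos mult_pos_pos add_nonneg_pos) auto
  have le: "(\<integral>x. norm (v n x) \<partial>M) \<le> \<delta> * measure M (space M) + \<delta> powr (1 - p) * (\<integral>x. norm (v n x) powr p \<partial>M)" for n
  proof -
    have i: "integrable M (\<lambda>x. norm (v n x) powr p)"
      using assms(2) by (simp add: in_Lp_def)
    have "(\<integral>x. norm (v n x) \<partial>M) \<le> (\<integral>x. \<delta> + \<delta> powr (1 - p) * norm (v n x) powr p \<partial>M)"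
      using in_Lp_integrable[OF assms(1,2)] i le_powr_Young[OF norm_ge_zero \<delta> assms(1)]
      by (intro integral_mono) auto
    also have "\<dots> = \<delta> * measure M (space M) + \<delta> powr (1 - p) * (\<integral>x. norm (v n x) powr p \<partial>M)"
      using i by (simp add: mult.commute)
    finally show ?thesis .
  qed
  have "0 < e / 2 / \<delta> powr (1 - p)" using e \<delta> by simp
  from LIMSEQ_D[OF lim this] obtain N where N: "\<And>n. n \<ge> N \<Longrightarrow> (\<integral>x. norm (v n x) powr p \<partial>M) < e / 2 / \<delta> powr (1 - p)"
    by (auto simp: integral_nonneg_AE)
  have "\<delta> * measure M (space M) \<le> e / 2"
  proof -
    have "e / (2 * (c + 1)) * c \<le> e / 2" if "0 \<le> c" for c
      using that e by (simp add: field_simps)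
    then show ?thesis using m by (simp only: \<delta>_def)
  qed
  moreover have "\<delta> powr (1 - p) * (\<integral>x. norm (v n x) powr p \<partial>M) < e / 2" if "n \<ge> N" for n
    using N[OF that] \<delta> by (simp add: pos_less_divide_eq mult_ac)
  ultimately have "(\<integral>x. norm (v n x) \<partial>M) < e" if "n \<ge> N" for n
    using le[of n] that by fastforce
  then show "\<exists>N. \<forall>n\<ge>N. norm ((\<integral>x. norm (v n x) \<partial>M) - 0) < e"
    by (intro exI[of _ N]) (simp add: integral_nonneg_AE)
qed

lemma in_Lp_bounded:
  fixes v :: "'a \<Rightarrow> 'b::{banach, second_countable_topology}"
  assumes "0 \<le> p" "v \<in> borel_measurable M" "AE x in M. norm (v x) \<le> L"
  shows "in_Lp M p v"
  unfolding in_Lp_def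
proof
  show "integrable M (\<lambda>x. norm (v x) powr p)"
  proof (rule integrable_const_bound)
    show "AE x in M. norm (norm (v x) powr p) \<le> L powr p"
      using assms(3) by eventually_elim (use assms(1) in \<open>auto intro: powr_mono2\<close>)
  qed (use assms(2) in measurable)
qed fact

end

lemma in_Lp_add:
  fixes v w :: "'a \<Rightarrow> 'b::{banach, second_countable_topology}"
  assumes "0 \<le> p" "in_Lp M p v" "in_Lp M p w"
  shows "in_Lp M p (\<lambda>x. v x + w x)"
  unfolding in_Lp_def
proof
  have [measurable]: "v \<in> borel_measurable M" "w \<in> borel_measurable M"
    using assms by (auto simp: in_Lp_def)
  show "(\<lambda>x. v x + w x) \<in> borel_measurable M" by measurable
  show "integrable M (\<lambda>x. norm (v x + w x) powr p)"
  proof (rule Bochner_Integration.integrable_bound)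
    show "integrable M (\<lambda>x. 2 powr p * (norm (v x) powr p + norm (w x) powr p))"
      using assms by (auto simp: in_Lp_def)
    have "norm (v x + w x) powr p \<le> 2 powr p * (norm (v x) powr p + norm (w x) powr p)" for x
      using powr_mono2[OF assms(1) norm_ge_zero norm_triangle_ineq[of "v x" "w x"]]
        powr_add_le[OF norm_ge_zero norm_ge_zero assms(1), of "v x" "w x"] by linarith
    then show "AE x in M. norm (norm (v x + w x) powr p) \<le> norm (2 powr p * (norm (v x) powr p + norm (w x) powr p))"
      by simp
  qed measurable
qed

lemma in_Lp_bound:
  fixes v :: "'a \<Rightarrow> 'b::{banach, second_countable_topology}" and w :: "'a \<Rightarrow> 'c::{banach, second_countable_topology}"
  assumes "0 \<le> p" "in_Lp M p v" "w \<in> borel_measurable M" "AE x in M. norm (w x) \<le> L * norm (v x)" "0 \<le> L"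
  shows "in_Lp M p w" "(\<integral>x. norm (w x) powr p \<partial>M) \<le> L powr p * (\<integral>x. norm (v x) powr p \<partial>M)"
proof -
  have [measurable]: "v \<in> borel_measurable M" using assms by (auto simp: in_Lp_def)
  have i: "integrable M (\<lambda>x. L powr p * norm (v x) powr p)"
    using assms(2) by (auto simp: in_Lp_def)
  have le: "AE x in M. norm (w x) powr p \<le> L powr p * norm (v x) powr p"
    using assms(4)
  proof eventually_elim
    case (elim x)
    then show ?case
      using powr_mono2[OF assms(1) norm_ge_zero elim] assms(5) by (simp add: powr_mult)
  qed
  have wi: "integrable M (\<lambda>x. norm (w x) powr p)"
    by (rule Bochner_Integration.integrable_bound[OF i]) (use le assms(3) in auto)
  then show "in_Lp M p w" using assms(3) by (simp add: in_Lp_def)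
  have "(\<integral>x. norm (w x) powr p \<partial>M) \<le> (\<integral>x. L powr p * norm (v x) powr p \<partial>M)"
    using wi i le by (rule integral_mono_AE)
  then show "(\<integral>x. norm (w x) powr p \<partial>M) \<le> L powr p * (\<integral>x. norm (v x) powr p \<partial>M)"
    by simp
qed

lemma Lp_norm_lessD:
  assumes "Lp_norm M p u < ereal e" "0 < p"
  shows "in_Lp M p u" "(\<integral>x. norm (u x) powr p \<partial>M) < e powr p"
proof -
  show 1: "in_Lp M p u" using assms by (auto simp: Lp_norm_def split: if_splits)
  let ?I = "\<integral>x. norm (u x) powr p \<partial>M"
  have "0 \<le> ?I" by (intro integral_nonneg_AE) auto
  moreover have "?I powr (1 / p) < e" using assms 1 by (simp add: Lp_norm_def)
  ultimately show "?I < e powr p"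
    using powr_less_mono2[of p "?I powr (1 / p)" e] assms(2) by (simp add: powr_powr)
qed

lemma Lp_norm_lessI:
  assumes "in_Lp M p u" "(\<integral>x. norm (u x) powr p \<partial>M) < e powr p" "0 < p" "0 < e"
  shows "Lp_norm M p u < ereal e"
  using powr_less_mono2[of "1 / p" "\<integral>x. norm (u x) powr p \<partial>M" "e powr p"] assms
  by (simp add: Lp_norm_def powr_powr integral_nonneg_AE)

lemma Lp_norm_nonneg: "0 \<le> Lp_norm M p u"
  by (simp add: Lp_norm_def)

lemma W1p_norm_lessD:
  assumes "W1p_norm \<Omega> p u < ereal e"
  shows "Lp_norm (lebesgue_on \<Omega>) p u < ereal e" "Lp_norm (lebesgue_on \<Omega>) p (weak_grad \<Omega> u) < ereal e"
proof -
  note n = Lp_norm_nonneg[of "lebesgue_on \<Omega>" p u] Lp_norm_nonneg[of "lebesgue_on \<Omega>" p "weak_grad \<Omega> u"]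
  show "Lp_norm (lebesgue_on \<Omega>) p u < ereal e"
    using assms n unfolding W1p_norm_def by (meson add_increasing2 le_less_trans order_refl)
  show "Lp_norm (lebesgue_on \<Omega>) p (weak_grad \<Omega> u) < ereal e"
    using assms n unfolding W1p_norm_def by (meson add_increasing le_less_trans order_refl)
qed

text \<open>Completeness of Lebesgue measure. Through it the arbitrarily chosen
  \<open>weak_grad\<close> inherits measurability from any measurable gradient that it equals almost
  everywhere.\<close>

lemma AE_eq_lebesgue_on_measurable:
  fixes f g :: "'a::euclidean_space \<Rightarrow> 'b::euclidean_space"
  assumes "\<Omega> \<in> sets lebesgue" "f \<in> borel_measurable (lebesgue_on \<Omega>)" "AE x in lebesgue_on \<Omega>. f x = g x"
  shows "g \<in> borel_measurable (lebesgue_on \<Omega>)"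
proof -
  have "(\<lambda>x. if x \<in> \<Omega> then f x else 0) \<in> borel_measurable lebesgue"
    using assms(1,2) by (simp add: borel_measurable_if)
  moreover have "AE x in lebesgue. (if x \<in> \<Omega> then f x else 0) = (if x \<in> \<Omega> then g x else 0)"
    using assms(3) assms(1) by (simp add: AE_restrict_space_iff)
  ultimately have "(\<lambda>x. if x \<in> \<Omega> then g x else 0) \<in> borel_measurable lebesgue"
    by (rule borel_measurable_AE)
  then show ?thesis
    using assms(1) by (simp add: borel_measurable_if)
qed

lemma test_function_measurable_lebesgue_on:
  assumes "test_function \<Omega> \<phi>"
  shows "\<phi> \<in> borel_measurable (lebesgue_on S)" "grad \<phi> \<in> borel_measurable (lebesgue_on S)"
proof -
  have "\<phi> \<in> borel_measurable lborel" "grad \<phi> \<in> borel_measurable lborel"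
    using test_function_borel[OF assms] by auto
  then show "\<phi> \<in> borel_measurable (lebesgue_on S)" "grad \<phi> \<in> borel_measurable (lebesgue_on S)"
    by (auto intro!: measurable_restrict_space1 measurable_completion)
qed

section \<open>Sobolev functions on a bounded open set\<close>

locale bounded_domain =
  fixes \<Omega> :: "'a::euclidean_space set" and p :: real
  assumes open_\<Omega>: "open \<Omega>" and bounded_\<Omega>: "bounded \<Omega>" and p: "1 \<le> p"
begin

abbreviation M where "M \<equiv> lebesgue_on \<Omega>"

lemma sets_\<Omega>: "\<Omega> \<in> sets lebesgue"
  using open_\<Omega> by (simp add: sets_completionI_sets)

lemma \<Omega>_lmeasurable: "\<Omega> \<in> lmeasurable"
  using bounded_\<Omega> open_\<Omega> lmeasurable_open by blast

sublocale finite_measure M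
  by (rule finite_measure_lebesgue_on[OF \<Omega>_lmeasurable])

lemma in_Lp_test_function:
  assumes "test_function \<Omega> \<phi>"
  shows "in_Lp M p \<phi>" "in_Lp M p (grad \<phi>)"
proof -
  obtain L where L: "0 < L" "\<And>x. \<bar>\<phi> x\<bar> \<le> L" "\<And>x. norm (grad \<phi> x) \<le> L"
    using test_function_bounded[OF assms] by metis
  show "in_Lp M p \<phi>"
    using p L by (intro in_Lp_bounded[of _ _ L] test_function_measurable_lebesgue_on[OF assms]) auto
  show "in_Lp M p (grad \<phi>)"
    using p L by (intro in_Lp_bounded[of _ _ L] test_function_measurable_lebesgue_on[OF assms]) auto
qed

lemma W0_weak_gradient:
  assumes "u \<in> W0_1p \<Omega> p"
  shows "has_weak_gradient \<Omega> u (weak_grad \<Omega> u)" "in_Lp M p u" "in_Lp M p (weak_grad \<Omega> u)"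
proof -
  obtain G where G: "has_weak_gradient \<Omega> u G" "in_Lp M p G" and u: "in_Lp M p u"
    using assms by (auto simp: W0_1p_def W1p_def)
  show "in_Lp M p u" by fact
  show "has_weak_gradient \<Omega> u (weak_grad \<Omega> u)"
    unfolding weak_grad_def using someI[of "has_weak_gradient \<Omega> u", OF G(1)] by simp
  have ae: "AE x in M. weak_grad \<Omega> u x = G x"
    by (rule weak_grad_AE[OF open_\<Omega> G(1)])
  have "weak_grad \<Omega> u \<in> borel_measurable M"
    by (rule AE_eq_lebesgue_on_measurable[OF sets_\<Omega>, of G])
      (use G(2) ae in \<open>auto simp: in_Lp_def elim: eventually_mono\<close>)
  then show "in_Lp M p (weak_grad \<Omega> u)"
  proof (intro in_Lp_bound(1)[of p M G "weak_grad \<Omega> u" 1])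
    show "AE x in M. norm (weak_grad \<Omega> u x) \<le> 1 * norm (G x)"
      using ae by eventually_elim simp
  qed (use G(2) p in auto)
qed

lemma weak_grad_diff_test:
  assumes "has_weak_gradient \<Omega> u G" "test_function \<Omega> \<phi>"
  shows "AE x in M. weak_grad \<Omega> (\<lambda>x. u x - \<phi> x) x = G x - grad \<phi> x"
  by (rule weak_grad_AE[OF open_\<Omega> has_weak_gradient_diff[OF sets_\<Omega> assms(1)
        has_weak_gradient_test_function[OF open_\<Omega> assms(2)]]])

text \<open>The definition of \<open>W0_1p\<close> speaks of \<open>weak_grad\<close> of a
  difference; uniqueness turns this into convergence of the classical gradients. The pointwise
  convergence is needed twice: for the continuity argument in the chain rule and for Fatou's lemma
  in the translation estimate.\<close>

lemma W0_approx:
  assumes u: "u \<in> W0_1p \<Omega> p"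
  obtains \<phi> where "\<And>n. test_function \<Omega> (\<phi> n)"
    "(\<lambda>n. \<integral>x. norm (u x - \<phi> n x) powr p \<partial>M) \<longlonglongrightarrow> 0"
    "(\<lambda>n. \<integral>x. norm (weak_grad \<Omega> u x - grad (\<phi> n) x) powr p \<partial>M) \<longlonglongrightarrow> 0"
    "AE x in M. (\<lambda>n. \<phi> n x) \<longlonglongrightarrow> u x"
proof -
  note wu = W0_weak_gradient[OF u]
  have "\<exists>\<phi>. test_function \<Omega> \<phi> \<and> W1p_norm \<Omega> p (\<lambda>x. u x - \<phi> x) < ereal e" if "0 < e" for e
    using u that by (auto simp: W0_1p_def)
  then have "\<forall>n. \<exists>\<phi>. test_function \<Omega> \<phi> \<and> W1p_norm \<Omega> p (\<lambda>x. u x - \<phi> x) < ereal (inverse (real (Suc n)))"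
    by simp
  then obtain \<psi> where \<psi>: "\<And>n. test_function \<Omega> (\<psi> n)"
    and W: "\<And>n. W1p_norm \<Omega> p (\<lambda>x. u x - \<psi> n x) < ereal (inverse (real (Suc n)))"
    by metis
  have lim0: "(\<lambda>n. inverse (real (Suc n)) powr p) \<longlonglongrightarrow> 0"
    using tendsto_powr'[OF LIMSEQ_inverse_real_of_nat tendsto_const[of p]] p by simp
  have 1: "(\<lambda>n. \<integral>x. norm (u x - \<psi> n x) powr p \<partial>M) \<longlonglongrightarrow> 0"
  proof (rule Lim_null_comparison[OF _ lim0], rule always_eventually, rule allI)
    show "norm (\<integral>x. norm (u x - \<psi> n x) powr p \<partial>M) \<le> inverse (real (Suc n)) powr p" for n
      using Lp_norm_lessD(2)[OF W1p_norm_lessD(1)[OF W]] p by (simp add: integral_nonneg_AE less_imp_le)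
  qed
  have 2: "(\<lambda>n. \<integral>x. norm (weak_grad \<Omega> u x - grad (\<psi> n) x) powr p \<partial>M) \<longlonglongrightarrow> 0"
  proof (rule Lim_null_comparison[OF _ lim0], rule always_eventually, rule allI)
    fix n
    have i: "in_Lp M p (weak_grad \<Omega> (\<lambda>x. u x - \<psi> n x))"
      and lt: "(\<integral>x. norm (weak_grad \<Omega> (\<lambda>x. u x - \<psi> n x) x) powr p \<partial>M) < inverse (real (Suc n)) powr p"
      using Lp_norm_lessD[OF W1p_norm_lessD(2)[OF W]] p by simp_all
    have "(\<integral>x. norm (weak_grad \<Omega> u x - grad (\<psi> n) x) powr p \<partial>M)
        = (\<integral>x. norm (weak_grad \<Omega> (\<lambda>x. u x - \<psi> n x) x) powr p \<partial>M)"
    proof (rule integral_cong_AE)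
      show "(\<lambda>x. norm (weak_grad \<Omega> u x - grad (\<psi> n) x) powr p) \<in> borel_measurable M"
        using wu(3) test_function_measurable_lebesgue_on[OF \<psi>, of n \<Omega>] by (auto simp: in_Lp_def)
      show "(\<lambda>x. norm (weak_grad \<Omega> (\<lambda>x. u x - \<psi> n x) x) powr p) \<in> borel_measurable M"
        using i by (auto simp: in_Lp_def)
      show "AE x in M. norm (weak_grad \<Omega> u x - grad (\<psi> n) x) powr p
          = norm (weak_grad \<Omega> (\<lambda>x. u x - \<psi> n x) x) powr p"
        using weak_grad_diff_test[OF wu(1) \<psi>, of n] by eventually_elim simp
    qed
    then show "norm (\<integral>x. norm (weak_grad \<Omega> u x - grad (\<psi> n) x) powr p \<partial>M) \<le> inverse (real (Suc n)) powr p"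
      using lt by (simp add: integral_nonneg_AE)
  qed
  \<comment> \<open>Convergence in Lp is L1 convergence to 0 of the p-th powers, and this yields a
    subsequence converging almost everywhere.\<close>
  have "\<exists>r::nat \<Rightarrow> nat. strict_mono r \<and> (AE x in M. (\<lambda>n. norm (u x - \<psi> (r n) x) powr p) \<longlonglongrightarrow> 0)"
  proof (rule tendsto_L1_AE_subseq)
    show "integrable M (\<lambda>x. norm (u x - \<psi> n x) powr p)" for n
      using Lp_norm_lessD(1)[OF W1p_norm_lessD(1)[OF W[of n]]] p by (simp add: in_Lp_def)
    show "(\<lambda>n. \<integral>x. norm (norm (u x - \<psi> n x) powr p) \<partial>M) \<longlonglongrightarrow> 0"
      using 1 by simp
  qed
  then obtain r :: "nat \<Rightarrow> nat" where r: "strict_mono r"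
    and ae: "AE x in M. (\<lambda>n. norm (u x - \<psi> (r n) x) powr p) \<longlonglongrightarrow> 0" by blast
  have "AE x in M. (\<lambda>n. \<psi> (r n) x) \<longlonglongrightarrow> u x"
    using ae
  proof eventually_elim
    case (elim x)
    have "(\<lambda>n. (norm (u x - \<psi> (r n) x) powr p) powr (1 / p)) \<longlonglongrightarrow> 0"
      using tendsto_powr'[OF elim tendsto_const[of "1 / p"]] p by simp
    then have "(\<lambda>n. norm (u x - \<psi> (r n) x)) \<longlonglongrightarrow> 0"
      using p by (simp add: powr_powr)
    then have "(\<lambda>n. \<psi> (r n) x - u x) \<longlonglongrightarrow> 0"
      by (subst tendsto_norm_zero_iff[symmetric]) (simp add: abs_minus_commute)
    then show ?case by (rule LIM_zero_cancel)
  qed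
  then show ?thesis
    using that[of "\<lambda>n. \<psi> (r n)"] \<psi> LIMSEQ_subseq_LIMSEQ[OF 1 r] LIMSEQ_subseq_LIMSEQ[OF 2 r]
    by (simp add: o_def)
qed

lemma W0_I:
  assumes "has_weak_gradient \<Omega> w G" "in_Lp M p w" "in_Lp M p G" "\<And>n. test_function \<Omega> (\<phi> n)"
    "(\<lambda>n. \<integral>x. norm (w x - \<phi> n x) powr p \<partial>M) \<longlonglongrightarrow> 0"
    "(\<lambda>n. \<integral>x. norm (G x - grad (\<phi> n) x) powr p \<partial>M) \<longlonglongrightarrow> 0"
  shows "w \<in> W0_1p \<Omega> p"
  unfolding W0_1p_def
proof (intro CollectI conjI allI impI)
  show "w \<in> W1p \<Omega> p"
    using assms by (auto simp: W1p_def)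
  fix e :: real assume e: "0 < e"
  then have e2: "0 < (e / 2) powr p" by simp
  have "\<forall>\<^sub>F n in sequentially. (\<integral>x. norm (w x - \<phi> n x) powr p \<partial>M) < (e / 2) powr p
      \<and> (\<integral>x. norm (G x - grad (\<phi> n) x) powr p \<partial>M) < (e / 2) powr p"
    using order_tendstoD(2)[OF assms(5) e2] order_tendstoD(2)[OF assms(6) e2] by (rule eventually_conj)
  then obtain n where n: "(\<integral>x. norm (w x - \<phi> n x) powr p \<partial>M) < (e / 2) powr p"
      "(\<integral>x. norm (G x - grad (\<phi> n) x) powr p \<partial>M) < (e / 2) powr p"
    by (auto simp: eventually_sequentially)
  have neg: "in_Lp M p (\<lambda>x. - v x)" if "in_Lp M p v" for v :: "'a \<Rightarrow> 'b::{banach, second_countable_topology}"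
    using that by (auto simp: in_Lp_def)
  note L = in_Lp_test_function[OF assms(4)[of n]]
  have i1: "in_Lp M p (\<lambda>x. w x - \<phi> n x)"
    using in_Lp_add[OF _ assms(2) neg[OF L(1)]] p by simp
  have i2: "in_Lp M p (\<lambda>x. G x - grad (\<phi> n) x)"
    using in_Lp_add[OF _ assms(3) neg[OF L(2)]] p by simp
  have ae: "AE x in M. G x - grad (\<phi> n) x = weak_grad \<Omega> (\<lambda>x. w x - \<phi> n x) x"
    using weak_grad_diff_test[OF assms(1,4), of n] by eventually_elim simp
  have m: "weak_grad \<Omega> (\<lambda>x. w x - \<phi> n x) \<in> borel_measurable M"
    by (rule AE_eq_lebesgue_on_measurable[OF sets_\<Omega> _ ae]) (use i2 in \<open>simp add: in_Lp_def\<close>)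
  have b: "AE x in M. norm (weak_grad \<Omega> (\<lambda>x. w x - \<phi> n x) x) \<le> 1 * norm (G x - grad (\<phi> n) x)"
    using ae by eventually_elim simp
  have i3: "in_Lp M p (weak_grad \<Omega> (\<lambda>x. w x - \<phi> n x))"
    "(\<integral>x. norm (weak_grad \<Omega> (\<lambda>x. w x - \<phi> n x) x) powr p \<partial>M) \<le> (\<integral>x. norm (G x - grad (\<phi> n) x) powr p \<partial>M)"
    using in_Lp_bound[OF _ i2 m b] p by simp_all
  have "Lp_norm M p (\<lambda>x. w x - \<phi> n x) < ereal (e / 2)"
    using i1 n(1) p e by (intro Lp_norm_lessI) auto
  moreover have "Lp_norm M p (weak_grad \<Omega> (\<lambda>x. w x - \<phi> n x)) < ereal (e / 2)"
    using i3 n(2) p e by (intro Lp_norm_lessI) auto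
  ultimately have "W1p_norm \<Omega> p (\<lambda>x. w x - \<phi> n x) < ereal (e / 2) + ereal (e / 2)"
    unfolding W1p_norm_def by (rule ereal_add_strict_mono2)
  then show "\<exists>\<phi>. test_function \<Omega> \<phi> \<and> W1p_norm \<Omega> p (\<lambda>x. w x - \<phi> x) < ereal e"
    using assms(4) by (intro exI[of _ "\<phi> n"]) simp
qed

end

section \<open>Chain rule and translation estimate in the Sobolev space\<close>

context bounded_domain
begin

text \<open>The functions H(\<phi> n) are test functions, so only their convergence is at stake. The
  gradient error is (H'(u) - H'(\<phi> n)) G + H'(\<phi> n) (G - grad (\<phi> n)): the first part
  vanishes in the limit by dominated convergence, the second because H' is bounded.\<close>

lemma W0_compose:
  assumes u: "u \<in> W0_1p \<Omega> p" and H: "smooth H" "H 0 = 0"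
    and H': "\<And>t. (H has_real_derivative H' t) (at t)" "continuous_on UNIV H'" "\<And>t. \<bar>H' t\<bar> \<le> L"
  shows "(\<lambda>x. H (u x)) \<in> W0_1p \<Omega> p"
    and "AE x in M. weak_grad \<Omega> (\<lambda>x. H (u x)) x = H' (u x) *\<^sub>R weak_grad \<Omega> u x"
proof -
  note wu = W0_weak_gradient[OF u]
  obtain \<phi> where \<phi>: "\<And>n. test_function \<Omega> (\<phi> n)"
    and c1: "(\<lambda>n. \<integral>x. norm (u x - \<phi> n x) powr p \<partial>M) \<longlonglongrightarrow> 0"
    and c2: "(\<lambda>n. \<integral>x. norm (weak_grad \<Omega> u x - grad (\<phi> n) x) powr p \<partial>M) \<longlonglongrightarrow> 0"
    and ae: "AE x in M. (\<lambda>n. \<phi> n x) \<longlonglongrightarrow> u x"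
    using W0_approx[OF u] by blast
  define G where "G = weak_grad \<Omega> u"
  define K where "K x = H' (u x) *\<^sub>R G x" for x
  define v where "v n x = H (\<phi> n x)" for n x
  have L: "0 \<le> L" using H'(3)[of 0] by linarith
  have Hlip: "\<bar>H s - H t\<bar> \<le> L * \<bar>s - t\<bar>" for s t
    using field_differentiable_bound[of UNIV H H' L s t] H'(1,3) by (auto simp: field_differentiable_def)
  have Hcont: "continuous_on UNIV H"
    using H'(1) by (meson DERIV_continuous_on has_field_derivative_at_within)
  have [measurable]: "H \<in> borel_measurable borel" "H' \<in> borel_measurable borel"
    using Hcont H'(2) by (auto intro: borel_measurable_continuous_onI)
  have [measurable]: "u \<in> borel_measurable M" "G \<in> borel_measurable M"
    using wu(2,3) by (auto simp: in_Lp_def G_def)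
  have [measurable]: "\<phi> n \<in> borel_measurable M" "grad (\<phi> n) \<in> borel_measurable M" for n
    using test_function_measurable_lebesgue_on[OF \<phi>] by auto
  have v: "test_function \<Omega> (v n)" for n
    unfolding v_def by (rule test_function_smooth[OF \<phi> H])
  have gv: "grad (v n) x = H' (\<phi> n x) *\<^sub>R grad (\<phi> n) x" for n x
    unfolding v_def by (rule grad_compose[OF \<phi> H'(1)])
  note Lv = in_Lp_test_function[OF v] and L\<phi> = in_Lp_test_function[OF \<phi>]
  have neg: "in_Lp M p (\<lambda>x. - f x)" if "in_Lp M p f" for f :: "'a \<Rightarrow> 'b::{banach, second_countable_topology}"
    using that by (auto simp: in_Lp_def)
  have p0: "0 \<le> p" using p by simp
  have iu: "in_Lp M p (\<lambda>x. H (u x))"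
    using Hlip[of _ 0] H(2) by (intro in_Lp_bound(1)[OF p0 wu(2) _ _ L]) auto
  have iG: "in_Lp M p G" using wu(3) by (simp add: G_def)
  have iK: "in_Lp M p K"
    unfolding K_def using H'(3) by (intro in_Lp_bound(1)[OF p0 iG _ _ L]) (auto intro!: mult_right_mono)
  have d1: "in_Lp M p (\<lambda>x. u x - \<phi> n x)" for n
    using in_Lp_add[OF p0 wu(2) neg[OF L\<phi>(1)]] by simp
  have d2: "in_Lp M p (\<lambda>x. G x - grad (\<phi> n) x)" for n
    using in_Lp_add[OF p0 iG neg[OF L\<phi>(2)]] by simp
  have d3: "in_Lp M p (\<lambda>x. H (u x) - v n x)" for n
    using in_Lp_add[OF p0 iu neg[OF Lv(1)]] by simp
  have d4: "in_Lp M p (\<lambda>x. K x - grad (v n) x)" for n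
    using in_Lp_add[OF p0 iK neg[OF Lv(2)]] by simp
  have l1: "(\<lambda>n. \<integral>x. norm (H (u x) - v n x) powr p \<partial>M) \<longlonglongrightarrow> 0"
  proof (rule Lim_null_comparison)
    show "(\<lambda>n. L powr p * (\<integral>x. norm (u x - \<phi> n x) powr p \<partial>M)) \<longlonglongrightarrow> 0"
      using tendsto_mult_right_zero[OF c1] by simp
    have "(\<integral>x. norm (H (u x) - v n x) powr p \<partial>M) \<le> L powr p * (\<integral>x. norm (u x - \<phi> n x) powr p \<partial>M)" for n
      unfolding v_def using Hlip by (intro in_Lp_bound(2)[OF p0 d1 _ _ L]) auto
    then show "\<forall>\<^sub>F n in sequentially. norm (\<integral>x. norm (H (u x) - v n x) powr p \<partial>M)
        \<le> L powr p * (\<integral>x. norm (u x - \<phi> n x) powr p \<partial>M)"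
      by (simp add: integral_nonneg_AE)
  qed
  have l2a: "(\<lambda>n. \<integral>x. norm ((H' (u x) - H' (\<phi> n x)) *\<^sub>R G x) powr p \<partial>M) \<longlonglongrightarrow> (\<integral>x. 0 \<partial>M)"
  proof (rule integral_dominated_convergence)
    show "integrable M (\<lambda>x. (2 * L) powr p * norm (G x) powr p)"
      using iG by (auto simp: in_Lp_def)
    show "AE x in M. (\<lambda>n. norm ((H' (u x) - H' (\<phi> n x)) *\<^sub>R G x) powr p) \<longlonglongrightarrow> 0"
      using ae
    proof eventually_elim
      case (elim x)
      have "(\<lambda>n. H' (\<phi> n x)) \<longlonglongrightarrow> H' (u x)"
        using continuous_on_tendsto_compose[OF H'(2) elim] by simp
      then have "(\<lambda>n. norm ((H' (u x) - H' (\<phi> n x)) *\<^sub>R G x)) \<longlonglongrightarrow> norm ((H' (u x) - H' (u x)) *\<^sub>R G x)"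
        by (intro tendsto_intros)
      then have "(\<lambda>n. norm ((H' (u x) - H' (\<phi> n x)) *\<^sub>R G x)) \<longlonglongrightarrow> 0" by simp
      from tendsto_powr'[OF this tendsto_const[of p]] p show ?case by simp
    qed
    show "AE x in M. norm (norm ((H' (u x) - H' (\<phi> n x)) *\<^sub>R G x) powr p) \<le> (2 * L) powr p * norm (G x) powr p" for n
    proof (rule AE_I2)
      fix x
      have "\<bar>H' (u x) - H' (\<phi> n x)\<bar> \<le> 2 * L" using H'(3)[of "u x"] H'(3)[of "\<phi> n x"] by linarith
      then have "norm ((H' (u x) - H' (\<phi> n x)) *\<^sub>R G x) \<le> 2 * L * norm (G x)"
        by (simp add: mult_right_mono)
      from powr_mono2[OF p0 norm_ge_zero this]
      show "norm (norm ((H' (u x) - H' (\<phi> n x)) *\<^sub>R G x) powr p) \<le> (2 * L) powr p * norm (G x) powr p"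
        using L by (simp add: powr_mult)
    qed
  qed measurable
  have l2: "(\<lambda>n. \<integral>x. norm (K x - grad (v n) x) powr p \<partial>M) \<longlonglongrightarrow> 0"
  proof (rule Lim_null_comparison)
    let ?A = "\<lambda>n. \<integral>x. norm ((H' (u x) - H' (\<phi> n x)) *\<^sub>R G x) powr p \<partial>M"
    let ?B = "\<lambda>n. \<integral>x. norm (G x - grad (\<phi> n) x) powr p \<partial>M"
    have "(\<lambda>n. 2 powr p * (?A n + L powr p * ?B n)) \<longlonglongrightarrow> 2 powr p * (0 + L powr p * 0)"
      using l2a c2 by (intro tendsto_intros) (simp_all add: G_def)
    then show "(\<lambda>n. 2 powr p * (?A n + L powr p * ?B n)) \<longlonglongrightarrow> 0" by simp
    have "(\<integral>x. norm (K x - grad (v n) x) powr p \<partial>M) \<le> 2 powr p * (?A n + L powr p * ?B n)" for n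
    proof -
      have j1: "in_Lp M p (\<lambda>x. (H' (u x) - H' (\<phi> n x)) *\<^sub>R G x)"
      proof (rule in_Lp_bound(1)[OF p0 iG])
        have "\<bar>H' (u x) - H' (\<phi> n x)\<bar> \<le> 2 * L" for x using H'(3)[of "u x"] H'(3)[of "\<phi> n x"] by linarith
        then show "AE x in M. norm ((H' (u x) - H' (\<phi> n x)) *\<^sub>R G x) \<le> 2 * L * norm (G x)"
          by (simp add: mult_right_mono)
      qed (use L in auto)
      have j2: "in_Lp M p (\<lambda>x. H' (\<phi> n x) *\<^sub>R (G x - grad (\<phi> n) x))"
        "(\<integral>x. norm (H' (\<phi> n x) *\<^sub>R (G x - grad (\<phi> n) x)) powr p \<partial>M) \<le> L powr p * ?B n"
      proof -
        have "AE x in M. norm (H' (\<phi> n x) *\<^sub>R (G x - grad (\<phi> n) x)) \<le> L * norm (G x - grad (\<phi> n) x)"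
          using H'(3) by (auto intro!: mult_right_mono)
        from in_Lp_bound[OF p0 d2 _ this L]
        show "in_Lp M p (\<lambda>x. H' (\<phi> n x) *\<^sub>R (G x - grad (\<phi> n) x))"
          "(\<integral>x. norm (H' (\<phi> n x) *\<^sub>R (G x - grad (\<phi> n) x)) powr p \<partial>M) \<le> L powr p * ?B n"
          by simp_all
      qed
      have "(\<integral>x. norm (K x - grad (v n) x) powr p \<partial>M)
        \<le> (\<integral>x. 2 powr p * (norm ((H' (u x) - H' (\<phi> n x)) *\<^sub>R G x) powr p
            + norm (H' (\<phi> n x) *\<^sub>R (G x - grad (\<phi> n) x)) powr p) \<partial>M)"
      proof (rule integral_mono)
        show "integrable M (\<lambda>x. norm (K x - grad (v n) x) powr p)"
          using d4 by (simp add: in_Lp_def)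
        show "integrable M (\<lambda>x. 2 powr p * (norm ((H' (u x) - H' (\<phi> n x)) *\<^sub>R G x) powr p
            + norm (H' (\<phi> n x) *\<^sub>R (G x - grad (\<phi> n) x)) powr p))"
          using j1 j2(1) by (simp add: in_Lp_def del: norm_scaleR)
        fix x
        have "K x - grad (v n) x = (H' (u x) - H' (\<phi> n x)) *\<^sub>R G x + H' (\<phi> n x) *\<^sub>R (G x - grad (\<phi> n) x)"
          by (simp add: K_def gv scaleR_left_diff_distrib scaleR_right_diff_distrib)
        then have "norm (K x - grad (v n) x) \<le> norm ((H' (u x) - H' (\<phi> n x)) *\<^sub>R G x) + norm (H' (\<phi> n x) *\<^sub>R (G x - grad (\<phi> n) x))"
          using norm_triangle_ineq by metis
        from powr_mono2[OF p0 norm_ge_zero this]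
        show "norm (K x - grad (v n) x) powr p \<le> 2 powr p * (norm ((H' (u x) - H' (\<phi> n x)) *\<^sub>R G x) powr p
            + norm (H' (\<phi> n x) *\<^sub>R (G x - grad (\<phi> n) x)) powr p)"
          using powr_add_le[OF norm_ge_zero norm_ge_zero p0] order.trans by blast
      qed
      also have "\<dots> = 2 powr p * (?A n + (\<integral>x. norm (H' (\<phi> n x) *\<^sub>R (G x - grad (\<phi> n) x)) powr p \<partial>M))"
        using j1 j2(1) by (simp add: in_Lp_def del: norm_scaleR)
      also have "\<dots> \<le> 2 powr p * (?A n + L powr p * ?B n)"
        using j2(2) by (intro mult_left_mono add_left_mono) auto
      finally show ?thesis .
    qed
    then show "\<forall>\<^sub>F n in sequentially. norm (\<integral>x. norm (K x - grad (v n) x) powr p \<partial>M) \<le> 2 powr p * (?A n + L powr p * ?B n)"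
      by (simp add: integral_nonneg_AE)
  qed
  have w: "has_weak_gradient \<Omega> (\<lambda>x. H (u x)) K"
  proof (rule has_weak_gradient_limit[OF sets_\<Omega> has_weak_gradient_test_function[OF open_\<Omega> v]])
    show "integrable M (v n)" "integrable M (grad (v n))" for n
      using Lv in_Lp_integrable[OF p] by blast+
    show "integrable M (\<lambda>x. H (u x))" "integrable M K"
      using iu iK in_Lp_integrable[OF p] by blast+
    show "(\<lambda>n. \<integral>x. \<bar>v n x - H (u x)\<bar> \<partial>M) \<longlonglongrightarrow> 0"
      using Lp_tendsto_0_imp_L1[OF p d3 l1] by (simp add: abs_minus_commute)
    show "(\<lambda>n. \<integral>x. norm (grad (v n) x - K x) \<partial>M) \<longlonglongrightarrow> 0"
      using Lp_tendsto_0_imp_L1[OF p d4 l2] by (simp add: norm_minus_commute)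
  qed
  show "(\<lambda>x. H (u x)) \<in> W0_1p \<Omega> p"
    by (rule W0_I[OF w iu iK v l1 l2])
  show "AE x in M. weak_grad \<Omega> (\<lambda>x. H (u x)) x = H' (u x) *\<^sub>R weak_grad \<Omega> u x"
    using weak_grad_AE[OF open_\<Omega> w] by (simp add: K_def G_def)
qed

text \<open>Fatou's lemma carries the estimate over from test functions. \<open>w'\<close> is a
  Borel representative of the extension by zero, so that shifts, and later the exchange of
  integrals, take place in \<open>lborel\<close>. With a nonnegative integral on the left,
  integrability of the difference is no separate issue.\<close>

lemma W0_translation:
  assumes w: "w \<in> W0_1p \<Omega> p"
  obtains w' where "w' \<in> borel_measurable borel" "AE x in lebesgue. w' x = indicator \<Omega> x * w x"
    "\<And>z. (\<integral>\<^sup>+x. ennreal \<bar>w' (x + z) - w' x\<bar> \<partial>lborel) \<le> ennreal (norm z * (\<integral>x. norm (weak_grad \<Omega> w x) \<partial>M))"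
proof -
  note ww = W0_weak_gradient[OF w]
  obtain \<phi> where \<phi>: "\<And>n. test_function \<Omega> (\<phi> n)"
    and c1: "(\<lambda>n. \<integral>x. norm (w x - \<phi> n x) powr p \<partial>M) \<longlonglongrightarrow> 0"
    and c2: "(\<lambda>n. \<integral>x. norm (weak_grad \<Omega> w x - grad (\<phi> n) x) powr p \<partial>M) \<longlonglongrightarrow> 0"
    and ae: "AE x in M. (\<lambda>n. \<phi> n x) \<longlonglongrightarrow> w x"
    using W0_approx[OF w] by blast
  have p0: "0 \<le> p" using p by simp
  have "(\<lambda>x. indicator \<Omega> x * w x) \<in> borel_measurable lebesgue"
    using ww(2) sets_\<Omega> by (simp add: in_Lp_def borel_measurable_restrict_space_iff mult.commute)
  then obtain w' where w'0: "w' \<in> borel_measurable lborel" "AE x in lborel. indicator \<Omega> x * w x = w' x"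
    using completion_ex_borel_measurable_real by blast
  then have w' [measurable]: "w' \<in> borel_measurable borel" by simp
  have aew': "AE x in lebesgue. w' x = indicator \<Omega> x * w x"
    using AE_completion[OF w'0(2)] by eventually_elim simp
  have \<phi>0: "\<phi> n x = 0" if "x \<notin> \<Omega>" for n x
    using test_functionE[OF \<phi>[of n]] that by (metis subsetD)
  have "AE x in lebesgue. x \<in> \<Omega> \<longrightarrow> (\<lambda>n. \<phi> n x) \<longlonglongrightarrow> w x"
    using ae sets_\<Omega> by (simp add: AE_restrict_space_iff)
  then have "AE x in lebesgue. (\<lambda>n. \<phi> n x) \<longlonglongrightarrow> w' x"
    using aew'
  proof eventually_elim
    case (elim x)
    then show ?case using \<phi>0[of x] by (cases "x \<in> \<Omega>") simp_all
  qed
  then have l: "AE x in lborel. (\<lambda>n. \<phi> n x) \<longlonglongrightarrow> w' x"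
    by (simp add: AE_completion_iff)
  note [measurable] = test_function_borel[OF \<phi>]
  have L1: "(\<lambda>n. \<integral>x. norm (grad (\<phi> n) x) \<partial>lborel) \<longlonglongrightarrow> (\<integral>x. norm (weak_grad \<Omega> w x) \<partial>M)"
  proof -
    have d: "in_Lp M p (\<lambda>x. weak_grad \<Omega> w x - grad (\<phi> n) x)" for n
    proof -
      have "in_Lp M p (\<lambda>x. - grad (\<phi> n) x)"
        using in_Lp_test_function(2)[OF \<phi>] by (auto simp: in_Lp_def)
      from in_Lp_add[OF p0 ww(3) this] show ?thesis by simp
    qed
    have "(\<lambda>n. \<integral>x. norm (grad (\<phi> n) x) \<partial>M) \<longlonglongrightarrow> (\<integral>x. norm (weak_grad \<Omega> w x) \<partial>M)"
    proof (rule LIM_zero_cancel, rule Lim_null_comparison[OF always_eventually Lp_tendsto_0_imp_L1[OF p d c2]], rule allI)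
      fix n
      have i: "integrable M (\<lambda>x. norm (grad (\<phi> n) x))" "integrable M (\<lambda>x. norm (weak_grad \<Omega> w x))"
        "integrable M (\<lambda>x. weak_grad \<Omega> w x - grad (\<phi> n) x)"
        using in_Lp_integrable[OF p in_Lp_test_function(2)[OF \<phi>]] in_Lp_integrable[OF p ww(3)] by auto
      have "norm ((\<integral>x. norm (grad (\<phi> n) x) \<partial>M) - (\<integral>x. norm (weak_grad \<Omega> w x) \<partial>M))
          = norm (\<integral>x. norm (grad (\<phi> n) x) - norm (weak_grad \<Omega> w x) \<partial>M)"
        using i by simp
      also have "\<dots> \<le> (\<integral>x. norm (norm (grad (\<phi> n) x) - norm (weak_grad \<Omega> w x)) \<partial>M)"
        by (rule integral_norm_bound)
      also have "\<dots> \<le> (\<integral>x. norm (weak_grad \<Omega> w x - grad (\<phi> n) x) \<partial>M)"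
      proof (rule integral_mono)
        show "norm (norm (grad (\<phi> n) x) - norm (weak_grad \<Omega> w x)) \<le> norm (weak_grad \<Omega> w x - grad (\<phi> n) x)" for x
          using norm_triangle_ineq3[of "grad (\<phi> n) x" "weak_grad \<Omega> w x"] by (simp add: norm_minus_commute)
      qed (use i in auto)
      finally show "norm ((\<integral>x. norm (grad (\<phi> n) x) \<partial>M) - (\<integral>x. norm (weak_grad \<Omega> w x) \<partial>M))
          \<le> (\<integral>x. norm (weak_grad \<Omega> w x - grad (\<phi> n) x) \<partial>M)" .
    qed
    moreover have "(\<integral>x. norm (grad (\<phi> n) x) \<partial>M) = (\<integral>x. norm (grad (\<phi> n) x) \<partial>lborel)" for n
    proof (rule integral_lebesgue_on_support[OF sets_\<Omega>])
      show "norm (grad (\<phi> n) x) = 0" if "x \<notin> \<Omega>" for x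
        using test_functionE[OF \<phi>[of n]] that by (metis subsetD norm_zero)
    qed measurable
    ultimately show ?thesis by simp
  qed
  show ?thesis
  proof (rule that[OF w' aew'])
    fix z
    \<comment> \<open>The image of \<open>lborel\<close> under a shift is \<open>lborel\<close>, so
      almost everywhere convergence survives the shift.\<close>
    have "AE x in distr lborel borel ((+) z). (\<lambda>n. \<phi> n x) \<longlonglongrightarrow> w' x"
      by (subst lborel_distr_plus) (rule l)
    then have l': "AE x in lborel. (\<lambda>n. \<phi> n (x + z)) \<longlonglongrightarrow> w' (x + z)"
      using AE_distrD[of "(+) z" lborel borel] by (simp add: add.commute)
    have "(\<integral>\<^sup>+x. ennreal \<bar>w' (x + z) - w' x\<bar> \<partial>lborel) = (\<integral>\<^sup>+x. liminf (\<lambda>n. ennreal \<bar>\<phi> n (x + z) - \<phi> n x\<bar>) \<partial>lborel)"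
    proof (rule nn_integral_cong_AE)
      show "AE x in lborel. ennreal \<bar>w' (x + z) - w' x\<bar> = liminf (\<lambda>n. ennreal \<bar>\<phi> n (x + z) - \<phi> n x\<bar>)"
        using l l'
      proof eventually_elim
        case (elim x)
        have "(\<lambda>n. ennreal \<bar>\<phi> n (x + z) - \<phi> n x\<bar>) \<longlonglongrightarrow> ennreal \<bar>w' (x + z) - w' x\<bar>"
          using elim by (intro tendsto_ennrealI tendsto_rabs tendsto_diff)
        from lim_imp_Liminf[OF sequentially_bot this] show ?case by (rule sym)
      qed
    qed
    also have "\<dots> \<le> liminf (\<lambda>n. \<integral>\<^sup>+x. ennreal \<bar>\<phi> n (x + z) - \<phi> n x\<bar> \<partial>lborel)"
      by (rule nn_integral_liminf) measurable
    also have "\<dots> \<le> liminf (\<lambda>n. ennreal (norm z * (\<integral>x. norm (grad (\<phi> n) x) \<partial>lborel)))"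
    proof (rule Liminf_mono, rule always_eventually, rule allI)
      fix n
      have "integrable lborel (\<lambda>x. \<bar>\<phi> n (x + z) - \<phi> n x\<bar>)"
        by (intro integrable_abs Bochner_Integration.integrable_diff integral_lborel_shift(2)
            integrable_test_function[OF \<phi>]) auto
      then have "(\<integral>\<^sup>+x. ennreal \<bar>\<phi> n (x + z) - \<phi> n x\<bar> \<partial>lborel) = ennreal (\<integral>x. \<bar>\<phi> n (x + z) - \<phi> n x\<bar> \<partial>lborel)"
        by (intro nn_integral_eq_integral) auto
      also have "\<dots> \<le> ennreal (norm z * (\<integral>x. norm (grad (\<phi> n) x) \<partial>lborel))"
        by (rule ennreal_leI[OF test_function_translation_L1[OF \<phi>]])
      finally show "(\<integral>\<^sup>+x. ennreal \<bar>\<phi> n (x + z) - \<phi> n x\<bar> \<partial>lborel)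
          \<le> ennreal (norm z * (\<integral>x. norm (grad (\<phi> n) x) \<partial>lborel))" .
    qed
    also have "\<dots> = ennreal (norm z * (\<integral>x. norm (weak_grad \<Omega> w x) \<partial>M))"
      using L1 by (intro lim_imp_Liminf tendsto_ennrealI tendsto_mult tendsto_const) auto
    finally show "(\<integral>\<^sup>+x. ennreal \<bar>w' (x + z) - w' x\<bar> \<partial>lborel)
        \<le> ennreal (norm z * (\<integral>x. norm (weak_grad \<Omega> w x) \<partial>M))" .
  qed
qed

end

section \<open>Level sets of weak solutions\<close>

lemma measure_ball_pos: "0 < r \<Longrightarrow> 0 < measure lborel (ball (c :: 'a::euclidean_space) r)"
  by (simp add: content_ball)

text \<open>At least half of the shifts \<open>z\<close> with \<open>|z| < r\<close> move a given point out of \<open>{w \<noteq> 0}\<close>.\<close>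
lemma level_set_L1:
  fixes w :: "'a::euclidean_space \<Rightarrow> real"
  assumes w [measurable]: "w \<in> borel_measurable borel"
    and trans: "\<And>z. (\<integral>\<^sup>+x. ennreal \<bar>w (x + z) - w x\<bar> \<partial>lborel) \<le> ennreal (norm z * D)"
    and D: "0 \<le> D" and r: "0 < r" and c: "0 < c"
    and A: "emeasure lborel {x. w x \<noteq> 0} \<noteq> \<infinity>" "2 * measure lborel {x. w x \<noteq> 0} \<le> measure lborel (ball (0::'a) r)"
  shows "c * measure lborel {x. c \<le> \<bar>w x\<bar>} \<le> 2 * r * D"
proof -
  define V where "V = measure lborel (ball (0::'a) r)"
  define b where "b = measure lborel {x. c \<le> \<bar>w x\<bar>}"
  have V: "0 < V" unfolding V_def using r by (rule measure_ball_pos)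
  have emV: "emeasure lborel (ball (0::'a) r) = ennreal V"
    unfolding V_def using emeasure_lborel_ball_finite[of "0::'a" r] by (intro emeasure_eq_ennreal_measure) simp
  have sub: "{x. c \<le> \<bar>w x\<bar>} \<subseteq> {x. w x \<noteq> 0}" using c by auto
  have "emeasure lborel {x. c \<le> \<bar>w x\<bar>} \<le> emeasure lborel {x. w x \<noteq> 0}"
    by (rule emeasure_mono[OF sub]) simp
  then have emb: "emeasure lborel {x. c \<le> \<bar>w x\<bar>} = ennreal b"
    unfolding b_def using A(1) by (intro emeasure_eq_ennreal_measure) (auto simp: top_unique)
  have inner: "ennreal (c * (V / 2)) * indicator {x. c \<le> \<bar>w x\<bar>} x
      \<le> (\<integral>\<^sup>+z. indicator (ball 0 r) z * ennreal \<bar>w (x + z) - w x\<bar> \<partial>lborel)" for x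
  proof (cases "c \<le> \<bar>w x\<bar>")
    case True
    \<comment> \<open>The shifts that keep the point inside {w \<noteq> 0}. They form a translate of
      that set, hence have at most half the measure of the ball; every other shift in the ball
      changes \<open>w\<close> by at least \<open>c\<close>.\<close>
    define E where "E = {z. w (x + z) \<noteq> 0}"
    have E [measurable]: "E \<in> sets borel" unfolding E_def by measurable
    have "emeasure (distr lborel borel ((+) x)) {x. w x \<noteq> 0} = emeasure lborel ((+) x -` {x. w x \<noteq> 0} \<inter> space lborel)"
      by (rule emeasure_distr) auto
    moreover have "(+) x -` {x. w x \<noteq> 0} \<inter> space lborel = E" by (auto simp: E_def)
    ultimately have eE: "emeasure lborel E = emeasure lborel {x. w x \<noteq> 0}"
      by (simp add: lborel_distr_plus)
    have eE': "emeasure lborel E = ennreal (measure lborel {x. w x \<noteq> 0})"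
      unfolding eE using A(1) by (intro emeasure_eq_ennreal_measure) simp
    have "emeasure lborel (ball 0 r - E) \<le> emeasure lborel (ball (0::'a) r)"
      by (rule emeasure_mono) auto
    then have X: "emeasure lborel (ball 0 r - E) = ennreal (measure lborel (ball 0 r - E))"
      by (intro emeasure_eq_ennreal_measure) (auto simp: emV top_unique)
    have "emeasure lborel (ball (0::'a) r) \<le> emeasure lborel ((ball 0 r - E) \<union> E)"
      by (rule emeasure_mono) (blast, simp)
    also have "\<dots> \<le> emeasure lborel (ball 0 r - E) + emeasure lborel E"
      by (rule emeasure_subadditive) auto
    finally have "V \<le> measure lborel (ball 0 r - E) + measure lborel {x. w x \<noteq> 0}"
      by (simp add: emV eE' X flip: ennreal_plus)
    then have "V / 2 \<le> measure lborel (ball 0 r - E)"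
      using A(2) by (simp add: V_def)
    then have "ennreal (V / 2) \<le> emeasure lborel (ball 0 r - E)"
      unfolding X by (rule ennreal_leI)
    then have "ennreal c * ennreal (V / 2) \<le> ennreal c * emeasure lborel (ball 0 r - E)"
      by (rule mult_left_mono) simp
    also have "\<dots> = (\<integral>\<^sup>+z. ennreal c * indicator (ball 0 r - E) z \<partial>lborel)"
      by (simp add: nn_integral_cmult_indicator)
    also have "\<dots> \<le> (\<integral>\<^sup>+z. indicator (ball 0 r) z * ennreal \<bar>w (x + z) - w x\<bar> \<partial>lborel)"
      using True by (intro nn_integral_mono) (auto simp: indicator_def E_def intro!: ennreal_leI)
    finally show ?thesis
      using True c V ennreal_mult[of c "V / 2"] by (simp del: times_divide_eq_right)
  qed simp
  have "ennreal (c * (V / 2)) * ennreal b = (\<integral>\<^sup>+x. ennreal (c * (V / 2)) * indicator {x. c \<le> \<bar>w x\<bar>} x \<partial>lborel)"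
    by (subst nn_integral_cmult_indicator) (auto simp: emb)
  also have "\<dots> \<le> (\<integral>\<^sup>+x. \<integral>\<^sup>+z. indicator (ball 0 r) z * ennreal \<bar>w (x + z) - w x\<bar> \<partial>lborel \<partial>lborel)"
    by (rule nn_integral_mono[OF inner])
  \<comment> \<open>After the exchange the inner integral runs over x for a fixed shift, where
    \<open>trans\<close> applies.\<close>
  also have "\<dots> = (\<integral>\<^sup>+z. \<integral>\<^sup>+x. indicator (ball 0 r) z * ennreal \<bar>w (x + z) - w x\<bar> \<partial>lborel \<partial>lborel)"
  proof (rule lborel_pair.Fubini')
    have "(\<lambda>q. w (fst q + snd q)) \<in> borel_measurable (lborel \<Otimes>\<^sub>M lborel)"
      by (rule measurable_compose[OF _ w]) measurable
    moreover have "(\<lambda>q. w (snd q)) \<in> borel_measurable (lborel \<Otimes>\<^sub>M lborel)"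
      "(\<lambda>q. w (fst q)) \<in> borel_measurable (lborel \<Otimes>\<^sub>M lborel)"
      by (rule measurable_compose[OF _ w]; measurable)+
    moreover have i: "(indicator (ball (0::'a) r) :: 'a \<Rightarrow> ennreal) \<in> borel_measurable lborel"
      by (rule borel_measurable_indicator) simp
    have "(\<lambda>q. indicator (ball (0::'a) r) (snd q) :: ennreal) \<in> borel_measurable (lborel \<Otimes>\<^sub>M lborel)"
      "(\<lambda>q. indicator (ball (0::'a) r) (fst q) :: ennreal) \<in> borel_measurable (lborel \<Otimes>\<^sub>M lborel)"
      by (rule measurable_compose[OF _ i]; measurable)+
    ultimately show "(\<lambda>(z, x). indicator (ball 0 r) z * ennreal \<bar>w (x + z) - w x\<bar>) \<in> borel_measurable (lborel \<Otimes>\<^sub>M lborel)"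
      unfolding split_beta' by measurable
  qed
  also have "\<dots> = (\<integral>\<^sup>+z. indicator (ball 0 r) z * (\<integral>\<^sup>+x. ennreal \<bar>w (x + z) - w x\<bar> \<partial>lborel) \<partial>lborel)"
    by (intro nn_integral_cong nn_integral_cmult) auto
  also have "\<dots> \<le> (\<integral>\<^sup>+z. ennreal (r * D) * indicator (ball (0::'a) r) z \<partial>lborel)"
  proof (rule nn_integral_mono)
    fix z :: 'a
    show "indicator (ball 0 r) z * (\<integral>\<^sup>+x. ennreal \<bar>w (x + z) - w x\<bar> \<partial>lborel) \<le> ennreal (r * D) * indicator (ball 0 r) z"
    proof (cases "z \<in> ball 0 r")
      case True
      then have "norm z * D \<le> r * D" using D by (intro mult_right_mono) auto
      then show ?thesis using True order.trans[OF trans[of z] ennreal_leI] by simp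
    qed simp
  qed
  also have "\<dots> = ennreal (r * D) * ennreal V"
    by (subst nn_integral_cmult_indicator) (auto simp: emV)
  finally have "ennreal (c * (V / 2)) * ennreal b \<le> ennreal (r * D) * ennreal V" .
  moreover have "ennreal (c * (V / 2)) * ennreal b = ennreal (c * (V / 2) * b)"
    using c V by (intro ennreal_mult[symmetric]) (auto simp: b_def)
  moreover have "ennreal (r * D) * ennreal V = ennreal (r * D * V)"
    using r D V by (intro ennreal_mult[symmetric]) auto
  ultimately have "ennreal (c * (V / 2) * b) \<le> ennreal (r * D * V)" by simp
  then have "c * (V / 2) * b \<le> r * D * V"
    using r D V by (subst (asm) ennreal_le_iff) auto
  then have "V * (c * b) \<le> V * (2 * r * D)" by (simp add: algebra_simps)
  then show ?thesis using V by (simp add: b_def)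
qed

text \<open>An odd, smooth substitute for cutting |s| off below k and above k + d. Scaling both the
  argument and the value by d keeps the derivative bounded independently of k and d: two summands of
  at most 2 each.\<close>

definition truncation :: "real \<Rightarrow> real \<Rightarrow> real \<Rightarrow> real" where
  "truncation k d s = d * smoothstep ((s - k) / d) - d * smoothstep ((- s - k) / d)"

definition truncation_deriv :: "real \<Rightarrow> real \<Rightarrow> real \<Rightarrow> real" where
  "truncation_deriv k d s = smoothstep_deriv ((s - k) / d) + smoothstep_deriv ((- s - k) / d)"

lemma smooth_truncation: "smooth (truncation k d)"
proof -
  have "smooth (\<lambda>s. d * smoothstep (1 / d * s + (- k / d)) - d * smoothstep (- 1 / d * s + (- k / d)))"
    by (intro smooth_diff smooth_affine smooth_smoothstep)
  then show ?thesis
    by (simp add: truncation_def[abs_def] diff_divide_distrib)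
qed

lemma DERIV_truncation:
  assumes "d \<noteq> 0"
  shows "(truncation k d has_real_derivative truncation_deriv k d s) (at s)"
  unfolding truncation_def[abs_def] truncation_deriv_def
  by (auto intro!: derivative_eq_intros DERIV_chain2[OF DERIV_smoothstep] simp: assms)

lemma truncation_deriv_continuous: "continuous_on UNIV (truncation_deriv k d)"
  unfolding truncation_deriv_def[abs_def] divide_inverse
  by (intro continuous_intros continuous_on_compose2[OF smoothstep_deriv_continuous]) auto

lemma truncation_deriv_bounds: "0 \<le> truncation_deriv k d s" "truncation_deriv k d s \<le> 4"
  using smoothstep_deriv_bounds[of "(s - k) / d"] smoothstep_deriv_bounds[of "(- s - k) / d"]
  by (simp_all add: truncation_deriv_def)

lemma truncation_eq_0:
  assumes "\<bar>s\<bar> \<le> k" "0 < d"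
  shows "truncation k d s = 0" "truncation_deriv k d s = 0"
proof -
  have "\<not> 0 < (s - k) / d" "\<not> 0 < (- s - k) / d"
    using assms by (auto simp: zero_less_divide_iff)
  then show "truncation k d s = 0" "truncation_deriv k d s = 0"
    by (simp_all add: truncation_def truncation_deriv_def smoothstep_def smoothstep_deriv_def)
qed

lemma truncation_le:
  assumes "0 < d"
  shows "\<bar>truncation k d s\<bar> \<le> d"
proof -
  have "d * smoothstep t \<le> d * 1" "0 \<le> d * smoothstep t" for t
    using assms smoothstep_bounds[of t] by (intro mult_left_mono mult_nonneg_nonneg; simp)+
  from this[of "(s - k) / d"] this[of "(- s - k) / d"] show ?thesis
    unfolding truncation_def by linarith
qed

text \<open>Beyond k + d one of the two steps has an argument above 1, where its value is at least
  1/e and thus at least 1/3; the other step is 0.\<close>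

lemma truncation_ge:
  assumes "k + d < \<bar>s\<bar>" "0 \<le> k" "0 < d"
  shows "d / 3 \<le> \<bar>truncation k d s\<bar>"
proof -
  have "exp 1 \<le> (3::real)" using e_less_272 by simp
  then have "1 / 3 \<le> smoothstep 1"
    by (simp add: smoothstep_def exp_minus divide_simps)
  then have g: "d / 3 \<le> d * smoothstep t" if "1 \<le> t" for t
    using smoothstep_mono[OF that] mult_left_mono[of "1 / 3" "smoothstep t" d] assms(3) by auto
  have z: "smoothstep t = 0" if "t < 0" for t using that by (simp add: smoothstep_def)
  show ?thesis
  proof (cases "0 \<le> s")
    case True
    then have "1 \<le> (s - k) / d" "(- s - k) / d < 0"
      using assms by (auto simp: divide_simps)
    then show ?thesis using g[of "(s - k) / d"] z[of "(- s - k) / d"] by (simp add: truncation_def)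
  next
    case False
    then have "1 \<le> (- s - k) / d" "(s - k) / d < 0"
      using assms by (auto simp: divide_simps)
    then show ?thesis using g[of "(- s - k) / d"] z[of "(s - k) / d"] by (simp add: truncation_def)
  qed
qed

section \<open>The level set inequality for weak solutions\<close>

context bounded_domain
begin

text \<open>The exponent that a weak solution prescribes for its source is at least 1, and the
  measure is finite. The integrals of the source over level sets are therefore meaningful.\<close>

lemma weak_solution_source_integrable:
  assumes "1 < p" "p < real DIM('a)" and sol: "weak_solution \<Omega> p f u"
  shows "integrable M (\<lambda>x. f x (u x))"
proof -
  have ex: "1 \<le> conj_exponent (critical_exponent (real DIM('a)) p)"
  proof -
    have "1 < critical_exponent (real DIM('a)) p"
      using assms(1,2) by (simp add: critical_exponent_def pos_less_divide_eq algebra_simps)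
         (smt (verit) mult_less_cancel_left1 mult.commute)
    then show ?thesis by (simp add: conj_exponent_def)
  qed
  show ?thesis
    using sol unfolding weak_solution_def by (intro in_Lp_integrable[OF ex]) (elim conjE)
qed

text \<open>Testing with \<open>w\<close> bounds the integral of T'(u) |G|^p by d F, since |w| <= d
  and \<open>w\<close> vanishes off \<open>A\<close>. The Young-type bound with parameter
  \<open>l\<close> converts this into an L1 bound for the gradient of \<open>w\<close>, and
  \<open>level_set_L1\<close> at height d / 3 concludes. The 4 bounds T'; the 6 is 2 times the 3
  from the height.\<close>

lemma level_set_inequality:
  assumes "1 < p" "p < real DIM('a)" and sol: "weak_solution \<Omega> p f u"
    and k: "0 \<le> k" and d: "0 < d" and l: "0 < l" and r: "0 < r"
    and vol: "2 * measure M {x\<in>\<Omega>. k < \<bar>u x\<bar>} \<le> unit_ball_vol (real DIM('a)) * r ^ DIM('a)"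
  shows "d * measure M {x\<in>\<Omega>. k + d < \<bar>u x\<bar>}
    \<le> 6 * r * (4 * l * measure M {x\<in>\<Omega>. k < \<bar>u x\<bar>}
        + l powr (1 - p) * d * (\<integral>x. indicator {x\<in>\<Omega>. k < \<bar>u x\<bar>} x * \<bar>f x (u x)\<bar> \<partial>M))"
proof -
  define G where "G = weak_grad \<Omega> u"
  define T where "T = truncation k d"
  define T' where "T' = truncation_deriv k d"
  define A where "A = {x\<in>\<Omega>. k < \<bar>u x\<bar>}"
  define B where "B = {x\<in>\<Omega>. k + d < \<bar>u x\<bar>}"
  define F where "F = (\<integral>x. indicator A x * \<bar>f x (u x)\<bar> \<partial>M)"
  define w where "w x = T (u x)" for x
  have u: "u \<in> W0_1p \<Omega> p" using sol by (simp add: weak_solution_def)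
  note wu = W0_weak_gradient[OF u]
  have [measurable]: "u \<in> borel_measurable M" "G \<in> borel_measurable M"
    using wu by (auto simp: in_Lp_def G_def)
  have spM: "space M = \<Omega>" by (simp add: space_restrict_space)
  have A_eq: "A = {x\<in>space M. k < \<bar>u x\<bar>}" and B_eq: "B = {x\<in>space M. k + d < \<bar>u x\<bar>}"
    by (simp_all add: A_def B_def spM)
  have Am [measurable]: "A \<in> sets M" and Bm [measurable]: "B \<in> sets M"
    unfolding A_eq B_eq by measurable
  have fi: "integrable M (\<lambda>x. f x (u x))"
    by (rule weak_solution_source_integrable[OF assms(1,2) sol])
  then have [measurable]: "(\<lambda>x. f x (u x)) \<in> borel_measurable M" by auto
  have fA: "integrable M (\<lambda>x. indicator A x * \<bar>f x (u x)\<bar>)"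
    using integrable_mult_indicator[OF Am integrable_abs[OF fi]] by simp
  have T': "(T has_real_derivative T' t) (at t)" for t
    unfolding T_def T'_def using d by (intro DERIV_truncation) simp
  have T'b: "\<bar>T' t\<bar> \<le> 4" "0 \<le> T' t" for t
    using truncation_deriv_bounds[of k d t] by (simp_all add: T'_def)
  have T'c: "continuous_on UNIV T'" by (simp add: T'_def truncation_deriv_continuous)
  have T0: "T 0 = 0" unfolding T_def using k d by (intro truncation_eq_0) auto
  have [measurable]: "T \<in> borel_measurable borel" "T' \<in> borel_measurable borel"
    using T'c T' by (auto intro!: borel_measurable_continuous_onI DERIV_continuous_on intro: has_field_derivative_at_within)
  have w: "w \<in> W0_1p \<Omega> p" and gw: "AE x in M. weak_grad \<Omega> w x = T' (u x) *\<^sub>R G x"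
    unfolding w_def G_def using W0_compose[OF u _ T0 T' T'c T'b(1)] smooth_truncation[of k d] by (auto simp: T_def)
  have wg [measurable]: "weak_grad \<Omega> w \<in> borel_measurable M"
    using W0_weak_gradient(3)[OF w] by (simp add: in_Lp_def)
  have Gp: "integrable M (\<lambda>x. T' (u x) * norm (G x) powr p)"
  proof (rule Bochner_Integration.integrable_bound)
    show "integrable M (\<lambda>x. 4 * norm (G x) powr p)" using wu(3) by (simp add: in_Lp_def G_def)
    show "AE x in M. norm (T' (u x) * norm (G x) powr p) \<le> norm (4 * norm (G x) powr p)"
      using T'b(1) by (intro AE_I2) (simp add: abs_mult mult_right_mono)
  qed measurable
  have energy: "(\<integral>x. T' (u x) * norm (G x) powr p \<partial>M) \<le> d * F"
  proof -
    have "(\<integral>x. T' (u x) * norm (G x) powr p \<partial>M)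
        = (\<integral>x. (norm (G x) powr (p - 2) *\<^sub>R G x) \<bullet> weak_grad \<Omega> w x \<partial>M)"
    proof (rule integral_cong_AE)
      \<comment> \<open>At g = 0 both sides are 0 whatever the sign of p - 2, because
        \<open>0 powr\<close> any exponent is 0.\<close>
      have e: "norm g powr (p - 2) * (norm g)\<^sup>2 = norm g powr p" for g :: 'a
        by (cases "g = 0") (simp_all flip: powr_numeral powr_add)
      show "AE x in M. T' (u x) * norm (G x) powr p = (norm (G x) powr (p - 2) *\<^sub>R G x) \<bullet> weak_grad \<Omega> w x"
        using gw by eventually_elim (simp add: e[symmetric] power2_norm_eq_inner)
    qed measurable
    also have "\<dots> = (\<integral>x. f x (u x) * w x \<partial>M)"
      using sol w by (simp add: weak_solution_def G_def)
    also have "\<dots> \<le> (\<integral>x. d * (indicator A x * \<bar>f x (u x)\<bar>) \<partial>M)"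
    proof (rule integral_mono)
      have le: "\<bar>f x (u x) * w x\<bar> \<le> d * (indicator A x * \<bar>f x (u x)\<bar>)" if "x \<in> space M" for x
      proof (cases "x \<in> A")
        case True
        then show ?thesis
          using mult_right_mono[OF truncation_le[OF d, of k "u x"], of "\<bar>f x (u x)\<bar>"]
          by (simp add: w_def T_def abs_mult mult.commute)
      next
        case False
        then have "w x = 0"
          using that d truncation_eq_0(1)[of "u x" k d] by (simp add: A_eq w_def T_def)
        then show ?thesis using False by simp
      qed
      show "integrable M (\<lambda>x. d * (indicator A x * \<bar>f x (u x)\<bar>))" using fA by simp
      then show "integrable M (\<lambda>x. f x (u x) * w x)"
      proof (rule Bochner_Integration.integrable_bound)
        show "AE x in M. norm (f x (u x) * w x) \<le> norm (d * (indicator A x * \<bar>f x (u x)\<bar>))"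
          using order.trans[OF le abs_ge_self] by (intro AE_I2) (simp only: real_norm_def)
      qed (simp add: w_def)
      show "f x (u x) * w x \<le> d * (indicator A x * \<bar>f x (u x)\<bar>)" if "x \<in> space M" for x
        using le[OF that] by linarith
    qed
    also have "\<dots> = d * F" by (simp add: F_def)
    finally show ?thesis .
  qed
  have L1: "(\<integral>x. norm (weak_grad \<Omega> w x) \<partial>M) \<le> 4 * l * measure M A + l powr (1 - p) * d * F"
  proof -
    have "(\<integral>x. norm (weak_grad \<Omega> w x) \<partial>M) \<le> (\<integral>x. 4 * l * indicator A x + l powr (1 - p) * (T' (u x) * norm (G x) powr p) \<partial>M)"
    proof (rule integral_mono_AE)
      show "integrable M (\<lambda>x. norm (weak_grad \<Omega> w x))"
        using in_Lp_integrable[OF p W0_weak_gradient(3)[OF w]] by simp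
      show "integrable M (\<lambda>x. 4 * l * indicator A x + l powr (1 - p) * (T' (u x) * norm (G x) powr p))"
        using Gp by (intro Bochner_Integration.integrable_add integrable_mult_right) (auto simp: fmeasurable_def emeasure_eq_measure)
      show "AE x in M. norm (weak_grad \<Omega> w x) \<le> 4 * l * indicator A x + l powr (1 - p) * (T' (u x) * norm (G x) powr p)"
        using gw AE_space
      proof eventually_elim
        case (elim x)
        show ?case
        proof (cases "x \<in> A")
          case True
          have "norm (weak_grad \<Omega> w x) = T' (u x) * norm (G x)"
            using elim T'b by simp
          also have "\<dots> \<le> T' (u x) * (l + l powr (1 - p) * norm (G x) powr p)"
            using T'b(2) le_powr_Young[OF norm_ge_zero l p] by (rule mult_left_mono[rotated])
          also have "\<dots> \<le> 4 * l + l powr (1 - p) * (T' (u x) * norm (G x) powr p)"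
            using T'b(1)[of "u x"] l by (simp add: distrib_left mult_ac)
          finally show ?thesis using True by simp
        next
          case False
          then have "T' (u x) = 0"
            using elim d truncation_eq_0(2)[of "u x" k d] by (simp add: A_eq T'_def)
          then show ?thesis using elim False by simp
        qed
      qed
    qed
    also have "\<dots> = 4 * l * measure M A + l powr (1 - p) * (\<integral>x. T' (u x) * norm (G x) powr p \<partial>M)"
    proof -
      have "A \<inter> \<Omega> = A" by (auto simp: A_def)
      then show ?thesis
        using Gp by (subst Bochner_Integration.integral_add) (auto simp: emeasure_eq_measure spM)
    qed
    also have "\<dots> \<le> 4 * l * measure M A + l powr (1 - p) * (d * F)"
      using energy by (intro add_left_mono mult_left_mono) auto
    finally show ?thesis by (simp add: mult.assoc)
  qed
  obtain w' where w' [measurable]: "w' \<in> borel_measurable borel"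
    and ae: "AE x in lebesgue. w' x = indicator \<Omega> x * w x"
    and tr: "\<And>z. (\<integral>\<^sup>+x. ennreal \<bar>w' (x + z) - w' x\<bar> \<partial>lborel) \<le> ennreal (norm z * (\<integral>x. norm (weak_grad \<Omega> w x) \<partial>M))"
    using W0_translation[OF w] by blast
  have sub: "A \<subseteq> \<Omega>" "B \<subseteq> \<Omega>" by (auto simp: A_def B_def)
  have AL: "A \<in> sets lebesgue" "B \<in> sets lebesgue"
    using Am Bm sets_\<Omega> by (auto simp: sets_restrict_space_iff)
  have emAL: "emeasure lebesgue A = ennreal (measure M A)" "emeasure lebesgue B = ennreal (measure M B)"
    using sub sets_\<Omega> by (simp_all add: emeasure_eq_measure[symmetric] emeasure_restrict_space)
  have 1: "emeasure lborel {x. w' x \<noteq> 0} \<le> ennreal (measure M A)"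
  proof -
    have "emeasure lborel {x. w' x \<noteq> 0} = emeasure lebesgue {x. w' x \<noteq> 0}"
      by simp
    also have "\<dots> \<le> emeasure lebesgue A"
    proof (rule emeasure_mono_AE[OF _ AL(1)])
      show "AE x in lebesgue. x \<in> {x. w' x \<noteq> 0} \<longrightarrow> x \<in> A"
        using ae
      proof eventually_elim
        case (elim x)
        show ?case
          using elim truncation_eq_0(1)[of "u x" k d] d
          by (cases "\<bar>u x\<bar> \<le> k") (auto simp: A_def w_def T_def indicator_def split: if_splits)
      qed
    qed
    finally show ?thesis by (simp add: emAL)
  qed
  have 2: "ennreal (measure M B) \<le> emeasure lborel {x. d / 3 \<le> \<bar>w' x\<bar>}"
  proof -
    have "emeasure lebesgue B \<le> emeasure lebesgue {x. d / 3 \<le> \<bar>w' x\<bar>}"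
    proof (rule emeasure_mono_AE)
      show "AE x in lebesgue. x \<in> B \<longrightarrow> x \<in> {x. d / 3 \<le> \<bar>w' x\<bar>}"
        using ae
      proof eventually_elim
        case (elim x)
        show ?case
          using elim truncation_ge[of k d "u x"] k d by (auto simp: B_def w_def T_def)
      qed
      show "{x. d / 3 \<le> \<bar>w' x\<bar>} \<in> sets lebesgue" by (rule sets_completionI_sets) simp
    qed
    also have "\<dots> = emeasure lborel {x. d / 3 \<le> \<bar>w' x\<bar>}"
      by simp
    finally show ?thesis by (simp add: emAL)
  qed
  have fin: "emeasure lborel {x. w' x \<noteq> 0} \<noteq> \<infinity>" using 1 by (auto simp: top_unique)
  have mA: "measure lborel {x. w' x \<noteq> 0} \<le> measure M A"
    using 1 emeasure_eq_ennreal_measure[of lborel "{x. w' x \<noteq> 0}"] fin by simp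
  have "emeasure lborel {x. d / 3 \<le> \<bar>w' x\<bar>} \<le> emeasure lborel {x. w' x \<noteq> 0}"
    using d by (intro emeasure_mono) auto
  then have "emeasure lborel {x. d / 3 \<le> \<bar>w' x\<bar>} \<noteq> top"
    using fin by (auto simp: top_unique)
  then have mB: "measure M B \<le> measure lborel {x. d / 3 \<le> \<bar>w' x\<bar>}"
    using 2 emeasure_eq_ennreal_measure[of lborel "{x. d / 3 \<le> \<bar>w' x\<bar>}"] by simp
  have "d / 3 * measure lborel {x. d / 3 \<le> \<bar>w' x\<bar>} \<le> 2 * r * (\<integral>x. norm (weak_grad \<Omega> w x) \<partial>M)"
  proof (rule level_set_L1[OF w' tr _ r _ fin])
    show "0 \<le> (\<integral>x. norm (weak_grad \<Omega> w x) \<partial>M)" by (intro integral_nonneg_AE) simp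
    show "2 * measure lborel {x. w' x \<noteq> 0} \<le> measure lborel (ball (0::'a) r)"
      using vol mA r unfolding A_def by (simp add: content_ball)
  qed (use d in simp)
  moreover have "d / 3 * measure M B \<le> d / 3 * measure lborel {x. d / 3 \<le> \<bar>w' x\<bar>}"
    using mB d by (intro mult_left_mono) auto
  moreover have "2 * r * (\<integral>x. norm (weak_grad \<Omega> w x) \<partial>M) \<le> 2 * r * (4 * l * measure M A + l powr (1 - p) * d * F)"
    using L1 r by (intro mult_left_mono) auto
  ultimately have "d * measure M B \<le> 6 * r * (4 * l * measure M A + l powr (1 - p) * d * F)" by linarith
  then show ?thesis by (simp add: A_def B_def F_def)
qed

end

section \<open>Decay of the distribution function\<close>

text \<open>The form matters: D is fixed before \<open>a\<close> and K. Along the levels K + D (1 -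
  2^(-i)) the claim is a <= Y \<rho>^i. The shrinking increments cost 2^(\<alpha> (i + 1)), the
  superlinear power gains \<rho>^(\<sigma> i), and \<rho>^\<sigma> = 2^(-\<alpha>) balances the two;
  D makes the constant left over equal to \<rho>.\<close>

lemma stampacchia:
  fixes C \<alpha> \<sigma> Y :: real
  assumes "0 < C" "0 < \<alpha>" "0 < \<sigma>" "0 < Y"
  shows "\<exists>D>0. \<forall>(a :: real \<Rightarrow> real) K. (\<forall>t. 0 \<le> a t) \<and> antimono a \<and> a K \<le> Y
    \<and> (\<forall>k d. K \<le> k \<longrightarrow> 0 < d \<longrightarrow> a (k + d) \<le> C * d powr (- \<alpha>) * a k powr (1 + \<sigma>)) \<longrightarrow> a (K + D) = 0"
proof -
  define \<rho> where "\<rho> = (2::real) powr (- \<alpha> / \<sigma>)"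
  define D where "D = (C * 2 powr \<alpha> * Y powr \<sigma> / \<rho>) powr (1 / \<alpha>)"
  have \<rho>: "0 < \<rho>" "\<rho> < 1"
    using assms by (auto simp: \<rho>_def powr_less_one divide_neg_pos)
  have D: "0 < D" using assms \<rho> by (simp add: D_def)
  have D\<alpha>: "C * D powr (- \<alpha>) * 2 powr \<alpha> * Y powr \<sigma> = \<rho>"
    using assms \<rho> by (simp add: D_def powr_powr powr_minus divide_simps)
  have \<rho>\<sigma>: "\<rho> powr \<sigma> = 2 powr (- \<alpha>)"
    using assms by (simp add: \<rho>_def powr_powr)
  have main: "a (K + D) = 0" if a0: "\<And>t. 0 \<le> a t" and mono: "antimono a" and aK: "a K \<le> Y"
    and step: "\<And>k d. K \<le> k \<Longrightarrow> 0 < d \<Longrightarrow> a (k + d) \<le> C * d powr (- \<alpha>) * a k powr (1 + \<sigma>)"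
    for a :: "real \<Rightarrow> real" and K
  proof -
    define \<kappa> where "\<kappa> i = K + D * (1 - (1 / 2) ^ i)" for i :: nat
    have \<kappa>: "K \<le> \<kappa> i" "\<kappa> i \<le> K + D" for i
      using D by (auto simp: \<kappa>_def power_le_one intro!: mult_nonneg_nonneg mult_left_le)
    have le: "a (\<kappa> i) \<le> Y * \<rho> powr real i" for i
    proof (induction i)
      case 0
      then show ?case using aK \<rho> by (simp add: \<kappa>_def)
    next
      case (Suc i)
      define d where "d = D * 2 powr (- real i - 1)"
      have half: "(1 / 2) ^ i = (2::real) powr (- real i)"
      proof -
        have "(2::real) powr (- real i) = inverse (2 powr real i)" by (rule powr_minus)
        also have "(2::real) powr real i = 2 ^ i" by (rule powr_realpow) simp
        finally show ?thesis by (simp only: power_one_over inverse_eq_divide)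
      qed
      have d: "0 < d" using D by (simp add: d_def)
      have "\<kappa> (Suc i) = \<kappa> i + d"
        using half by (simp add: \<kappa>_def d_def powr_diff algebra_simps)
      then have "a (\<kappa> (Suc i)) \<le> C * d powr (- \<alpha>) * a (\<kappa> i) powr (1 + \<sigma>)"
        using step[OF \<kappa>(1)[of i] d] by simp
      also have "\<dots> \<le> C * d powr (- \<alpha>) * (Y * \<rho> powr real i) powr (1 + \<sigma>)"
        using Suc assms a0 by (intro mult_left_mono powr_mono2) auto
      also have "\<dots> = Y * \<rho> powr real (Suc i)"
      proof -
        have d\<alpha>: "d powr (- \<alpha>) = D powr (- \<alpha>) * 2 powr \<alpha> * (2 powr (- \<alpha>)) powr (- real i)"
          using D by (simp add: d_def powr_mult powr_powr algebra_simps flip: powr_add)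
        have Y: "(Y * \<rho> powr real i) powr (1 + \<sigma>) = Y * Y powr \<sigma> * \<rho> powr real i * (\<rho> powr \<sigma>) powr real i"
        proof -
          have "(\<rho> powr real i) powr \<sigma> = (\<rho> powr \<sigma>) powr real i"
            by (simp add: powr_powr mult.commute)
          then show ?thesis
            using assms \<rho> by (simp add: powr_mult powr_add)
        qed
        have one: "(2 powr (- \<alpha>)) powr (- real i) * ((2::real) powr (- \<alpha>)) powr real i = 1"
          by (simp flip: powr_add)
        have "C * d powr (- \<alpha>) * (Y * \<rho> powr real i) powr (1 + \<sigma>)
            = (C * D powr (- \<alpha>) * 2 powr \<alpha> * Y powr \<sigma>) * Y * \<rho> powr real i
              * ((2 powr (- \<alpha>)) powr (- real i) * (2 powr (- \<alpha>)) powr real i)"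
          by (simp only: d\<alpha> Y \<rho>\<sigma> mult_ac)
        also have "\<dots> = \<rho> * Y * \<rho> powr real i * 1"
          by (simp only: D\<alpha> one)
        also have "\<dots> = Y * \<rho> powr real (Suc i)"
          using \<rho> by (simp add: powr_add)
        finally show ?thesis .
      qed
      finally show ?case .
    qed
    have "(\<lambda>i. Y * \<rho> powr real i) \<longlonglongrightarrow> Y * 0"
      using \<rho> by (intro tendsto_intros) (simp add: powr_realpow LIMSEQ_realpow_zero)
    moreover have "a (K + D) \<le> Y * \<rho> powr real i" for i
      using le[of i] antimonoD[OF mono \<kappa>(2)[of i]] by linarith
    ultimately have "a (K + D) \<le> Y * 0"
      by (intro LIMSEQ_le_const) auto
    then show ?thesis using a0[of "K + D"] by simp
  qed
  show ?thesis
    using D main by (intro exI[of _ D]) blast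
qed

lemma suminf_ennreal_geometric_le:
  fixes g :: "nat \<Rightarrow> real"
  assumes "\<And>j. 0 \<le> g j" "\<And>j. g j \<le> c * (2 ^ j * k) powr (- 1)" "0 < k" "0 \<le> c"
  shows "(\<Sum>j. ennreal (g j)) \<le> ennreal (2 * c / k)"
proof -
  have g: "g j \<le> (c / k) * (1 / 2) ^ j" for j
    using assms(2)[of j] assms(3) by (simp add: powr_minus power_one_over divide_simps mult.commute)
  have s: "(\<lambda>j. (c / k) * (1 / 2) ^ j) sums ((c / k) * (1 / (1 - 1 / 2)))"
    by (intro sums_mult geometric_sums) simp
  have "(\<Sum>j. ennreal (g j)) \<le> (\<Sum>j. ennreal ((c / k) * (1 / 2) ^ j))"
    using g by (intro suminf_le ennreal_leI) auto
  also have "\<dots> = ennreal (\<Sum>j. (c / k) * (1 / 2) ^ j)"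
    using s assms by (intro suminf_ennreal2) (auto simp: sums_iff)
  also have "(\<Sum>j. (c / k) * (1 / 2) ^ j) = 2 * c / k"
    using s by (simp add: sums_iff)
  finally show ?thesis .
qed

text \<open>\<open>a\<close> plays the role of the distribution function \<open>t \<mapsto> |{|u| > t}|\<close> of a solution, and \<open>F k\<close> that of the
  integral of \<open>|f(x,u)|\<close> over \<open>{|u| > k}\<close>.\<close>
definition level_bounds ::
    "real \<Rightarrow> real \<Rightarrow> real \<Rightarrow> real \<Rightarrow> real \<Rightarrow> real \<Rightarrow> real \<Rightarrow> (real \<Rightarrow> real) \<Rightarrow> (real \<Rightarrow> real) \<Rightarrow> (real \<Rightarrow> real) \<Rightarrow> bool" where
  "level_bounds N p \<mu> C1 C2 B Y s a F \<longleftrightarrow>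
     (\<forall>t. 0 \<le> a t) \<and> antimono a \<and> (\<forall>t. a t \<le> Y)
     \<and> (\<forall>t>0. t powr critical_exponent N p * a t \<le> B)
     \<and> (\<forall>k d F'. 0 < k \<longrightarrow> 0 < d \<longrightarrow> 0 < F' \<longrightarrow> F k \<le> F' \<longrightarrow>
           d * a (k + d) \<le> C1 * a k powr (1 / N + 1 - 1 / p) * (d * F') powr (1 / p))
     \<and> (\<forall>\<epsilon> k. 0 < \<epsilon> \<longrightarrow> s \<epsilon> \<le> k \<longrightarrow> 0 < k \<longrightarrow>
           ennreal (F k) \<le> (\<Sum>j. ennreal (\<epsilon> * C2 * (2 * (2 ^ j * k)) powr (hardy_sobolev_exponent N p \<mu> - 1)
             * a (2 ^ j * k) powr (1 - \<mu> / N))))"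

text \<open>K depends on the constants and on the threshold function \<open>s\<close> only, and is
  chosen before \<open>a\<close> and F. The critical recursion alone would reproduce the bound on
  t^P a(t); the smallness of \<open>\<epsilon>\<close> makes it contract, and the power decay gained
  in this way turns the recursion into a superlinear one.\<close>

lemma level_bounds_vanish:
  fixes N p \<mu> C1 C2 B Y :: real and s :: "real \<Rightarrow> real"
  assumes p: "1 < p" "p < N" and \<mu>: "0 < \<mu>" "\<mu> < p"
    and C: "0 < C1" "0 < C2" "0 < B" "0 < Y"
  shows "\<exists>K>0. \<forall>a F. level_bounds N p \<mu> C1 C2 B Y s a F \<longrightarrow> a K = 0"
proof -
  define P where "P = critical_exponent N p"
  define m where "m = hardy_sobolev_exponent N p \<mu> - 1"
  have P: "P = N * p / (N - p)" by (simp add: P_def critical_exponent_def)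
  have m: "m = p * (N - \<mu>) / (N - p) - 1" by (simp add: m_def hardy_sobolev_exponent_def)
  define \<kappa> where "\<kappa> = 1 - \<mu> / N"
  define \<tau> where "\<tau> = 1 / N + 1 - 1 / p"
  define \<theta> where "\<theta> = (p - \<mu>) / (N * p)"
  \<comment> \<open>Equal to p \<theta> / 2. The factor a^\<eta> is given up for the convergence of
    the dyadic sum; half of the gain \<theta> survives.\<close>
  define \<eta> where "\<eta> = (p - \<mu>) / (2 * N)"
  have N: "0 < N" using p by linarith
  have Np: "0 < N - p" using p by linarith
  \<comment> \<open>The first two identities express the critical scaling and make all powers of the
    level cancel. The other two are the resulting powers of the bound S and of \<open>a k\<close>;
    both exceed 1 because \<open>\<mu> < p\<close>.\<close>
  have e1: "P * \<kappa> = m + 1" using N Np by (simp add: P m \<kappa>_def field_simps)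
  have e2: "P * \<tau> = P - 1" using N Np p by (simp add: P \<tau>_def field_simps)
  have e3: "\<tau> + \<kappa> / p = 1 + \<theta>" using N p by (simp add: \<tau>_def \<kappa>_def \<theta>_def field_simps)
  have e4: "\<tau> + (\<kappa> - \<eta>) / p = 1 + \<theta> / 2" using N p by (simp add: \<tau>_def \<kappa>_def \<eta>_def \<theta>_def field_simps)
  have "\<kappa> - \<eta> = (2 * N - \<mu> - p) / (2 * N)" using N by (simp add: \<kappa>_def \<eta>_def field_simps)
  then have "0 < \<kappa> - \<eta>" using N p \<mu> by simp
  moreover have "0 < 1 - 1 / p" "0 < 1 / N" using p N by simp_all
  then have "0 < \<tau>" unfolding \<tau>_def by linarith
  moreover have "0 < P" "0 < \<kappa>" "0 < \<theta>" "0 < \<eta>"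
    using N Np p \<mu> by (simp_all add: P \<kappa>_def \<theta>_def \<eta>_def)
  ultimately have pos: "0 < P" "0 < \<kappa>" "0 < \<tau>" "0 < \<theta>" "0 < \<eta>" "0 < \<kappa> - \<eta>"
    by blast+
  have m0: "0 < m"
  proof -
    have "1 * (N - \<mu>) < p * (N - \<mu>)" using p \<mu> by (intro mult_strict_right_mono) linarith+
    then have "N - p < p * (N - \<mu>)" using \<mu> by (simp only: mult_1)
    then have "1 < p * (N - \<mu>) / (N - p)" using Np by (simp only: pos_less_divide_eq mult_1)
    then show ?thesis by (simp add: m)
  qed
  \<comment> \<open>With decay t^(-q) the factor a^\<eta> contributes t^(-(m + 1)), which beats the
    growth t^m and leaves 1/t, summable along dyadic levels. Contraction by \<delta> = 2^(-q) at
    each doubling is exactly this decay.\<close>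
  define q where "q = (m + 1) / \<eta>"
  define \<delta> where "\<delta> = (2::real) powr (- q)"
  define C4 where "C4 = 2 powr P * (C1 * (C2 * 2 powr m * 2) powr (1 / p))"
  \<comment> \<open>Solves C4 \<epsilon>^(1/p) B^\<theta> = \<delta>, the contraction factor
    required in \<open>improve\<close>.\<close>
  define \<epsilon> where "\<epsilon> = (\<delta> / (C4 * B powr \<theta>)) powr p"
  \<comment> \<open>Above K the source bound holds with \<open>\<epsilon>\<close>, as the
    contraction needs, and with 1, as the final recursion needs. K >= 1 allows harmless powers of
    the level to be dropped.\<close>
  define K where "K = max 1 (max (s \<epsilon>) (s 1))"
  define B' where "B' = B * (2 * K) powr q"
  define C5 where "C5 = 2 * (C2 * 2 powr m * B' powr \<eta>)"
  define C6 where "C6 = C1 * C5 powr (1 / p)"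
  have q: "0 < q" "q * \<eta> = m + 1" using m0 pos by (auto simp: q_def)
  have \<delta>: "0 < \<delta>" by (simp add: \<delta>_def)
  have C4: "0 < C4" using C by (simp add: C4_def)
  have \<epsilon>: "0 < \<epsilon>" using C C4 \<delta> by (simp add: \<epsilon>_def)
  have K: "1 \<le> K" "s \<epsilon> \<le> K" "s 1 \<le> K" by (auto simp: K_def)
  have B': "0 < B'" using C K by (simp add: B'_def)
  have C5: "0 < C5" using C B' by (simp add: C5_def)
  have C6: "0 < C6" using C C5 by (simp add: C6_def)
  have \<epsilon>\<delta>: "C4 * \<epsilon> powr (1 / p) * B powr \<theta> = \<delta>"
    using C C4 \<delta> p by (simp add: \<epsilon>_def powr_powr)
  obtain D where D: "0 < D" and stamp: "\<And>(a :: real \<Rightarrow> real) K. (\<And>t. 0 \<le> a t) \<Longrightarrow> antimono a \<Longrightarrow> a K \<le> Y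
    \<Longrightarrow> (\<And>k d. K \<le> k \<Longrightarrow> 0 < d \<Longrightarrow> a (k + d) \<le> C6 * d powr (- (1 - 1 / p)) * a k powr (1 + \<theta> / 2)) \<Longrightarrow> a (K + D) = 0"
    using stampacchia[of C6 "1 - 1 / p" "\<theta> / 2" Y] C6 C p pos by auto
  have main: "a (K + D) = 0"
    if a0: "\<And>t. 0 \<le> a t" and mono: "antimono a" and aY: "\<And>t. a t \<le> Y"
      and aB: "\<And>t. 0 < t \<Longrightarrow> t powr P * a t \<le> B"
      and lev: "\<And>k d F'. 0 < k \<Longrightarrow> 0 < d \<Longrightarrow> 0 < F' \<Longrightarrow> F k \<le> F' \<Longrightarrow>
           d * a (k + d) \<le> C1 * a k powr \<tau> * (d * F') powr (1 / p)"
      and src: "\<And>e k. 0 < e \<Longrightarrow> s e \<le> k \<Longrightarrow> 0 < k \<Longrightarrow>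
           ennreal (F k) \<le> (\<Sum>j. ennreal (e * C2 * (2 * (2 ^ j * k)) powr m * a (2 ^ j * k) powr \<kappa>))"
    for a F :: "real \<Rightarrow> real"
  proof -
    \<comment> \<open>\<open>b\<close> collects what does not depend on j: if the j-th term is at
      most a multiple of the reciprocal of its level, the series is geometric with ratio
      1/2.\<close>
    have Fle: "F k \<le> 2 * (e * C2 * 2 powr m * b) / k"
      if "0 < e" "s e \<le> k" "0 < k" "0 \<le> b"
        and h: "\<And>j. (2 ^ j * k) powr m * a (2 ^ j * k) powr \<kappa> \<le> b * (2 ^ j * k) powr (- 1)" for e k b
    proof -
      have "(\<Sum>j. ennreal (e * C2 * (2 * (2 ^ j * k)) powr m * a (2 ^ j * k) powr \<kappa>)) \<le> ennreal (2 * (e * C2 * 2 powr m * b) / k)"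
      proof (rule suminf_ennreal_geometric_le)
        fix j
        have "e * C2 * (2 * (2 ^ j * k)) powr m * a (2 ^ j * k) powr \<kappa>
            = e * C2 * 2 powr m * ((2 ^ j * k) powr m * a (2 ^ j * k) powr \<kappa>)"
          using that by (subst powr_mult) auto
        also have "\<dots> \<le> e * C2 * 2 powr m * (b * (2 ^ j * k) powr (- 1))"
          using that C by (intro mult_left_mono h) auto
        finally show "e * C2 * (2 * (2 ^ j * k)) powr m * a (2 ^ j * k) powr \<kappa> \<le> e * C2 * 2 powr m * b * (2 ^ j * k) powr (- 1)"
          by (simp add: mult.assoc)
      qed (use that C in auto)
      then have "ennreal (F k) \<le> ennreal (2 * (e * C2 * 2 powr m * b) / k)"
        using src[of e k] that by (meson order_trans)
      then show ?thesis
        by (subst (asm) ennreal_le_iff) (use that C in auto)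
    qed
    \<comment> \<open>Taking h = t / 2 both as level and as increment leaves S^(1 + \<theta>) on the
      right. Since S <= B, the excess S^\<theta> is at most B^\<theta>, so one and the same
      \<open>\<epsilon>\<close> serves every round of the iteration.\<close>
    have improve: "\<forall>t\<ge>2 * k. t powr P * a t \<le> \<delta> * S"
      if S: "0 < S" "S \<le> B" and k: "K \<le> k" and h: "\<forall>t\<ge>k. t powr P * a t \<le> S" for S k
    proof (intro allI impI)
      fix t assume t: "2 * k \<le> t"
      define h where "h = t / 2"
      have hk: "K \<le> h" "k \<le> h" "1 \<le> h" "0 < h" using t k K by (auto simp: h_def)
      have ale: "a r \<le> S * r powr (- P)" if "h \<le> r" for r
      proof -
        have "0 < r powr P" using hk that by simp
        moreover have "r powr P * a r \<le> S" using \<open>\<forall>t\<ge>k. t powr P * a t \<le> S\<close> hk that by auto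
        ultimately show ?thesis by (simp add: powr_minus divide_simps mult.commute)
      qed
      define F' where "F' = 2 * (\<epsilon> * C2 * 2 powr m * S powr \<kappa>) / h"
      have F'0: "0 < F'" using \<epsilon> C S hk by (simp add: F'_def)
      have "F h \<le> F'"
        unfolding F'_def
      proof (rule Fle)
        fix j :: nat
        have hj: "h \<le> 2 ^ j * h" "0 < 2 ^ j * h" using hk by auto
        have "a (2 ^ j * h) powr \<kappa> \<le> (S * (2 ^ j * h) powr (- P)) powr \<kappa>"
          using pos a0 by (intro powr_mono2 ale hj) auto
        also have "\<dots> = S powr \<kappa> * (2 ^ j * h) powr (- (m + 1))"
          using S hj by (simp add: powr_mult powr_powr e1)
        finally have "(2 ^ j * h) powr m * a (2 ^ j * h) powr \<kappa> \<le> (2 ^ j * h) powr m * (S powr \<kappa> * (2 ^ j * h) powr (- (m + 1)))"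
          by (rule mult_left_mono) simp
        also have "\<dots> = S powr \<kappa> * ((2 ^ j * h) powr m * (2 ^ j * h) powr (- (m + 1)))"
          by (simp add: mult_ac)
        also have "(2 ^ j * h) powr m * (2 ^ j * h) powr (- (m + 1)) = (2 ^ j * h) powr (- 1)"
          by (simp flip: powr_add)
        finally show "(2 ^ j * h) powr m * a (2 ^ j * h) powr \<kappa> \<le> S powr \<kappa> * (2 ^ j * h) powr (- 1)" .
      qed (use \<epsilon> K hk in auto)
      from lev[OF hk(4) hk(4) F'0 this]
      have "h * a t \<le> C1 * a h powr \<tau> * (h * F') powr (1 / p)" by (simp add: h_def)
      also have "\<dots> \<le> C1 * (S * h powr (- P)) powr \<tau> * (h * F') powr (1 / p)"
        using C pos a0 ale[of h] by (intro mult_right_mono mult_left_mono powr_mono2) auto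
      also have "(S * h powr (- P)) powr \<tau> = S powr \<tau> * h powr (1 - P)"
        using S hk e2 by (simp add: powr_mult powr_powr)
      also have "h * F' = (C2 * 2 powr m * 2) * \<epsilon> * S powr \<kappa>"
        using hk by (simp add: F'_def)
      also have "\<dots> powr (1 / p) = (C2 * 2 powr m * 2) powr (1 / p) * \<epsilon> powr (1 / p) * S powr (\<kappa> / p)"
        using C \<epsilon> S by (simp add: powr_mult powr_powr)
      finally have "h * a t \<le> C1 * (S powr \<tau> * h powr (1 - P)) * ((C2 * 2 powr m * 2) powr (1 / p) * \<epsilon> powr (1 / p) * S powr (\<kappa> / p))" .
      then have "h powr (P - 1) * (h * a t) \<le> h powr (P - 1) * (C1 * (S powr \<tau> * h powr (1 - P)) * ((C2 * 2 powr m * 2) powr (1 / p) * \<epsilon> powr (1 / p) * S powr (\<kappa> / p)))"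
        by (rule mult_left_mono) simp
      also have "\<dots> = (h powr (P - 1) * h powr (1 - P)) * (C1 * (C2 * 2 powr m * 2) powr (1 / p)) * \<epsilon> powr (1 / p) * (S powr \<tau> * S powr (\<kappa> / p))"
        by (simp add: mult_ac)
      also have "h powr (P - 1) * h powr (1 - P) = 1"
        using hk by (simp flip: powr_add)
      also have "S powr \<tau> * S powr (\<kappa> / p) = S * S powr \<theta>"
        using S by (simp add: e3 powr_add flip: powr_add[of S \<tau>]) 
      finally have "h powr (P - 1) * (h * a t) \<le> 1 * (C1 * (C2 * 2 powr m * 2) powr (1 / p)) * \<epsilon> powr (1 / p) * (S * S powr \<theta>)" .
      moreover have "h powr (P - 1) * (h * a t) = h powr P * a t"
        using hk by (simp add: powr_diff)
      ultimately have 1: "h powr P * a t \<le> (C1 * (C2 * 2 powr m * 2) powr (1 / p)) * \<epsilon> powr (1 / p) * (S * S powr \<theta>)" by simp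
      have "t powr P * a t = 2 powr P * (h powr P * a t)"
        using hk powr_mult[of 2 h P] by (simp add: h_def)
      also have "\<dots> \<le> 2 powr P * ((C1 * (C2 * 2 powr m * 2) powr (1 / p)) * \<epsilon> powr (1 / p) * (S * S powr \<theta>))"
        using 1 by (rule mult_left_mono) simp
      also have "\<dots> = C4 * \<epsilon> powr (1 / p) * S powr \<theta> * S"
        by (simp add: C4_def mult_ac)
      also have "\<dots> \<le> C4 * \<epsilon> powr (1 / p) * B powr \<theta> * S"
        using C4 S pos by (intro mult_right_mono mult_left_mono powr_mono2) auto
      also have "\<dots> = \<delta> * S" by (simp only: \<epsilon>\<delta>)
      finally show "t powr P * a t \<le> \<delta> * S" .
    qed
    have iter: "\<forall>t\<ge>2 ^ i * K. t powr P * a t \<le> \<delta> ^ i * B" for i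
    proof (induction i)
      case 0
      then show ?case using aB K by auto
    next
      case (Suc i)
      have "\<delta> \<le> 1" using q powr_mono[of "- q" 0 "2::real"] by (simp add: \<delta>_def)
      then have "\<delta> ^ i * B \<le> B" "0 < \<delta> ^ i * B"
        using \<delta> C by (auto simp: power_le_one mult_left_le_one_le)
      moreover have "K \<le> 2 ^ i * K" using K by simp
      ultimately show ?case
        using improve[OF _ _ _ Suc] by (simp add: mult.assoc)
    qed
    \<comment> \<open>The index i with 2^i K <= t < 2^(i + 1) K counts the doublings available
      before t. The upper inequality turns \<delta>^i = (2^i)^(-q) into a power of t; the factor
      t^P, which is at least 1, is discarded.\<close>
    have decay: "a t \<le> B' * t powr (- q)" if t: "K \<le> t" for t
    proof -
      have "\<exists>i. t < 2 ^ Suc i * K"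
      proof -
        obtain i where "t / K < 2 ^ i" using real_arch_pow[of 2 "t / K"] by auto
        then have "t < 2 ^ i * K" using K by (simp add: divide_simps)
        also have "\<dots> \<le> 2 ^ Suc i * K" using K by simp
        finally show ?thesis by blast
      qed
      define i where "i = (LEAST i. t < 2 ^ Suc i * K)"
      have i1: "t < 2 ^ Suc i * K"
        unfolding i_def by (rule LeastI_ex) fact
      have i2: "2 ^ i * K \<le> t"
      proof (cases i)
        case 0
        then show ?thesis using t by simp
      next
        case (Suc j)
        then have "\<not> t < 2 ^ Suc j * K"
          using not_less_Least[of j "\<lambda>i. t < 2 ^ Suc i * K"] by (simp add: i_def)
        then show ?thesis by (simp add: Suc)
      qed
      have t1: "1 \<le> t" using t K by linarith
      have "1 \<le> t powr P" using t1 pos by (intro ge_one_powr_ge_zero) auto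
      from mult_right_mono[OF this a0[of t]] have "a t \<le> t powr P * a t" by simp
      also have "\<dots> \<le> \<delta> ^ i * B" using iter i2 by blast
      also have "\<delta> ^ i = (2 ^ i) powr (- q)"
      proof -
        have "\<delta> ^ i = \<delta> powr real i" using \<delta> by (rule powr_realpow[symmetric])
        also have "\<dots> = (2 powr real i) powr (- q)" by (simp only: \<delta>_def powr_powr mult.commute)
        also have "2 powr real i = (2::real) ^ i" by (rule powr_realpow) simp
        finally show ?thesis .
      qed
      also have "(2 ^ i) powr (- q) * B \<le> (t / (2 * K)) powr (- q) * B"
      proof (intro mult_right_mono powr_mono2')
        show "t / (2 * K) \<le> 2 ^ i" using i1 K by (simp add: divide_simps)
      qed (use t1 K q C in auto)
      also have "(t / (2 * K)) powr (- q) * B = B' * t powr (- q)"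
        using t1 K by (simp add: B'_def powr_divide powr_minus divide_simps)
      finally show ?thesis .
    qed
    \<comment> \<open>The case a k = 0 is separate because \<open>lev\<close> asks for a positive
      bound F' on the source, and the one used is a multiple of a power of
      \<open>a k\<close>.\<close>
    have final: "a (k + d) \<le> C6 * d powr (- (1 - 1 / p)) * a k powr (1 + \<theta> / 2)" if k: "K \<le> k" and d: "0 < d" for k d
    proof (cases "a k = 0")
      case True
      then have "a (k + d) \<le> 0" using antimonoD[OF mono, of k "k + d"] d by simp
      then show ?thesis using True by simp
    next
      case False
      then have ak: "0 < a k" using a0[of k] by simp
      have k1: "1 \<le> k" using k K by linarith
      define F' where "F' = C5 * a k powr (\<kappa> - \<eta>)"
      have F'0: "0 < F'" using C5 ak by (simp add: F'_def)
      have "F k \<le> 2 * (1 * C2 * 2 powr m * (B' powr \<eta> * a k powr (\<kappa> - \<eta>))) / k"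
      proof (rule Fle)
        fix j :: nat
        have kj: "k \<le> 2 ^ j * k" "0 < 2 ^ j * k" using k1 by auto
        \<comment> \<open>The first factor is bounded by its value at k through monotonicity and
          supplies the superlinear power; the second is spent on summability through
          \<open>decay\<close>.\<close>
        have "a (2 ^ j * k) powr \<kappa> = a (2 ^ j * k) powr (\<kappa> - \<eta>) * a (2 ^ j * k) powr \<eta>"
          by (simp flip: powr_add)
        also have "\<dots> \<le> a k powr (\<kappa> - \<eta>) * (B' * (2 ^ j * k) powr (- q)) powr \<eta>"
          using pos a0 kj k antimonoD[OF mono kj(1)] by (intro mult_mono powr_mono2 decay) auto
        also have "(B' * (2 ^ j * k) powr (- q)) powr \<eta> = B' powr \<eta> * (2 ^ j * k) powr (- (m + 1))"
          using B' kj q by (simp add: powr_mult powr_powr)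
        finally have "(2 ^ j * k) powr m * a (2 ^ j * k) powr \<kappa>
            \<le> (2 ^ j * k) powr m * (a k powr (\<kappa> - \<eta>) * (B' powr \<eta> * (2 ^ j * k) powr (- (m + 1))))"
          by (rule mult_left_mono) simp
        also have "\<dots> = B' powr \<eta> * a k powr (\<kappa> - \<eta>) * ((2 ^ j * k) powr m * (2 ^ j * k) powr (- (m + 1)))"
          by (simp add: mult_ac)
        also have "(2 ^ j * k) powr m * (2 ^ j * k) powr (- (m + 1)) = (2 ^ j * k) powr (- 1)"
          by (simp flip: powr_add)
        finally show "(2 ^ j * k) powr m * a (2 ^ j * k) powr \<kappa> \<le> B' powr \<eta> * a k powr (\<kappa> - \<eta>) * (2 ^ j * k) powr (- 1)" .
      qed (use K k k1 in auto)
      also have "\<dots> = F' / k" by (simp add: F'_def C5_def mult_ac)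
      also have "\<dots> \<le> F'" using F'0 k1 by (simp add: divide_le_eq mult_le_cancel_left1)
      finally have "F k \<le> F'" .
      from lev[OF _ d F'0 this] k1
      have "d * a (k + d) \<le> C1 * a k powr \<tau> * (d * F') powr (1 / p)" by simp
      also have "(d * F') powr (1 / p) = d powr (1 / p) * C5 powr (1 / p) * a k powr ((\<kappa> - \<eta>) / p)"
        using d C5 ak by (simp add: F'_def powr_mult powr_powr)
      also have "C1 * a k powr \<tau> * (d powr (1 / p) * C5 powr (1 / p) * a k powr ((\<kappa> - \<eta>) / p))
          = C6 * d powr (1 / p) * (a k powr \<tau> * a k powr ((\<kappa> - \<eta>) / p))"
        by (simp add: C6_def mult_ac)
      also have "a k powr \<tau> * a k powr ((\<kappa> - \<eta>) / p) = a k powr (1 + \<theta> / 2)"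
        by (simp only: e4 flip: powr_add)
      finally have "a (k + d) \<le> C6 * (d powr (1 / p) / d) * a k powr (1 + \<theta> / 2)"
        using d by (simp add: divide_simps mult_ac)
      also have "d powr (1 / p) / d = d powr (- (1 - 1 / p))"
        using d by (simp add: powr_diff)
      finally show ?thesis .
    qed
    show ?thesis
      by (rule stamp[OF a0 mono aY final])
  qed
  show ?thesis
  proof (intro exI[of _ "K + D"] conjI allI impI)
    show "0 < K + D" using K D by linarith
    fix a F
    assume "level_bounds N p \<mu> C1 C2 B Y s a F"
    then show "a (K + D) = 0"
      by (intro main[of a F]) (auto simp: level_bounds_def P_def m_def \<kappa>_def \<tau>_def)
  qed
qed

section \<open>The singular weight\<close>

text \<open>Strictness on the left puts y above the level 2^j k, matching level sets defined by a
  strict inequality.\<close>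

lemma dyadic_scale:
  fixes k y :: real
  assumes "0 < k" "k < y"
  obtains j :: nat where "2 ^ j * k < y" "y \<le> 2 * (2 ^ j * k)"
proof -
  define j where "j = (LEAST j. y \<le> 2 * (2 ^ j * k))"
  have ex: "\<exists>j. y \<le> 2 * (2 ^ j * k)"
  proof -
    obtain i where "y / k < 2 ^ i" using real_arch_pow[of 2 "y / k"] by auto
    then have "y < 2 ^ i * k" using assms by (simp add: divide_simps)
    also have "\<dots> \<le> 2 * (2 ^ i * k)" using assms by simp
    finally show ?thesis by (intro exI[of _ i]) simp
  qed
  have 1: "y \<le> 2 * (2 ^ j * k)"
    unfolding j_def by (rule LeastI_ex[OF ex])
  have 2: "2 ^ j * k < y"
  proof (cases j)
    case 0
    then show ?thesis using assms by simp
  next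
    case (Suc i)
    then have "\<not> y \<le> 2 * (2 ^ i * k)"
      using not_less_Least[of i "\<lambda>j. y \<le> 2 * (2 ^ j * k)"] by (simp add: j_def)
    then show ?thesis by (simp add: Suc)
  qed
  show ?thesis using that[OF 2 1] .
qed

lemma single_le_suminf_ennreal: "f j \<le> (\<Sum>j. f j :: ennreal)"
  using sum_le_suminf[of f "{j}"] by (simp add: summableI)

text \<open>On the shell R / 2^(j + 1) <= |x| < R / 2^j the weight is at most \<open>w j\<close>.
  Enlarging the shell to the whole ball of radius R / 2^j costs only a constant, and the products of
  weight and volume form a geometric series with ratio 2^(\<mu> - N) < 1.\<close>

lemma nn_integral_weight_ball:
  fixes \<mu> :: real
  assumes \<mu>: "0 < \<mu>" "\<mu> < real DIM('a::euclidean_space)"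
  shows "\<exists>C>0. \<forall>R>0. (\<integral>\<^sup>+x. indicator (ball (0::'a) R) x * ennreal (norm x powr (- \<mu>)) \<partial>lborel)
    \<le> ennreal (C * R powr (real DIM('a) - \<mu>))"
proof -
  define N where "N = real DIM('a)"
  define v where "v = unit_ball_vol N"
  define q where "q = (2::real) powr (\<mu> - N)"
  have v: "0 < v" by (simp add: v_def N_def)
  have q: "0 < q" "q < 1" using \<mu> powr_less_mono[of "\<mu> - N" 0 "2::real"] by (auto simp: q_def N_def)
  define C where "C = v * 2 powr \<mu> / (1 - q)"
  have C: "0 < C" using v q by (simp add: C_def)
  have "(\<integral>\<^sup>+x. indicator (ball (0::'a) R) x * ennreal (norm x powr (- \<mu>)) \<partial>lborel) \<le> ennreal (C * R powr (N - \<mu>))"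
    if R: "0 < R" for R
  proof -
    define w where "w j = (R / (2 * 2 ^ j)) powr (- \<mu>)" for j :: nat
    have "(\<integral>\<^sup>+x. indicator (ball (0::'a) R) x * ennreal (norm x powr (- \<mu>)) \<partial>lborel)
        \<le> (\<integral>\<^sup>+x. (\<Sum>j. ennreal (w j) * indicator (ball (0::'a) (R / 2 ^ j)) x) \<partial>lborel)"
    proof (rule nn_integral_mono)
      fix x :: 'a
      show "indicator (ball 0 R) x * ennreal (norm x powr (- \<mu>)) \<le> (\<Sum>j. ennreal (w j) * indicator (ball 0 (R / 2 ^ j)) x)"
      \<comment> \<open>At the origin the weight is \<open>0 powr (- \<mu>)\<close>, which is 0, so
        the left-hand side vanishes there.\<close>
      proof (cases "x \<noteq> 0 \<and> norm x < R")
        case True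
        then have "1 < R / norm x" by simp
        then obtain j where j: "2 ^ j * 1 < R / norm x" "R / norm x \<le> 2 * (2 ^ j * 1)"
          using dyadic_scale[of 1 "R / norm x"] by auto
        have "norm x < R / 2 ^ j" using j(1) True by (simp add: field_simps)
        moreover have "R / (2 * 2 ^ j) \<le> norm x" using j(2) True by (simp add: field_simps)
        then have "norm x powr (- \<mu>) \<le> w j"
          unfolding w_def using R \<mu> by (intro powr_mono2') auto
        ultimately have "indicator (ball 0 R) x * ennreal (norm x powr (- \<mu>)) \<le> ennreal (w j) * indicator (ball 0 (R / 2 ^ j)) x"
          using True by (simp add: ennreal_leI)
        also have "\<dots> \<le> (\<Sum>j. ennreal (w j) * indicator (ball 0 (R / 2 ^ j)) x)"
          by (rule single_le_suminf_ennreal)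
        finally show ?thesis .
      qed (auto simp: indicator_def)
    qed
    also have "\<dots> = (\<Sum>j. \<integral>\<^sup>+x. ennreal (w j) * indicator (ball (0::'a) (R / 2 ^ j)) x \<partial>lborel)"
      by (intro nn_integral_suminf borel_measurable_times_ennreal borel_measurable_const borel_measurable_indicator) simp
    also have "\<dots> = (\<Sum>j. ennreal (v * 2 powr \<mu> * R powr (N - \<mu>) * q ^ j))"
    proof (rule suminf_cong)
      fix j :: nat
      have two: "2 ^ j = (2::real) powr real j" by (rule powr_realpow[symmetric]) simp
      have "(\<integral>\<^sup>+x. ennreal (w j) * indicator (ball (0::'a) (R / 2 ^ j)) x \<partial>lborel) = ennreal (w j) * emeasure lborel (ball (0::'a) (R / 2 ^ j))"
        by (rule nn_integral_cmult_indicator) simp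
      also have "\<dots> = ennreal (w j * (v * (R / 2 ^ j) ^ DIM('a)))"
        using R by (subst emeasure_ball) (auto simp: v_def N_def w_def ennreal_mult)
      also have "w j * (v * (R / 2 ^ j) ^ DIM('a)) = v * 2 powr \<mu> * R powr (N - \<mu>) * q ^ j"
      proof -
        have "(R / 2 ^ j) ^ DIM('a) = (R / 2 ^ j) powr N"
          unfolding N_def using R by (intro powr_realpow[symmetric]) simp
        also have "\<dots> = R powr N * 2 powr (- (real j * N))"
          using R by (simp only: two powr_divide powr_powr) (simp add: powr_minus divide_inverse)
        finally have 1: "(R / 2 ^ j) ^ DIM('a) = R powr N * 2 powr (- (real j * N))" .
        have "2 * 2 ^ j = (2::real) powr (1 + real j)" by (simp only: two powr_add) simp
        then have 2: "w j = R powr (- \<mu>) * 2 powr ((1 + real j) * \<mu>)"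
          using R by (simp only: w_def powr_divide powr_powr) (simp add: powr_minus divide_inverse)
        have "q ^ j = q powr real j" using q by (intro powr_realpow[symmetric])
        then have 3: "q ^ j = 2 powr ((\<mu> - N) * real j)" by (simp only: q_def powr_powr)
        have "w j * (v * (R / 2 ^ j) ^ DIM('a)) = v * (R powr (- \<mu>) * R powr N) * (2 powr ((1 + real j) * \<mu>) * 2 powr (- (real j * N)))"
          unfolding 1 2 by (simp only: mult_ac)
        also have "\<dots> = v * R powr (N - \<mu>) * (2 powr \<mu> * 2 powr ((\<mu> - N) * real j))"
          by (simp add: algebra_simps flip: powr_add)
        finally show ?thesis unfolding 3 by (simp only: mult_ac)
      qed
      finally show "(\<integral>\<^sup>+x. ennreal (w j) * indicator (ball (0::'a) (R / 2 ^ j)) x \<partial>lborel) = ennreal (v * 2 powr \<mu> * R powr (N - \<mu>) * q ^ j)" .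
    qed
    also have "\<dots> = ennreal (\<Sum>j. v * 2 powr \<mu> * R powr (N - \<mu>) * q ^ j)"
      using v q by (intro suminf_ennreal2) (auto intro!: summable_mult summable_geometric)
    also have "(\<Sum>j. v * 2 powr \<mu> * R powr (N - \<mu>) * q ^ j) = C * R powr (N - \<mu>)"
      using q by (subst suminf_mult) (auto intro!: summable_geometric simp: suminf_geometric C_def)
    finally show ?thesis .
  qed
  then show ?thesis using C unfolding N_def by blast
qed

text \<open>With R = |A|^(1/N), the ball of radius R takes care of the singularity, and on the rest
  of A the weight is at most R^(-\<mu>). Both parts scale like |A|^(1 - \<mu>/N), whence the
  constant C + 1. A null set A would give R = 0 and is treated apart.\<close>

lemma nn_integral_weight:
  fixes \<mu> :: real
  assumes \<mu>: "0 < \<mu>" "\<mu> < real DIM('a::euclidean_space)"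
  shows "\<exists>C>0. \<forall>A \<in> sets lebesgue. emeasure lebesgue A \<noteq> \<infinity> \<longrightarrow>
    (\<integral>\<^sup>+x. indicator A x * ennreal (norm (x::'a) powr (- \<mu>)) \<partial>lebesgue)
    \<le> ennreal (C * measure lebesgue A powr (1 - \<mu> / real DIM('a)))"
proof -
  define N where "N = real DIM('a)"
  have N: "0 < N" by (simp add: N_def)
  obtain C where C: "0 < C" and ball: "\<And>R. 0 < R \<Longrightarrow> (\<integral>\<^sup>+x. indicator (ball (0::'a) R) x * ennreal (norm x powr (- \<mu>)) \<partial>lborel)
    \<le> ennreal (C * R powr (N - \<mu>))"
    using nn_integral_weight_ball[OF \<mu>] unfolding N_def by blast
  have "(\<integral>\<^sup>+x. indicator A x * ennreal (norm (x::'a) powr (- \<mu>)) \<partial>lebesgue)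
    \<le> ennreal ((C + 1) * measure lebesgue A powr (1 - \<mu> / N))"
    if A: "A \<in> sets lebesgue" "emeasure lebesgue A \<noteq> \<infinity>" for A
  proof -
    define a where "a = measure lebesgue A"
    have ea: "emeasure lebesgue A = ennreal a"
      unfolding a_def using A(2) by (intro emeasure_eq_ennreal_measure) simp
    show ?thesis
    proof (cases "a = 0")
      case True
      then have "AE x in lebesgue. x \<notin> A"
        using A ea by (intro AE_not_in) auto
      then have "AE x in lebesgue. indicator A x * ennreal (norm (x::'a) powr (- \<mu>)) = 0"
        by eventually_elim simp
      then have "(\<integral>\<^sup>+x. indicator A x * ennreal (norm (x::'a) powr (- \<mu>)) \<partial>lebesgue) = (\<integral>\<^sup>+x. 0 \<partial>(lebesgue :: 'a measure))"
        by (rule nn_integral_cong_AE)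
      then show ?thesis by simp
    next
      case False
      then have a: "0 < a" by (simp add: a_def less_le)
      define R where "R = a powr (1 / N)"
      have R: "0 < R" using a by (simp add: R_def)
      have "(\<integral>\<^sup>+x. indicator A x * ennreal (norm (x::'a) powr (- \<mu>)) \<partial>lebesgue)
        \<le> (\<integral>\<^sup>+x. indicator (ball (0::'a) R) x * ennreal (norm x powr (- \<mu>)) + ennreal (R powr (- \<mu>)) * indicator A x \<partial>lebesgue)"
      proof (rule nn_integral_mono)
        fix x :: 'a
        show "indicator A x * ennreal (norm x powr (- \<mu>)) \<le> indicator (ball 0 R) x * ennreal (norm x powr (- \<mu>)) + ennreal (R powr (- \<mu>)) * indicator A x"
        proof (cases "norm x < R")
          case False
          then have "norm x powr (- \<mu>) \<le> R powr (- \<mu>)"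
            using R \<mu> by (intro powr_mono2') auto
          then show ?thesis using False by (auto simp: indicator_def intro!: ennreal_leI)
        qed (auto simp: indicator_def)
      qed
      also have "\<dots> = (\<integral>\<^sup>+x. indicator (ball (0::'a) R) x * ennreal (norm x powr (- \<mu>)) \<partial>lebesgue)
          + (\<integral>\<^sup>+x. ennreal (R powr (- \<mu>)) * indicator A x \<partial>lebesgue)"
        using A(1)
        by (intro nn_integral_add borel_measurable_times_ennreal borel_measurable_const borel_measurable_indicator
            measurable_completion) simp_all
      also have "(\<integral>\<^sup>+x. indicator (ball (0::'a) R) x * ennreal (norm x powr (- \<mu>)) \<partial>lebesgue)
          = (\<integral>\<^sup>+x. indicator (ball (0::'a) R) x * ennreal (norm x powr (- \<mu>)) \<partial>lborel)"
        by (rule nn_integral_completion)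
      also have "(\<integral>\<^sup>+x. ennreal (R powr (- \<mu>)) * indicator A x \<partial>lebesgue) = ennreal (R powr (- \<mu>)) * ennreal a"
        using A(1) ea by (simp add: nn_integral_cmult_indicator)
      also have "(\<integral>\<^sup>+x. indicator (ball (0::'a) R) x * ennreal (norm x powr (- \<mu>)) \<partial>lborel) + ennreal (R powr (- \<mu>)) * ennreal a
          \<le> ennreal (C * R powr (N - \<mu>)) + ennreal (R powr (- \<mu>)) * ennreal a"
        by (intro add_right_mono ball R)
      also have "\<dots> = ennreal (C * R powr (N - \<mu>) + R powr (- \<mu>) * a)"
        using C a by (simp add: ennreal_mult)
      also have "R powr (- \<mu>) * a = a powr (1 - \<mu> / N)"
        using a N by (simp add: R_def powr_powr powr_diff powr_minus divide_inverse mult.commute)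
      also have "R powr (N - \<mu>) = a powr (1 - \<mu> / N)"
        using a N by (simp add: R_def powr_powr diff_divide_distrib)
      finally show ?thesis by (simp add: a_def algebra_simps)
    qed
  qed
  then show ?thesis using C unfolding N_def by (intro exI[of _ "C + 1"]) auto
qed

section \<open>Uniform bounds\<close>

text \<open>The radius makes the ball exactly twice as large as the level set, and \<open>l\<close>
  makes l^(1 - p) d F' equal to l a, so that the bracket is 5 l a and the constant 30. A positive F'
  replaces the integral itself, which may be 0 and would then give l = 0.\<close>

lemma (in bounded_domain) level_set_inequality_optimized:
  fixes N v :: real
  defines "N \<equiv> real DIM('a)" and "v \<equiv> unit_ball_vol (real DIM('a))"
  assumes "1 < p" "p < real DIM('a)" and sol: "weak_solution \<Omega> p f u"
    and k: "0 < k" and d: "0 < d" and F': "0 < F'"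
    and FF': "(\<integral>x. indicator {x\<in>\<Omega>. k < \<bar>u x\<bar>} x * \<bar>f x (u x)\<bar> \<partial>M) \<le> F'"
  shows "d * measure M {x\<in>\<Omega>. k + d < \<bar>u x\<bar>}
    \<le> 30 * (2 / v) powr (1 / N) * measure M {x\<in>\<Omega>. k < \<bar>u x\<bar>} powr (1 / N + 1 - 1 / p) * (d * F') powr (1 / p)"
proof -
  define a where "a = measure M {x\<in>\<Omega>. k < \<bar>u x\<bar>}"
  have N: "0 < N" and v: "0 < v" by (simp_all add: N_def v_def)
  have "u \<in> borel_measurable M"
    using sol W0_weak_gradient(2)[of u] by (simp add: weak_solution_def in_Lp_def)
  then have m: "{x\<in>\<Omega>. c < \<bar>u x\<bar>} \<in> sets M" for c
    using borel_measurable_pred_less[of "\<lambda>_. c" M "\<lambda>x. \<bar>u x\<bar>"]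
    by (simp add: pred_def space_restrict_space)
  show ?thesis
  proof (cases "a = 0")
    case True
    have "measure M {x\<in>\<Omega>. k + d < \<bar>u x\<bar>} \<le> a"
      unfolding a_def using d by (intro finite_measure_mono m) auto
    then have "measure M {x\<in>\<Omega>. k + d < \<bar>u x\<bar>} = 0"
      using True by (simp add: antisym)
    then show ?thesis by simp
  next
    case False
    then have a: "0 < a" by (simp add: a_def less_le)
    define r where "r = (2 * a / v) powr (1 / N)"
    define l where "l = (d * F' / a) powr (1 / p)"
    have r: "0 < r" using a v by (simp add: r_def)
    have l: "0 < l" using a d F' by (simp add: l_def)
    have rN: "r ^ DIM('a) = 2 * a / v"
    proof -
      have "r ^ DIM('a) = r powr N" unfolding N_def using r by (rule powr_realpow[symmetric])
      also have "\<dots> = 2 * a / v" using a v N by (simp add: r_def powr_powr)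
      finally show ?thesis .
    qed
    have "d * measure M {x\<in>\<Omega>. k + d < \<bar>u x\<bar>}
        \<le> 6 * r * (4 * l * a + l powr (1 - p) * d * (\<integral>x. indicator {x\<in>\<Omega>. k < \<bar>u x\<bar>} x * \<bar>f x (u x)\<bar> \<partial>M))"
      unfolding a_def
    proof (rule level_set_inequality[OF assms(3,4) sol _ d l r])
      show "2 * measure M {x\<in>\<Omega>. k < \<bar>u x\<bar>} \<le> unit_ball_vol (real DIM('a)) * r ^ DIM('a)"
      proof -
        have "unit_ball_vol (real DIM('a)) * r ^ DIM('a) = 2 * a"
          unfolding rN v_def[symmetric] using v by simp
        then show ?thesis by (simp only: a_def)
      qed
    qed (use k in simp)
    also have "\<dots> \<le> 6 * r * (4 * l * a + l powr (1 - p) * d * F')"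
      using r l d FF' by (intro mult_left_mono add_left_mono) auto
    also have "l powr (1 - p) * d * F' = l * a"
    proof -
      have "l powr p = d * F' / a"
        using assms(3) a d F' by (simp add: l_def powr_powr)
      then have "l powr (1 - p) = l * (a / (d * F'))"
        using l by (simp add: powr_diff)
      then show ?thesis using d F' by simp
    qed
    also have "6 * r * (4 * l * a + l * a) = 30 * (r * (l * a))" by simp
    also have "l * a = (d * F') powr (1 / p) * a powr (1 - 1 / p)"
      using a d F' by (simp add: l_def powr_divide powr_diff)
    also have "r = (2 / v) powr (1 / N) * a powr (1 / N)"
      using powr_mult[of "2 / v" a "1 / N"] a v by (simp add: r_def)
    also have "30 * ((2 / v) powr (1 / N) * a powr (1 / N) * ((d * F') powr (1 / p) * a powr (1 - 1 / p)))
        = 30 * (2 / v) powr (1 / N) * (a powr (1 / N) * a powr (1 - 1 / p)) * (d * F') powr (1 / p)"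
      by (simp only: mult_ac)
    also have "a powr (1 / N) * a powr (1 - 1 / p) = a powr (1 / N + 1 - 1 / p)"
      by (simp add: add_diff_eq flip: powr_add)
    finally show ?thesis by (simp add: a_def)
  qed
qed

text \<open>A point with 2^j k < |u| <= 2^(j + 1) k is charged to the j-th term alone, where |u|^m
  is at most (2 (2^j k))^m. Each term integrates over the full level set instead of the shell, so
  only the inequality "one term is at most the sum" is used.\<close>

lemma (in bounded_domain) source_bound:
  fixes u :: "'a \<Rightarrow> real"
  assumes u: "u \<in> borel_measurable M" and fi: "integrable M (\<lambda>x. f x (u x))"
    and f: "\<And>x s. x \<in> closure \<Omega> - {0} \<Longrightarrow> \<bar>f x s\<bar> \<le> norm x powr (- \<mu>) * ft s"
    and ft: "\<And>s. k < \<bar>s\<bar> \<Longrightarrow> ft s \<le> \<epsilon> * \<bar>s\<bar> powr m"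
    and k: "0 < k" and \<epsilon>: "0 < \<epsilon>" and m: "0 \<le> m"
    and C: "0 < C" and weight: "\<And>A. A \<in> sets lebesgue \<Longrightarrow> emeasure lebesgue A \<noteq> \<infinity> \<Longrightarrow>
      (\<integral>\<^sup>+x. indicator A x * ennreal (norm (x::'a) powr (- \<mu>)) \<partial>lebesgue) \<le> ennreal (C * measure lebesgue A powr \<kappa>)"
  shows "ennreal (\<integral>x. indicator {x\<in>\<Omega>. k < \<bar>u x\<bar>} x * \<bar>f x (u x)\<bar> \<partial>M)
    \<le> (\<Sum>j. ennreal (\<epsilon> * C * (2 * (2 ^ j * k)) powr m * measure M {x\<in>\<Omega>. 2 ^ j * k < \<bar>u x\<bar>} powr \<kappa>))"
proof -
  define A where "A t = {x\<in>\<Omega>. t < \<bar>u x\<bar>}" for t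
  have Am: "A t \<in> sets M" for t
    using u borel_measurable_pred_less[of "\<lambda>_. t" M "\<lambda>x. \<bar>u x\<bar>"]
    by (simp add: pred_def space_restrict_space A_def)
  have sub: "A t \<subseteq> \<Omega>" for t by (auto simp: A_def)
  have AL: "A t \<in> sets lebesgue" for t
    using Am[of t] sets_\<Omega> by (auto simp: sets_restrict_space_iff)
  have mA: "measure lebesgue (A t) = measure M (A t)" for t
    using sub sets_\<Omega> by (simp add: measure_restrict_space)
  have eA: "emeasure lebesgue (A t) \<noteq> \<infinity>" for t
    using sub sets_\<Omega> emeasure_eq_measure[of "A t"] by (simp add: emeasure_restrict_space)
  have wm: "(\<lambda>x::'a. ennreal (norm x powr (- \<mu>))) \<in> borel_measurable M"
    by (intro measurable_restrict_space1 measurable_completion) simp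
  have int: "integrable M (\<lambda>x. indicator (A k) x * \<bar>f x (u x)\<bar>)"
    using integrable_mult_indicator[OF Am[of k] integrable_abs[OF fi]] by simp
  define c where "c j = \<epsilon> * (2 * (2 ^ j * k)) powr m" for j :: nat
  have c: "0 \<le> c j" for j using \<epsilon> by (simp add: c_def)
  \<comment> \<open>The growth hypothesis says nothing at the origin, a null set.\<close>
  have ne: "AE x in M. x \<noteq> 0"
  proof -
    have "AE x in lebesgue. x \<noteq> (0::'a)" by (intro AE_completion AE_lborel_singleton)
    then show ?thesis using sets_\<Omega> by (simp add: AE_restrict_space_iff eventually_mono)
  qed
  have "ennreal (\<integral>x. indicator (A k) x * \<bar>f x (u x)\<bar> \<partial>M) = (\<integral>\<^sup>+x. ennreal (indicator (A k) x * \<bar>f x (u x)\<bar>) \<partial>M)"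
    by (rule nn_integral_eq_integral[OF int, symmetric]) simp
  also have "\<dots> \<le> (\<integral>\<^sup>+x. (\<Sum>j. ennreal (c j) * (indicator (A (2 ^ j * k)) x * ennreal (norm x powr (- \<mu>)))) \<partial>M)"
  proof (rule nn_integral_mono_AE)
    show "AE x in M. ennreal (indicator (A k) x * \<bar>f x (u x)\<bar>)
        \<le> (\<Sum>j. ennreal (c j) * (indicator (A (2 ^ j * k)) x * ennreal (norm x powr (- \<mu>))))"
      using ne AE_space
    proof eventually_elim
      case (elim x)
      show ?case
      proof (cases "x \<in> A k")
        case True
        then have x: "x \<in> \<Omega>" "k < \<bar>u x\<bar>" by (auto simp: A_def)
        obtain j where j: "2 ^ j * k < \<bar>u x\<bar>" "\<bar>u x\<bar> \<le> 2 * (2 ^ j * k)"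
          using dyadic_scale[OF k x(2)] by blast
        have "\<bar>f x (u x)\<bar> \<le> norm x powr (- \<mu>) * ft (u x)"
          using f[of x "u x"] x(1) elim closure_subset[of \<Omega>] by auto
        also have "\<dots> \<le> norm x powr (- \<mu>) * (\<epsilon> * \<bar>u x\<bar> powr m)"
          by (intro mult_left_mono ft x) simp
        also have "\<dots> \<le> norm x powr (- \<mu>) * c j"
          unfolding c_def using \<epsilon> m j(2) by (intro mult_left_mono powr_mono2) auto
        finally have "ennreal \<bar>f x (u x)\<bar> \<le> ennreal (c j) * ennreal (norm x powr (- \<mu>))"
          using c[of j] by (simp add: mult.commute ennreal_leI flip: ennreal_mult)
        also have "\<dots> = ennreal (c j) * (indicator (A (2 ^ j * k)) x * ennreal (norm x powr (- \<mu>)))"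
          using x j by (simp add: A_def)
        also have "\<dots> \<le> (\<Sum>j. ennreal (c j) * (indicator (A (2 ^ j * k)) x * ennreal (norm x powr (- \<mu>))))"
          by (rule single_le_suminf_ennreal)
        finally show ?thesis using True by simp
      qed simp
    qed
  qed
  also have "\<dots> = (\<Sum>j. \<integral>\<^sup>+x. ennreal (c j) * (indicator (A (2 ^ j * k)) x * ennreal (norm x powr (- \<mu>))) \<partial>M)"
    by (intro nn_integral_suminf borel_measurable_times_ennreal borel_measurable_const borel_measurable_indicator Am wm)
  also have "\<dots> \<le> (\<Sum>j. ennreal (\<epsilon> * C * (2 * (2 ^ j * k)) powr m * measure M (A (2 ^ j * k)) powr \<kappa>))"
  proof (intro suminf_le summableI)
    fix j :: nat
    have "(\<integral>\<^sup>+x. ennreal (c j) * (indicator (A (2 ^ j * k)) x * ennreal (norm x powr (- \<mu>))) \<partial>M)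
        = ennreal (c j) * (\<integral>\<^sup>+x. indicator (A (2 ^ j * k)) x * ennreal (norm x powr (- \<mu>)) \<partial>M)"
      by (intro nn_integral_cmult borel_measurable_times_ennreal borel_measurable_indicator Am wm)
    also have "(\<integral>\<^sup>+x. indicator (A (2 ^ j * k)) x * ennreal (norm x powr (- \<mu>)) \<partial>M)
        = (\<integral>\<^sup>+x. indicator (A (2 ^ j * k)) x * ennreal (norm x powr (- \<mu>)) \<partial>lebesgue)"
      using sets_\<Omega> sub[of "2 ^ j * k"]
      by (subst nn_integral_restrict_space) (auto intro!: nn_integral_cong simp: indicator_def)
    also have "ennreal (c j) * \<dots> \<le> ennreal (c j) * ennreal (C * measure M (A (2 ^ j * k)) powr \<kappa>)"
      using weight[OF AL eA, of "2 ^ j * k"] by (intro mult_left_mono) (simp_all add: mA)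
    also have "\<dots> = ennreal (c j * (C * measure M (A (2 ^ j * k)) powr \<kappa>))"
      using c[of j] C by (intro ennreal_mult[symmetric]) auto
    also have "c j * (C * measure M (A (2 ^ j * k)) powr \<kappa>) = \<epsilon> * C * (2 * (2 ^ j * k)) powr m * measure M (A (2 ^ j * k)) powr \<kappa>"
      by (simp add: c_def mult_ac)
    finally show "(\<integral>\<^sup>+x. ennreal (c j) * (indicator (A (2 ^ j * k)) x * ennreal (norm x powr (- \<mu>))) \<partial>M)
      \<le> ennreal (\<epsilon> * C * (2 * (2 ^ j * k)) powr m * measure M (A (2 ^ j * k)) powr \<kappa>)" .
  qed
  finally show ?thesis by (simp add: A_def)
qed

text \<open>\<open>Lp_norm\<close> is infinite outside Lp, so a real bound already contains
  integrability of the power; the rest is Chebyshev's inequality.\<close>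

lemma (in bounded_domain) chebyshev_level_set:
  fixes u :: "'a \<Rightarrow> real"
  assumes q: "0 < q" and u: "Lp_norm M q u \<le> ereal c" and c: "0 \<le> c" and t: "0 < t"
  shows "t powr q * measure M {x\<in>\<Omega>. t < \<bar>u x\<bar>} \<le> c powr q"
proof -
  have i: "in_Lp M q u" using u by (auto simp: Lp_norm_def split: if_splits)
  have [measurable]: "u \<in> borel_measurable M" using i by (simp add: in_Lp_def)
  let ?A = "{x\<in>\<Omega>. t < \<bar>u x\<bar>}"
  have Am: "?A \<in> sets M"
    using borel_measurable_pred_less[of "\<lambda>_. t" M "\<lambda>x. \<bar>u x\<bar>"]
    by (simp add: pred_def space_restrict_space)
  let ?I = "\<integral>x. norm (u x) powr q \<partial>M"
  have I0: "0 \<le> ?I" by (intro integral_nonneg_AE) auto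
  have "?I powr (1 / q) \<le> c" using u i by (simp add: Lp_norm_def)
  then have "(?I powr (1 / q)) powr q \<le> c powr q" using q by (intro powr_mono2) auto
  then have I: "?I \<le> c powr q" using q I0 by (simp add: powr_powr)
  have "t powr q * measure M ?A = (\<integral>x. t powr q * indicator ?A x \<partial>M)"
  proof -
    have "?A \<inter> space M = ?A" by (auto simp: space_restrict_space)
    then show ?thesis by simp
  qed
  also have "\<dots> \<le> ?I"
  proof (rule integral_mono)
    show "integrable M (\<lambda>x. t powr q * indicator ?A x)"
      using Am by (intro integrable_mult_right integrable_real_indicator) (auto simp: emeasure_eq_measure)
    show "integrable M (\<lambda>x. norm (u x) powr q)" using i by (simp add: in_Lp_def)
    show "t powr q * indicator ?A x \<le> norm (u x) powr q" for x
      using q t by (auto simp: indicator_def intro!: powr_mono2)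
  qed
  finally show ?thesis using I by linarith
qed

theorem corollary4p1:
  fixes \<Omega> :: "'a::euclidean_space set"
    and p \<mu> C0 :: real
    and f :: "'a \<Rightarrow> real \<Rightarrow> real"
    and ft :: "real \<Rightarrow> real"
    and u :: "nat \<Rightarrow> 'a \<Rightarrow> real"
  assumes "1 < p" and "p < real DIM('a)"
    and "open \<Omega>" and "bounded \<Omega>" and "strictly_convex \<Omega>" and "C2_boundary \<Omega>"
    and "0 \<in> closure \<Omega>"
    and "caratheodory \<Omega> f"
    and "hypothesis_H0' \<Omega> p \<mu> f ft"
    and "hypothesis_H1 ft"
    and "\<And>k. weak_solution \<Omega> p f (u k)"
    and "C0 > 0"
    and "\<And>k. Lp_norm (lebesgue_on \<Omega>) (critical_exponent (real DIM('a)) p) (u k) \<le> ereal C0"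
  shows "\<exists>C>0. \<forall>k. Linf_norm (lebesgue_on \<Omega>) (u k) \<le> ereal C"
proof -
  interpret bounded_domain \<Omega> p
    using assms by unfold_locales auto
  define N where "N = real DIM('a)"
  define v where "v = unit_ball_vol (real DIM('a))"
  define P where "P = critical_exponent N p"
  define m where "m = hardy_sobolev_exponent N p \<mu> - 1"
  have \<mu>: "0 < \<mu>" "\<mu> < p" and ft: "((\<lambda>s. ft s / \<bar>s\<bar> powr m) \<longlongrightarrow> 0) at_infinity"
    and fb: "\<And>x s. x \<in> closure \<Omega> - {0} \<Longrightarrow> \<bar>f x s\<bar> \<le> norm x powr (- \<mu>) * ft s"
    using assms(9) by (auto simp: hypothesis_H0'_def m_def N_def)
  have pN: "1 < p" "p < N" using assms by (simp_all add: N_def)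
  have P: "0 < P" using pN by (simp add: P_def critical_exponent_def)
  have m: "m = p * (N - \<mu>) / (N - p) - 1" by (simp add: m_def hardy_sobolev_exponent_def)
  have "0 \<le> m"
  proof -
    have "1 * (N - \<mu>) \<le> p * (N - \<mu>)" using pN \<mu> by (intro mult_right_mono) linarith+
    then have "N - p \<le> p * (N - \<mu>)" using \<mu> by (simp only: mult_1)
    then have "1 \<le> p * (N - \<mu>) / (N - p)" using pN by (subst pos_le_divide_eq) auto
    then show ?thesis by (simp add: m)
  qed
  have "\<exists>s0. \<forall>s. s0 \<le> \<bar>s\<bar> \<longrightarrow> ft s / \<bar>s\<bar> powr m < e" if "0 < e" for e
    using order_tendstoD(2)[OF ft that] by (auto simp: eventually_at_infinity)
  then have "\<forall>e. \<exists>s0. 0 < e \<longrightarrow> (\<forall>s. s0 \<le> \<bar>s\<bar> \<longrightarrow> ft s / \<bar>s\<bar> powr m < e)" by blast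
  \<comment> \<open>The threshold is a function of the required smallness and is obtained from
    \<open>ft\<close> alone, hence common to all solutions of the sequence.\<close>
  from choice[OF this] obtain S where S: "\<And>e s. 0 < e \<Longrightarrow> S e \<le> \<bar>s\<bar> \<Longrightarrow> ft s / \<bar>s\<bar> powr m < e"
    by blast
  have \<mu>N: "\<mu> < real DIM('a)" using \<mu> pN by (simp add: N_def)
  obtain C2 where C2: "0 < C2" and weight: "\<And>A. A \<in> sets lebesgue \<Longrightarrow> emeasure lebesgue A \<noteq> \<infinity> \<Longrightarrow>
      (\<integral>\<^sup>+x. indicator A x * ennreal (norm (x::'a) powr (- \<mu>)) \<partial>lebesgue) \<le> ennreal (C2 * measure lebesgue A powr (1 - \<mu> / N))"
    using nn_integral_weight[OF \<mu>(1) \<mu>N] unfolding N_def by blast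
  define C1 where "C1 = 30 * (2 / v) powr (1 / N)"
  \<comment> \<open>The \<open>+ 1\<close> ensures the positivity of Y that Stampacchia's lemma asks
    for.\<close>
  define Y where "Y = measure M (space M) + 1"
  have v: "0 < v" by (simp add: v_def)
  have C1: "0 < C1" using v by (simp add: C1_def)
  have Y: "0 < Y" by (simp add: Y_def add_nonneg_pos)
  have B: "0 < C0 powr P" using assms(12) by simp
  \<comment> \<open>K is fixed before any member of the sequence is considered, so it bounds all of
    them.\<close>
  obtain K where K: "0 < K" and vanish: "\<And>a F. level_bounds N p \<mu> C1 C2 (C0 powr P) Y S a F \<Longrightarrow> a K = 0"
    using level_bounds_vanish[OF pN \<mu> C1 C2 B Y, of S] by blast
  have "Linf_norm M (u i) \<le> ereal K" for i
  proof -
    define a where "a t = measure M {x\<in>\<Omega>. t < \<bar>u i x\<bar>}" for t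
    define F where "F k = (\<integral>x. indicator {x\<in>\<Omega>. k < \<bar>u i x\<bar>} x * \<bar>f x (u i x)\<bar> \<partial>M)" for k
    have sol: "weak_solution \<Omega> p f (u i)" by fact
    have [measurable]: "u i \<in> borel_measurable M"
      using sol W0_weak_gradient(2)[of "u i"] by (simp add: weak_solution_def in_Lp_def)
    have Am: "{x\<in>\<Omega>. t < \<bar>u i x\<bar>} \<in> sets M" for t
      using borel_measurable_pred_less[of "\<lambda>_. t" M "\<lambda>x. \<bar>u i x\<bar>"]
      by (simp add: pred_def space_restrict_space)
    have fi: "integrable M (\<lambda>x. f x (u i x))"
      by (rule weak_solution_source_integrable[OF pN(1) assms(2) sol])
    have "level_bounds N p \<mu> C1 C2 (C0 powr P) Y S a F"
      unfolding level_bounds_def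
    proof (intro conjI allI impI)
      show "0 \<le> a t" for t by (simp add: a_def)
      show "antimono a"
        unfolding a_def by (intro antimonoI finite_measure_mono Am) auto
      show "a t \<le> Y" for t
        using bounded_measure[of "{x\<in>\<Omega>. t < \<bar>u i x\<bar>}"] by (simp add: a_def Y_def)
      show "t powr critical_exponent N p * a t \<le> C0 powr P" if "0 < t" for t
        unfolding a_def P_def[symmetric]
        by (rule chebyshev_level_set[OF P _ _ that]) (use assms(12,13) in \<open>simp_all add: P_def N_def\<close>)
      show "d * a (k + d) \<le> C1 * a k powr (1 / N + 1 - 1 / p) * (d * F') powr (1 / p)"
        if "0 < k" "0 < d" "0 < F'" "F k \<le> F'" for k d F'
        using level_set_inequality_optimized[OF pN(1) assms(2) sol that(1-3)] that(4)
        by (simp add: a_def F_def C1_def N_def v_def)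
      show "ennreal (F k) \<le> (\<Sum>j. ennreal (\<epsilon> * C2 * (2 * (2 ^ j * k)) powr (hardy_sobolev_exponent N p \<mu> - 1)
          * a (2 ^ j * k) powr (1 - \<mu> / N)))"
        if "0 < \<epsilon>" "S \<epsilon> \<le> k" "0 < k" for \<epsilon> k
        unfolding F_def a_def m_def[symmetric]
      proof (rule source_bound[OF _ fi fb _ that(3,1) \<open>0 \<le> m\<close> C2 weight])
        fix s assume s: "k < \<bar>s\<bar>"
        then have "ft s / \<bar>s\<bar> powr m < \<epsilon>" using that by (intro S) auto
        then show "ft s \<le> \<epsilon> * \<bar>s\<bar> powr m" using s that(3) by (simp add: pos_divide_less_eq)
      qed auto
    qed
    then have "a K = 0" by (rule vanish)
    then have "emeasure M {x\<in>\<Omega>. K < \<bar>u i x\<bar>} = 0"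
      by (simp add: a_def emeasure_eq_measure)
    then have "AE x in M. x \<notin> {x\<in>\<Omega>. K < \<bar>u i x\<bar>}"
      using Am by (intro AE_not_in) auto
    then have "AE x in M. ereal \<bar>u i x\<bar> \<le> ereal K"
      using AE_space by eventually_elim (auto simp: space_restrict_space)
    then show ?thesis
      unfolding Linf_norm_def by (intro esssup_I) measurable
  qed
  then show ?thesis using K by blast
qed

end
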